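(* Let $K$ be a non-perfect, separably closed field of characteristic three, $X=\mathbb{P}^2_K$ and $Y=\mathbb{P}^2_{K^{1/3}}$. Let $E$ be a quartic in $X$ which is non-smooth at the two distinct points $P$ and $Q$, and let $P^1,Q^1$ be the points of $Y$ lying over $P,Q$ respectively. If $P^1$ and $Q^1$ are $K^{1/3}$-rational points of $1$-type $1$ or $2$, then there are $u,t\in K^{1/3}$ such that: (i) the set $\{P^1,Q^1\}$ is $X$-equivalent to $\{(t:t^2:1),(u:u^2:1)\}$ if $P^1$ or $Q^1$ has $1$-type $2$; (ii) the set $\{P^1,Q^1\}$ is $X$-equivalent to $\{(t:0:1),(0:u:1)\}$ otherwise.
   Context: The natural base change morphism is $\pi\colon Y\to X$; each point of $X$ has exactly one point of $Y$ lying over it. A quartic in $X$ is a plane curve defined by a homogeneous polynomial of degree four with coefficients in $K$; it is non-smooth at a point if its base extension to the algebraic closure $\overline{K}$ is singular at the point lying over it. A closed subscheme of $Y$ is $X$-invariant if its ideal sheaf is stable under all local $\mathcal{O}_X$-derivations of $\mathcal{O}_Y$; equivalently, it is the base change of a closed subscheme of $X$ (defined by homogeneous polynomials with coefficients in $K$). The $1$-type of a point of $Y$ is the smallest degree of an $X$-invariant one-dimensional subvariety of $Y$ whose ideal sheaf is contained in the ideal sheaf of the point, i.e. which passes through the point. Two sets $\{V_1,\ldots,V_n\}$ and $\{W_1,\ldots,W_n\}$ of closed subschemes of $Y$ are $X$-equivalent if there is an automorphism $T$ of $X$ whose base change to $Y$ sends $V_i$ to $W_i$ for all $i$ (after a suitable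 ordering).
   Formalization: The quartic E is additionally assumed geometrically reduced (no repeated factor over the algebraic closure), automatic for integral E; without it the claim fails, e.g. E = y² times a conic with points (t:0:1), (u:0:1), t≠u not in K. *)

theory Defs
  imports
    "HOL-Analysis.Analysis"
    "HOL-Computational_Algebra.Squarefree"
    "HOL-Algebra.Algebraic_Closure_Type"
begin

text \<open>
  \<^bold>\<open>Fields.\<close>  The field \<open>K\<close> is a type \<open>'k\<close>.  Its algebraic closure is the library type
  \<open>'k alg_closure\<close>, with embedding \<open>to_ac\<close>; \<open>K\<close> and its extension generated by all cube roots
  (in characteristic three) are regarded as subfields of it.
\<close>

definition perfect_field :: "'k::Fields.field itself \<Rightarrow> bool" where
  "perfect_field _ \<longleftrightarrow>
     (\<forall>p :: 'k Polynomial.poly. Factorial_Ring.irreducible p \<longrightarrow> coprime p (pderiv p))"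

definition separably_closed :: "'k::Fields.field itself \<Rightarrow> bool" where
  "separably_closed _ \<longleftrightarrow>
     (\<forall>p :: 'k Polynomial.poly. Polynomial.degree p > 0 \<and> coprime p (pderiv p) \<longrightarrow>
        (\<exists>x. Polynomial.poly p x = 0))"

definition base_field :: "'k::Fields.field alg_closure set" where
  "base_field = range to_ac"

definition cuberoot_field :: "'k::Fields.field alg_closure set" where
  "cuberoot_field = {x. x ^ 3 \<in> base_field}"

text \<open>
  \<^bold>\<open>Polynomials in three variables.\<close>  Iterated univariate polynomials: the innermost variable is the
  first homogeneous coordinate, the outermost one is the third.
\<close>

type_synonym 'a poly3 = "'a Polynomial.poly Polynomial.poly Polynomial.poly"

definition coeff3 :: "'a::zero poly3 \<Rightarrow> nat \<Rightarrow> nat \<Rightarrow> nat \<Rightarrow> 'a" where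
  "coeff3 F i j k = Polynomial.coeff (Polynomial.coeff (Polynomial.coeff F k) j) i"

definition homogeneous :: "nat \<Rightarrow> 'a::zero poly3 \<Rightarrow> bool" where
  "homogeneous d F \<longleftrightarrow> (\<forall>i j k. coeff3 F i j k \<noteq> 0 \<longrightarrow> i + j + k = d)"

definition const3 :: "'a::zero \<Rightarrow> 'a poly3" where
  "const3 c = [:[:[:c:]:]:]"

definition coords3 :: "'a::comm_semiring_1 poly3 ^ 3" where
  "coords3 = vector [[:[:[:0, 1:]:]:], [:[:0, 1:]:], [:0, 1:]]"

text \<open>
  Substitution of the entries of \<open>v\<close> for the three variables, after applying \<open>h\<close> to the
  coefficients.
\<close>

definition subst3 :: "('a::zero \<Rightarrow> 'b::comm_semiring_1) \<Rightarrow> 'a poly3 \<Rightarrow> 'b ^ 3 \<Rightarrow> 'b" where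
  "subst3 h F v =
     Polynomial.poly (map_poly (\<lambda>G.
       Polynomial.poly (map_poly (\<lambda>H.
         Polynomial.poly (map_poly h H) (v $ 1)) G) (v $ 2)) F) (v $ 3)"

definition partial_derivs :: "'a::idom poly3 \<Rightarrow> 'a poly3 set" where
  "partial_derivs F = {map_poly (map_poly pderiv) F, map_poly pderiv F, pderiv F}"

text \<open>The homogeneous coordinate ring \<open>S[x, y, z]\<close> of the projective plane over a subfield \<open>S\<close>.\<close>

definition poly_ring3 :: "'a::comm_ring_1 set \<Rightarrow> 'a poly3 ring" where
  "poly_ring3 S = ring_of_type_algebra\<lparr>carrier := {F. \<forall>i j k. coeff3 F i j k \<in> S}\<rparr>"

text \<open>
  \<^bold>\<open>Points of projective planes.\<close>  A (not necessarily closed) point of the projective plane over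
  the subfield \<open>S\<close> is a homogeneous prime ideal of \<open>S[x, y, z]\<close> not containing all three
  coordinates.  The point lying under a point of the base extension is obtained by contraction.
\<close>

definition homogeneous_ideal :: "'a::comm_ring_1 poly3 set \<Rightarrow> bool" where
  "homogeneous_ideal I \<longleftrightarrow>
     (\<forall>F\<in>I. \<exists>n G. (\<forall>d\<le>n. homogeneous d (G d) \<and> G d \<in> I) \<and> F = (\<Sum>d\<le>n. G d))"

definition plane_point :: "'a::comm_ring_1 set \<Rightarrow> 'a poly3 set \<Rightarrow> bool" where
  "plane_point S p \<longleftrightarrow>
     primeideal p (poly_ring3 S) \<and> homogeneous_ideal p \<and> (\<exists>i. coords3 $ i \<notin> p)"

definition lies_over :: "'a::comm_ring_1 set \<Rightarrow> 'a poly3 set \<Rightarrow> 'a poly3 set \<Rightarrow> bool" where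
  "lies_over S q p \<longleftrightarrow> q \<inter> carrier (poly_ring3 S) = p"

text \<open>The homogeneous ideal of the point with homogeneous coordinates \<open>v\<close>.\<close>

definition point_ideal :: "'a::comm_ring_1 set \<Rightarrow> 'a ^ 3 \<Rightarrow> 'a poly3 set" where
  "point_ideal S v =
     Idl\<^bsub>poly_ring3 S\<^esub> {F \<in> carrier (poly_ring3 S). (\<exists>d. homogeneous d F) \<and> subst3 id F v = 0}"

definition rational_point :: "'a::comm_ring_1 set \<Rightarrow> 'a poly3 set \<Rightarrow> bool" where
  "rational_point S p \<longleftrightarrow> (\<exists>v. v \<noteq> 0 \<and> (\<forall>i. v $ i \<in> S) \<and> p = point_ideal S v)"

text \<open>\<^bold>\<open>Plane curves.\<close>  A curve is given by a defining homogeneous polynomial.\<close>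

definition plane_curve :: "'a::comm_ring_1 set \<Rightarrow> nat \<Rightarrow> 'a poly3 \<Rightarrow> bool" where
  "plane_curve S d F \<longleftrightarrow> F \<in> carrier (poly_ring3 S) \<and> F \<noteq> 0 \<and> homogeneous d F"

definition nonsmooth_at :: "'k::Fields.field alg_closure poly3 \<Rightarrow> 'k alg_closure poly3 set \<Rightarrow> bool" where
  "nonsmooth_at F p \<longleftrightarrow>
     (\<exists>r. plane_point UNIV r \<and> lies_over base_field r p \<and> F \<in> r \<and> partial_derivs F \<subseteq> r)"

text \<open>Reducedness of the base extension of the curve to the algebraic closure.\<close>

definition geometrically_reduced :: "'k::Fields.field alg_closure poly3 \<Rightarrow> bool" where
  "geometrically_reduced F \<longleftrightarrow> squarefree F"

text \<open>
  \<^bold>\<open>Invariance.\<close>  A closed subscheme of the plane \<open>Y\<close> over \<^const>\<open>cuberoot_field\<close>, given by its ideal,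
  is invariant if it is the base change of a closed subscheme of the plane \<open>X\<close> over
  \<^const>\<open>base_field\<close>, i.e.\ if its ideal is generated by polynomials over \<^const>\<open>base_field\<close>.
  A curve of \<open>Y\<close> passes through a point if its ideal is contained in that of the point.
\<close>

definition X_invariant :: "'k::Fields.field alg_closure poly3 set \<Rightarrow> bool" where
  "X_invariant I \<longleftrightarrow>
     Idl\<^bsub>poly_ring3 cuberoot_field\<^esub> (I \<inter> carrier (poly_ring3 base_field)) = I"

definition one_type :: "'k::Fields.field alg_closure poly3 set \<Rightarrow> nat" where
  "one_type p =
     (LEAST d. \<exists>G. plane_curve cuberoot_field d G \<and>
        X_invariant (PIdl\<^bsub>poly_ring3 cuberoot_field\<^esub> G) \<and>
        PIdl\<^bsub>poly_ring3 cuberoot_field\<^esub> G \<subseteq> p)"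

text \<open>
  The automorphisms of \<open>X\<close> are given by the invertible \<open>3 \<times> 3\<close> matrices over \<open>K\<close>.  The base change
  of such an automorphism sends the subscheme with ideal \<open>I\<close> to the subscheme whose ideal consists
  of the polynomials with pullback in \<open>I\<close>; in particular it sends the point with coordinates \<open>v\<close> to
  the point with coordinates \<open>A v\<close>.
\<close>

definition X_automorphism_image ::
    "'k::Fields.field ^ 3 ^ 3 \<Rightarrow> 'k alg_closure poly3 set \<Rightarrow> 'k alg_closure poly3 set" where
  "X_automorphism_image A I =
     {F \<in> carrier (poly_ring3 cuberoot_field).
        subst3 const3 F ((\<chi> i j. const3 (to_ac (A $ i $ j))) *v coords3) \<in> I}"

definition X_equivalent ::
    "'k::Fields.field alg_closure poly3 set set \<Rightarrow> 'k alg_closure poly3 set set \<Rightarrow> bool" where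
  "X_equivalent V W \<longleftrightarrow> (\<exists>A :: 'k ^ 3 ^ 3. invertible A \<and> X_automorphism_image A ` V = W)"

end

theory Submission
  imports Defs
begin

text \<open>
  Write \<open>v\<close>, \<open>w\<close> for coordinate vectors of the two points over \<open>K\<^sup>1\<^sup>/\<^sup>3\<close>, choose \<open>e\<close> over \<open>K\<close> so that
  \<open>v, w, e\<close> is a basis, and use the corresponding coordinates \<open>s, r, x\<close>.  Singularity at both points gives
  \<open>F = k s\<^sup>2 r\<^sup>2 + x (\<alpha> s\<^sup>2 r + \<beta> s r\<^sup>2) + x\<^sup>2 (a s\<^sup>2 + b s r + c r\<^sup>2) + x\<^sup>3 m\<close>.
  Every derivation \<open>D\<close> of \<open>K\<^sup>1\<^sup>/\<^sup>3\<close> over \<open>K\<close> kills \<open>F\<close>, and \<open>K\<close> is the set of elements killed by all of them.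
  If neither point is \<open>K\<close>-rational, the resulting relations between the coefficients force \<open>k \<noteq> 0\<close>
  (otherwise \<open>x\<^sup>2\<close> divides \<open>F\<close>), \<open>\<alpha>\<^sup>2 = k a\<close> and \<open>\<beta>\<^sup>2 = k c\<close>.  Hence \<open>k\<^sup>3 F\<close> is the square of a quadratic form modulo
  \<open>x\<^sup>3\<close>, and in characteristic three that form is itself killed by all derivations: there is a conic over \<open>K\<close>
  through both points.  The same relations show that no line over \<open>K\<close> contains two such points.

  A point of 1-type 2 lies on no \<open>K\<close>-line, so a \<open>K\<close>-conic through it is smooth and, \<open>K\<close> being
  quadratically closed, projectively equivalent to \<open>x\<^sup>2 = y z\<close>.  If the second point is \<open>K\<close>-rational, a common
  conic is found in the pencil spanned by \<open>x\<^sup>2 - y z\<close> and \<open>x y - t\<^sup>3 z\<^sup>2\<close>, which pass through \<open>(t : t\<^sup>2 : 1)\<close>.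
\<close>

no_notation fps_nth (infixl \<open>$\<close> 75)

subsection \<open>Evaluation of polynomials in three variables\<close>

text \<open>Why the square modulo \<open>x^3\<close> yields a conic over \<open>K\<close>:
  derivations kill cubes, in particular \<open>k^3\<close> and \<open>x^3\<close>. Let
  \<open>G\<close> be the quadratic form with \<open>G^2\<close> congruent to \<open>k^3 F\<close>.
  Since \<open>D F = 0\<close>, the form \<open>2 G (D G)\<close> is divisible by
  \<open>x^3\<close>. As \<open>k\<close> is nonzero, \<open>x\<close> does not divide
  \<open>G\<close>, so \<open>x^3\<close> divides \<open>D G\<close>, which has degree only two;
  hence \<open>D G = 0\<close>. The formal proof verifies this by comparing coefficients. The
  coordinates \<open>s\<close>, \<open>r\<close>, \<open>x\<close> are themselves moved by
  \<open>D\<close>, because their coefficients lie outside \<open>K\<close>. Derivations are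
  therefore applied to values at vectors over \<open>K\<close>, where \<open>F\<close> takes values
  in \<open>K\<close>; since \<open>K\<close> is infinite, an identity between such values is an
  identity of polynomials. Rational points need a separate treatment: every derivation moves a
  vector representing such a point only along itself, so the relations at that point become
  empty.\<close>

definition is_hom :: "('a::comm_ring_1 \<Rightarrow> 'b::comm_ring_1) \<Rightarrow> bool" where
  "is_hom h \<longleftrightarrow> h 0 = 0 \<and> h 1 = 1 \<and> (\<forall>x y. h (x + y) = h x + h y) \<and> (\<forall>x y. h (x * y) = h x * h y)"

lemma is_hom_id: "is_hom id"
  by (simp add: is_hom_def)

lemma map_poly_add:
  assumes "h 0 = 0" "\<And>x y. h (x + y) = h x + h y"
  shows "map_poly h (p + q) = map_poly h p + map_poly h q"
  by (intro poly_eqI) (simp add: coeff_map_poly assms)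

text \<open>\<open>subst3\<close> consists of three nested evaluations of this kind, so its ring
  laws follow by applying this rule three times.\<close>

lemma is_hom_poly:
  assumes "is_hom h"
  shows "is_hom (\<lambda>p. Polynomial.poly (map_poly h p) x)"
proof -
  note h = assms[unfolded is_hom_def]
  have add: "map_poly h (p + q) = map_poly h p + map_poly h q" for p q
    using h by (intro map_poly_add) auto
  have mult: "map_poly h (p * q) = map_poly h p * map_poly h q" for p q
  proof (induction p)
    case (pCons a p)
    then show ?case
      using h by (simp add: map_poly_pCons map_poly_smult add)
  qed simp
  show ?thesis
    using h by (simp add: is_hom_def add mult)
qed

lemma is_hom_subst3:
  assumes "is_hom h"
  shows "is_hom (\<lambda>F. subst3 h F v)"
  unfolding subst3_def by (intro is_hom_poly assms)

lemma subst3_0: "is_hom h \<Longrightarrow> subst3 h 0 v = 0"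
  and subst3_1: "is_hom h \<Longrightarrow> subst3 h 1 v = 1"
  and subst3_add: "is_hom h \<Longrightarrow> subst3 h (F + G) v = subst3 h F v + subst3 h G v"
  and subst3_mult: "is_hom h \<Longrightarrow> subst3 h (F * G) v = subst3 h F v * subst3 h G v"
  using is_hom_subst3[of h v] by (auto simp: is_hom_def)

lemma subst3_const3: "is_hom h \<Longrightarrow> subst3 h (const3 c) v = h c"
  by (simp add: subst3_def const3_def is_hom_def map_poly_pCons)

lemma coords3_nth:
  "coords3 $ 1 = [:[:[:0, 1:]:]:]" "coords3 $ 2 = [:[:0, 1:]:]" "coords3 $ 3 = [:0, 1:]"
  by (simp_all add: coords3_def)

lemma subst3_coords3:
  assumes "is_hom h"
  shows "subst3 h (coords3 $ i) v = v $ i"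
proof -
  have "i = 1 \<or> i = 2 \<or> i = 3" by (rule exhaust_3)
  then show ?thesis
    using assms by (auto simp: coords3_nth subst3_def is_hom_def map_poly_pCons)
qed

definition eval3 :: "'a::comm_ring_1 poly3 \<Rightarrow> 'a ^ 3 \<Rightarrow> 'a" where
  "eval3 F v = subst3 id F v"

lemmas eval3_simps [simp] = subst3_0[OF is_hom_id, folded eval3_def] subst3_1[OF is_hom_id, folded eval3_def]
  subst3_add[OF is_hom_id, folded eval3_def] subst3_mult[OF is_hom_id, folded eval3_def]
  subst3_const3[OF is_hom_id, folded eval3_def, simplified] subst3_coords3[OF is_hom_id, folded eval3_def]

lemma eval3_minus [simp]: "eval3 (- F) v = - eval3 F v"
  using eval3_simps(3)[of F "- F" v] by (simp add: eq_neg_iff_add_eq_0 add.commute)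

lemma eval3_diff [simp]: "eval3 (F - G) v = eval3 F v - eval3 G v"
  using eval3_simps(3)[of F "- G" v] by simp

lemma eval3_power [simp]: "eval3 (F ^ n) v = eval3 F v ^ n"
  by (induction n) auto

lemma eval3_sum [simp]: "eval3 (sum f A) v = (\<Sum>a\<in>A. eval3 (f a) v)"
  by (induction A rule: infinite_finite_induct) auto

text \<open>A nonzero polynomial in one variable has finitely many roots; this is applied to one
  variable at a time, the outermost first. The set \<open>S\<close> is left arbitrary because
  derivations control values only at vectors over \<open>K\<close>, and there \<open>S\<close> is
  \<open>base_field\<close>.\<close>

lemma eval3_eq_0_imp:
  fixes F :: "'a::idom poly3"
  assumes "infinite S" and "\<And>v. (\<forall>i. v $ i \<in> S) \<Longrightarrow> eval3 F v = 0"
  shows "F = 0"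
proof -
  have *: "p = 0" if "\<And>x. x \<in> S \<Longrightarrow> Polynomial.poly p x = 0" for p :: "'a Polynomial.poly"
  proof (rule ccontr)
    assume "p \<noteq> 0"
    then have "finite {x. Polynomial.poly p x = 0}" by (rule poly_roots_finite)
    moreover have "S \<subseteq> {x. Polynomial.poly p x = 0}" using that by auto
    ultimately show False using assms(1) finite_subset by blast
  qed
  have ev: "Polynomial.poly (map_poly (\<lambda>G. Polynomial.poly (map_poly (\<lambda>H. Polynomial.poly H x) G) y) F) z = 0"
    if "x \<in> S" "y \<in> S" "z \<in> S" for x y z
  proof -
    have "eval3 F (vector [x, y, z]) = 0"
      by (rule assms(2)) (use that in \<open>auto simp: forall_3\<close>)
    then show ?thesis by (simp add: eval3_def subst3_def id_def)
  qed
  have "Polynomial.coeff (Polynomial.coeff F k) j = 0" for j k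
  proof (rule *)
    fix x assume x: "x \<in> S"
    have "map_poly (\<lambda>H. Polynomial.poly H x) (Polynomial.coeff F k) = 0"
    proof (rule *)
      fix y assume y: "y \<in> S"
      have "map_poly (\<lambda>G. Polynomial.poly (map_poly (\<lambda>H. Polynomial.poly H x) G) y) F = 0"
        by (rule *) (use x y ev in auto)
      from arg_cong[OF this, of "\<lambda>p. Polynomial.coeff p k"]
      show "Polynomial.poly (map_poly (\<lambda>H. Polynomial.poly H x) (Polynomial.coeff F k)) y = 0"
        by (simp add: coeff_map_poly)
    qed
    from arg_cong[OF this, of "\<lambda>p. Polynomial.coeff p j"]
    show "Polynomial.poly (Polynomial.coeff (Polynomial.coeff F k) j) x = 0"
      by (simp add: coeff_map_poly)
  qed
  then show ?thesis by (intro poly_eqI) simp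
qed

lemma eval3_inject:
  fixes F G :: "'a::idom poly3"
  assumes "infinite (UNIV :: 'a set)" and "\<And>v. eval3 F v = eval3 G v"
  shows "F = G"
  using eval3_eq_0_imp[OF assms(1), of "F - G"] assms(2) by simp

section \<open>Polynomial rings over subrings\<close>

definition polyset :: "'a::zero set \<Rightarrow> 'a Polynomial.poly set" where
  "polyset S = {p. \<forall>i. Polynomial.coeff p i \<in> S}"

definition is_subring :: "'a::comm_ring_1 set \<Rightarrow> bool" where
  "is_subring S \<longleftrightarrow> 1 \<in> S \<and> (\<forall>x\<in>S. - x \<in> S) \<and> (\<forall>x\<in>S. \<forall>y\<in>S. x + y \<in> S \<and> x * y \<in> S)"

lemma is_subring_0: "is_subring S \<Longrightarrow> 0 \<in> S"
  unfolding is_subring_def by (metis add.right_inverse)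

lemma is_subring_sum: "is_subring S \<Longrightarrow> (\<And>a. a \<in> A \<Longrightarrow> f a \<in> S) \<Longrightarrow> sum f A \<in> S"
  by (induction A rule: infinite_finite_induct) (auto simp: is_subring_0, simp add: is_subring_def)

text \<open>Coefficients of a product are finite sums of products. Three iterations give
  \<open>carrier (poly_ring3 S)\<close>, so convolution sums are met in one variable only.\<close>

lemma is_subring_polyset:
  assumes "is_subring S"
  shows "is_subring (polyset S)"
proof -
  have "Polynomial.coeff (p * q) n \<in> S" if "p \<in> polyset S" "q \<in> polyset S" for p q n
    using that assms unfolding coeff_mult
    by (intro is_subring_sum assms) (simp add: polyset_def is_subring_def)
  then show ?thesis
    using assms is_subring_0[OF assms]
    by (auto simp: is_subring_def polyset_def)
qed

lemma carrier_poly_ring3: "carrier (poly_ring3 S) = {F. \<forall>i j k. coeff3 F i j k \<in> S}"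
  by (simp add: poly_ring3_def)

lemma carrier_poly_ring3': "carrier (poly_ring3 S) = polyset (polyset (polyset S))"
  by (auto simp: carrier_poly_ring3 polyset_def coeff3_def)

lemma is_subring_carrier: "is_subring S \<Longrightarrow> is_subring (carrier (poly_ring3 S))"
  unfolding carrier_poly_ring3' by (intro is_subring_polyset)

lemma poly_ring3_simps:
  "mult (poly_ring3 S) = (*)" "add (poly_ring3 S) = (+)" "one (poly_ring3 S) = 1"
  "zero (poly_ring3 S) = 0"
  by (simp_all add: poly_ring3_def ring_of_type_algebra_def)

lemma cring_poly_ring3:
  assumes "is_subring S"
  shows "cring (poly_ring3 S)"
proof -
  note * = is_subring_carrier[OF assms] is_subring_0[OF is_subring_carrier[OF assms]]
  have "\<exists>y\<in>carrier (poly_ring3 S). y + x = 0" if "x \<in> carrier (poly_ring3 S)" for x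
    by (rule bexI[of _ "- x"]) (use * that in \<open>auto simp: is_subring_def\<close>)
  then show ?thesis
    using * by (intro cringI abelian_groupI comm_monoidI)
      (auto simp: poly_ring3_simps is_subring_def algebra_simps)
qed

lemma ideal_poly_ring3I:
  assumes "is_subring S" and "I \<subseteq> carrier (poly_ring3 S)" and "0 \<in> I"
    and "\<And>F G. F \<in> I \<Longrightarrow> G \<in> I \<Longrightarrow> F + G \<in> I"
    and "\<And>F G. F \<in> carrier (poly_ring3 S) \<Longrightarrow> G \<in> I \<Longrightarrow> F * G \<in> I"
  shows "ideal I (poly_ring3 S)"
proof -
  interpret cring "poly_ring3 S" by (rule cring_poly_ring3[OF assms(1)])
  have neg: "- F \<in> I" if "F \<in> I" for F
    using assms(5)[of "- 1" F] that is_subring_carrier[OF assms(1)] by (simp add: is_subring_def)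
  have inv: "\<ominus>\<^bsub>poly_ring3 S\<^esub> F = - F" if "F \<in> I" for F
  proof (rule minus_equality)
    show "- F \<oplus>\<^bsub>poly_ring3 S\<^esub> F = \<zero>\<^bsub>poly_ring3 S\<^esub>" by (simp add: poly_ring3_simps)
  qed (use that neg assms(2) in auto)
  have "subgroup I (add_monoid (poly_ring3 S))"
  proof (rule add.subgroupI)
    fix a b assume "a \<in> I" "b \<in> I"
    then show "a \<oplus>\<^bsub>poly_ring3 S\<^esub> b \<in> I" using assms(4) by (simp add: poly_ring3_simps)
  next
    fix a assume "a \<in> I"
    then show "\<ominus>\<^bsub>poly_ring3 S\<^esub> a \<in> I" using inv neg by simp
  qed (use assms in auto)
  then show ?thesis
    using assms(5) by (intro idealI) (auto simp: poly_ring3_simps ring_axioms, metis mult.commute)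
qed

lemma const3_carrier: "is_subring S \<Longrightarrow> c \<in> S \<Longrightarrow> const3 c \<in> carrier (poly_ring3 S)"
  by (auto simp: carrier_poly_ring3 const3_def coeff3_def coeff_pCons is_subring_0 split: nat.split)

lemma coords3_carrier: "is_subring S \<Longrightarrow> coords3 $ i \<in> carrier (poly_ring3 S)"
  using exhaust_3[of i] is_subring_0[of S]
  by (auto simp: carrier_poly_ring3 coords3_nth coeff3_def coeff_pCons is_subring_def split: nat.split)

text \<open>Horner's scheme in each variable builds the polynomial from constants in
  \<open>S\<close> and coordinates. Facts about evaluation and substitution can then be checked on
  these generators while the coefficient ring is kept in view.\<close>

lemma poly3_induct [consumes 1, case_names const coord add mult]:
  fixes F :: "'a::comm_ring_1 poly3"
  assumes "F \<in> carrier (poly_ring3 S)"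
    and const: "\<And>c. c \<in> S \<Longrightarrow> P (const3 c)"
    and coord: "\<And>i. P (coords3 $ i)"
    and add: "\<And>F G. P F \<Longrightarrow> P G \<Longrightarrow> P (F + G)"
    and mult: "\<And>F G. P F \<Longrightarrow> P G \<Longrightarrow> P (F * G)"
  shows "P F"
proof -
  have coeff_cons: "a \<in> T" "p \<in> polyset T" if "pCons a p \<in> polyset T" for a :: "'b::zero" and p T
  proof -
    have *: "Polynomial.coeff (pCons a p) n \<in> T" for n
      using that by (simp add: polyset_def)
    show "a \<in> T" using *[of 0] by simp
    show "p \<in> polyset T" using *[of "Suc _"] by (simp add: polyset_def)
  qed
  have 1: "P [:[:b:]:]" if "b \<in> polyset S" for b
    using that
  proof (induction b)
    case (pCons c b)
    have "[:[:pCons c b:]:] = const3 c + coords3 $ 1 * [:[:b:]:]"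
      by (simp add: const3_def coords3_nth)
    then show ?case using pCons coeff_cons by (metis add const coord mult)
  next
    case 0
    have "0 \<in> S" using 0 by (simp add: polyset_def)
    then show ?case using const[of 0] by (simp add: const3_def)
  qed
  have 2: "P [:a:]" if "a \<in> polyset (polyset S)" for a
    using that
  proof (induction a)
    case (pCons b a)
    have "[:pCons b a:] = [:[:b:]:] + coords3 $ 2 * [:a:]"
      by (simp add: coords3_nth)
    then show ?case using pCons coeff_cons 1 by (metis add coord mult)
  next
    case 0
    have "0 \<in> polyset S" using 0 by (simp add: polyset_def)
    then show ?case using 1[of 0] by simp
  qed
  show ?thesis
    using assms(1) unfolding carrier_poly_ring3'
  proof (induction F)
    case (pCons a F)
    have "pCons a F = [:a:] + coords3 $ 3 * F"
      by (simp add: coords3_nth)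
    then show ?case using pCons coeff_cons 2 by (metis add coord mult)
  next
    case 0
    have "0 \<in> polyset (polyset S)" using 0 by (simp add: polyset_def)
    then show ?case using 2[of 0] by simp
  qed
qed

lemma is_hom_const3: "is_hom const3"
  by (simp add: is_hom_def const3_def one_pCons)

abbreviation compose3 :: "'a::comm_ring_1 poly3 \<Rightarrow> 'a poly3 ^ 3 \<Rightarrow> 'a poly3" where
  "compose3 \<equiv> subst3 const3"

lemma univ_carrier: "F \<in> carrier (poly_ring3 UNIV)"
  by (simp add: carrier_poly_ring3)

lemma eval3_compose3: "eval3 (compose3 F W) v = eval3 F (\<chi> i. eval3 (W $ i) v)"
  using univ_carrier[of F]
  by (induction F rule: poly3_induct)
    (simp_all add: subst3_add subst3_mult subst3_const3 subst3_coords3 is_hom_const3)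

lemma compose3_carrier:
  assumes "is_subring S" "F \<in> carrier (poly_ring3 S)" "\<And>i. W $ i \<in> carrier (poly_ring3 S)"
  shows "compose3 F W \<in> carrier (poly_ring3 S)"
  using assms(2)
  by (induction F rule: poly3_induct)
    (use assms is_subring_carrier[OF assms(1)] in
      \<open>simp_all add: subst3_add subst3_mult subst3_const3 subst3_coords3 is_hom_const3
        const3_carrier is_subring_def\<close>)

lemma eval3_in:
  assumes "is_subring S" "F \<in> carrier (poly_ring3 S)" "\<And>i. v $ i \<in> S"
  shows "eval3 F v \<in> S"
  using assms(2) by (induction F rule: poly3_induct) (use assms in \<open>auto simp: is_subring_def\<close>)

subsection \<open>Homogeneous components\<close>

definition build3 :: "nat \<Rightarrow> (nat \<Rightarrow> nat \<Rightarrow> nat \<Rightarrow> 'a) \<Rightarrow> 'a::comm_ring_1 poly3" where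
  "build3 n C = (\<Sum>k<n. Polynomial.monom (\<Sum>j<n. Polynomial.monom (\<Sum>i<n. Polynomial.monom (C i j k) i) j) k)"

lemma coeff3_build3:
  "coeff3 (build3 n C) i j k = (if i < n \<and> j < n \<and> k < n then C i j k else 0)"
  by (auto simp: coeff3_def build3_def coeff_sum sum.If_cases if_distrib[of "\<lambda>p. Polynomial.coeff p _"] cong: if_cong)

lemma coeff3_eqI: "(\<And>i j k. coeff3 F i j k = coeff3 G i j k) \<Longrightarrow> F = G"
  by (intro poly_eqI) (simp add: coeff3_def)

lemma map_poly_sum_monom:
  assumes "h 0 = 0" "\<And>x y. h (x + y) = h x + h y"
  shows "map_poly h (\<Sum>k<(n::nat). Polynomial.monom (f k) k) = (\<Sum>k<n. Polynomial.monom (h (f k)) k)"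
  by (induction n) (simp_all add: map_poly_add assms map_poly_monom)

lemma eval3_build3:
  "eval3 (build3 n C) v = (\<Sum>k<n. \<Sum>j<n. \<Sum>i<n. C i j k * (v $ 1 ^ i * v $ 2 ^ j * v $ 3 ^ k))"
proof -
  have h1: "is_hom (\<lambda>H. Polynomial.poly (map_poly id H) (v $ 1))"
    by (intro is_hom_poly is_hom_id)
  have h2: "is_hom (\<lambda>G. Polynomial.poly (map_poly (\<lambda>H. Polynomial.poly (map_poly id H) (v $ 1)) G) (v $ 2))"
    by (intro is_hom_poly is_hom_id)
  show ?thesis
    unfolding eval3_def subst3_def build3_def
    apply (subst map_poly_sum_monom)
      subgoal using h2 by (simp add: is_hom_def)
      subgoal using h2 by (simp add: is_hom_def)
    apply (subst map_poly_sum_monom)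
      subgoal using h1 by (simp add: is_hom_def)
      subgoal using h1 by (simp add: is_hom_def)
    apply (simp add: poly_sum poly_monom sum_distrib_right)
    apply (simp add: mult_ac)
    done
qed

lemma coeff3_bounded:
  obtains n where "\<And>i j k. coeff3 F i j k \<noteq> 0 \<Longrightarrow> i < n \<and> j < n \<and> k < n"
proof -
  define A where "A = (\<Union>k\<le>Polynomial.degree F. \<Union>j\<le>Polynomial.degree (Polynomial.coeff F k).
     {..Polynomial.degree (Polynomial.coeff (Polynomial.coeff F k) j)} \<times> {j} \<times> {k})"
  have "finite A" by (simp add: A_def)
  have mem: "(i, j, k) \<in> A" if "coeff3 F i j k \<noteq> 0" for i j k
  proof -
    have "Polynomial.coeff F k \<noteq> 0" "Polynomial.coeff (Polynomial.coeff F k) j \<noteq> 0"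
      using that by (auto simp: coeff3_def)
    then show ?thesis
      using that by (auto simp: A_def coeff3_def le_degree)
  qed
  define B where "B = (\<lambda>(i, j, k). i + j + k) ` A"
  have "finite B" using \<open>finite A\<close> by (simp add: B_def)
  have "i < Suc (Max B) \<and> j < Suc (Max B) \<and> k < Suc (Max B)" if "coeff3 F i j k \<noteq> 0" for i j k
  proof -
    have "i + j + k \<in> B" using mem[OF that] unfolding B_def by force
    then have "i + j + k \<le> Max B" using \<open>finite B\<close> by simp
    then show ?thesis by auto
  qed
  then show ?thesis using that by blast
qed

lemma eval3_sum_coeff3:
  assumes "\<And>i j k. coeff3 F i j k \<noteq> 0 \<Longrightarrow> i < n \<and> j < n \<and> k < n"
  shows "eval3 F v = (\<Sum>k<n. \<Sum>j<n. \<Sum>i<n. coeff3 F i j k * (v $ 1 ^ i * v $ 2 ^ j * v $ 3 ^ k))"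
proof -
  have "F = build3 n (coeff3 F)"
    using assms by (intro coeff3_eqI) (auto simp: coeff3_build3)
  then have "eval3 F v = eval3 (build3 n (coeff3 F)) v" by simp
  then show ?thesis by (simp add: eval3_build3)
qed

text \<open>The cutoff \<open>Suc d\<close> loses nothing, as exponents with sum \<open>d\<close> do
  not exceed \<open>d\<close>.\<close>

definition hcomp :: "nat \<Rightarrow> 'a::comm_ring_1 poly3 \<Rightarrow> 'a poly3" where
  "hcomp d F = build3 (Suc d) (\<lambda>i j k. if i + j + k = d then coeff3 F i j k else 0)"

lemma coeff3_hcomp: "coeff3 (hcomp d F) i j k = (if i + j + k = d then coeff3 F i j k else 0)"
  by (auto simp: hcomp_def coeff3_build3)

lemma homogeneous_hcomp: "homogeneous d (hcomp d F)"
  by (simp add: homogeneous_def coeff3_hcomp)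

lemma hcomp_carrier: "is_subring S \<Longrightarrow> F \<in> carrier (poly_ring3 S) \<Longrightarrow> hcomp d F \<in> carrier (poly_ring3 S)"
  by (simp add: carrier_poly_ring3 coeff3_hcomp is_subring_0)

lemma eval3_homogeneous:
  assumes "homogeneous d F"
  shows "eval3 F (c *s v) = c ^ d * eval3 F v"
proof -
  obtain n where n: "\<And>i j k. coeff3 F i j k \<noteq> 0 \<Longrightarrow> i < n \<and> j < n \<and> k < n"
    using coeff3_bounded by blast
  have "coeff3 F i j k * ((c * x) ^ i * (c * y) ^ j * (c * z) ^ k) =
        c ^ d * (coeff3 F i j k * (x ^ i * y ^ j * z ^ k))" for i j k x y z
  proof (cases "coeff3 F i j k = 0")
    case False
    then have "d = i + j + k" using assms by (auto simp: homogeneous_def)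
    then show ?thesis by (simp add: power_mult_distrib power_add mult_ac)
  qed simp
  then show ?thesis
    by (simp add: eval3_sum_coeff3[OF n] sum_distrib_left)
qed

lemma sum_hcomp:
  assumes "\<And>i j k. coeff3 F i j k \<noteq> 0 \<Longrightarrow> i < n \<and> j < n \<and> k < n"
  shows "(\<Sum>d<3 * n. hcomp d F) = F"
proof (rule coeff3_eqI)
  fix i j k
  have "coeff3 (\<Sum>d<3 * n. hcomp d F) i j k = (\<Sum>d<3 * n. coeff3 (hcomp d F) i j k)"
    by (simp add: coeff3_def coeff_sum)
  also have "\<dots> = (if i + j + k < 3 * n then coeff3 F i j k else 0)"
    by (simp add: coeff3_hcomp)
  \<comment> \<open>Three exponents below \<open>n\<close> have a sum below \<open>3 * n\<close>, so
    every nonzero coefficient is in range.\<close>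
  also have "\<dots> = coeff3 F i j k"
    using assms[of i j k] by (cases "coeff3 F i j k = 0") auto
  finally show "coeff3 (\<Sum>d<3 * n. hcomp d F) i j k = coeff3 F i j k" .
qed

lemma eval3_smult_hcomp:
  assumes "\<And>i j k. coeff3 F i j k \<noteq> 0 \<Longrightarrow> i < n \<and> j < n \<and> k < n"
  shows "eval3 F (c *s v) = (\<Sum>d<3 * n. c ^ d * eval3 (hcomp d F) v)"
proof -
  have "eval3 F (c *s v) = eval3 (\<Sum>d<3 * n. hcomp d F) (c *s v)"
    using sum_hcomp[of F n] assms by simp
  also have "\<dots> = (\<Sum>d<3 * n. c ^ d * eval3 (hcomp d F) v)"
    by (simp add: eval3_homogeneous[OF homogeneous_hcomp])
  finally show ?thesis .
qed

lemma sum_powers_eq_0_imp: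
  fixes a :: "nat \<Rightarrow> 'a::idom"
  assumes "infinite (UNIV :: 'a set)" and "\<And>c. (\<Sum>d<n. c ^ d * a d) = 0" and "d < n"
  shows "a d = 0"
proof -
  define p where "p = (\<Sum>d<n. Polynomial.monom (a d) d)"
  have "Polynomial.poly p c = 0" for c
    using assms(2)[of c] by (simp add: p_def poly_sum poly_monom mult.commute)
  then have "p = 0" using assms(1) poly_roots_finite[of p] by auto
  then have "Polynomial.coeff p d = 0" by simp
  then show ?thesis using assms(3) by (simp add: p_def coeff_sum)
qed

text \<open>As a function of \<open>c\<close>, \<open>eval3 F (c *s v)\<close> is a polynomial whose
  coefficients are the values at \<open>v\<close> of the homogeneous components; over an infinite
  domain all of them must vanish.\<close>

lemma eval3_hcomp_eq_0:
  fixes F :: "'a::idom poly3"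
  assumes "infinite (UNIV :: 'a set)" and "\<And>c. eval3 F (c *s v) = 0"
  shows "eval3 (hcomp d F) v = 0"
proof -
  obtain n where n: "\<And>i j k. coeff3 F i j k \<noteq> 0 \<Longrightarrow> i < n \<and> j < n \<and> k < n"
    using coeff3_bounded by blast
  \<comment> \<open>Enlarging the bound puts the index \<open>d\<close> inside the summation
    range.\<close>
  define m where "m = max n (Suc d)"
  have m: "\<And>i j k. coeff3 F i j k \<noteq> 0 \<Longrightarrow> i < m \<and> j < m \<and> k < m"
    using n unfolding m_def by fastforce
  have "d < 3 * m" by (auto simp: m_def max_def)
  then show ?thesis
    using sum_powers_eq_0_imp[OF assms(1), where n = "3 * m" and a = "\<lambda>d. eval3 (hcomp d F) v" and d = d]
      assms(2) eval3_smult_hcomp[of F m] m by simp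
qed

text \<open>Comparing powers of \<open>c\<close> shows that a component of degree other than
  \<open>d\<close> has only zero values. This suits forms that are given by a formula for their
  values rather than by coefficients.\<close>

lemma homogeneousI:
  fixes F :: "'a::idom poly3"
  assumes "infinite (UNIV :: 'a set)" and "\<And>c v. eval3 F (c *s v) = c ^ d * eval3 F v"
  shows "homogeneous d F"
  unfolding homogeneous_def
proof (intro allI impI, rule ccontr)
  fix i j k
  assume nz: "coeff3 F i j k \<noteq> 0" and ne: "i + j + k \<noteq> d"
  obtain n where n: "\<And>i j k. coeff3 F i j k \<noteq> 0 \<Longrightarrow> i < n \<and> j < n \<and> k < n"
    using coeff3_bounded by blast
  define m where "m = max n (Suc d)"
  have m: "\<And>i j k. coeff3 F i j k \<noteq> 0 \<Longrightarrow> i < m \<and> j < m \<and> k < m"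
    using n unfolding m_def by fastforce
  have "d < 3 * m" by (auto simp: m_def max_def)
  have "eval3 (hcomp (i + j + k) F) v = 0" for v
  proof -
    have "(\<Sum>e<3 * m. c ^ e * (eval3 (hcomp e F) v - (if e = d then eval3 F v else 0))) = 0" for c
    proof -
      have "(\<Sum>e<3 * m. c ^ e * (eval3 (hcomp e F) v - (if e = d then eval3 F v else 0))) =
        (\<Sum>e<3 * m. c ^ e * eval3 (hcomp e F) v) - (\<Sum>e<3 * m. if e = d then c ^ e * eval3 F v else 0)"
        unfolding sum_subtractf[symmetric] by (intro sum.cong refl) (simp add: right_diff_distrib)
      also have "\<dots> = eval3 F (c *s v) - c ^ d * eval3 F v"
        using eval3_smult_hcomp[of F m c v] m \<open>d < 3 * m\<close> by simp
      finally show ?thesis using assms(2) by simp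
    qed
    from sum_powers_eq_0_imp[OF assms(1) this, of "i + j + k"]
    show ?thesis using m[OF nz] ne by auto
  qed
  then have "hcomp (i + j + k) F = 0" by (intro eval3_eq_0_imp[OF assms(1)]) auto
  then have "coeff3 (hcomp (i + j + k) F) i j k = 0" by (simp add: coeff3_def)
  then show False using nz by (simp add: coeff3_hcomp)
qed

lemma eval3_homogeneous_sum:
  assumes "homogeneous d F"
  shows "eval3 F v =
    (\<Sum>k\<le>d. \<Sum>j\<le>d - k. coeff3 F (d - k - j) j k * (v $ 1 ^ (d - k - j) * v $ 2 ^ j * v $ 3 ^ k))"
proof -
  define t where "t i j k = coeff3 F i j k * (v $ 1 ^ i * v $ 2 ^ j * v $ 3 ^ k)" for i j k
  have t0: "t i j k = 0" if "i + j + k \<noteq> d" for i j k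
    using assms that by (metis homogeneous_def mult_zero_left t_def)
  have bound: "i < Suc d \<and> j < Suc d \<and> k < Suc d" if "coeff3 F i j k \<noteq> 0" for i j k
    using assms that by (fastforce simp: homogeneous_def)
  have "eval3 F v = (\<Sum>k<Suc d. \<Sum>j<Suc d. \<Sum>i<Suc d. t i j k)"
    unfolding t_def by (rule eval3_sum_coeff3) (use bound in blast)
  also have "\<dots> = (\<Sum>k\<le>d. \<Sum>j\<le>d - k. t (d - k - j) j k)"
  proof (rule sum.cong)
    fix k assume "k \<in> {..d}"
    have "(\<Sum>j<Suc d. \<Sum>i<Suc d. t i j k) = (\<Sum>j\<le>d - k. \<Sum>i<Suc d. t i j k)"
      using \<open>k \<in> {..d}\<close> by (intro sum.mono_neutral_right) (auto simp del: sum.lessThan_Suc intro!: sum.neutral t0)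
    also have "\<dots> = (\<Sum>j\<le>d - k. t (d - k - j) j k)"
    proof (rule sum.cong)
      fix j assume "j \<in> {..d - k}"
      have "(\<Sum>i<Suc d. t i j k) = (\<Sum>i\<in>{d - k - j}. t i j k)"
        using \<open>j \<in> {..d - k}\<close> \<open>k \<in> {..d}\<close> by (intro sum.mono_neutral_right) (auto intro!: t0)
      then show "(\<Sum>i<Suc d. t i j k) = t (d - k - j) j k" by simp
    qed simp
    finally show "(\<Sum>j<Suc d. \<Sum>i<Suc d. t i j k) = (\<Sum>j\<le>d - k. t (d - k - j) j k)" .
  qed auto
  finally show ?thesis by (simp add: t_def)
qed

subsection \<open>Rational points\<close>

text \<open>Vanishing at all multiples of \<open>v\<close> means that every homogeneous component
  vanishes at \<open>v\<close>: the right-hand side is an ideal, and each of its elements is a sum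
  of generators. Membership in the ideal of a point thus becomes a matter of evaluation.\<close>

lemma point_ideal_eq:
  fixes v :: "'a::idom ^ 3"
  assumes "infinite (UNIV :: 'a set)" and "is_subring S"
  shows "point_ideal S v = {F \<in> carrier (poly_ring3 S). \<forall>c. eval3 F (c *s v) = 0}" (is "_ = ?I")
proof -
  interpret cring "poly_ring3 S" by (rule cring_poly_ring3[OF assms(2)])
  let ?G = "{F \<in> carrier (poly_ring3 S). (\<exists>d. homogeneous d F) \<and> eval3 F v = 0}"
  have I: "ideal ?I (poly_ring3 S)"
    using is_subring_carrier[OF assms(2)] is_subring_0[OF is_subring_carrier[OF assms(2)]]
    by (intro ideal_poly_ring3I assms(2)) (auto simp: is_subring_def)
  have G: "?G \<subseteq> ?I"
    by (auto simp: eval3_homogeneous)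
  have 1: "Idl\<^bsub>poly_ring3 S\<^esub> ?G \<subseteq> ?I"
    by (rule genideal_minimal[OF I G])
  have sub: "?G \<subseteq> carrier (poly_ring3 S)" by auto
  interpret J: ideal "Idl\<^bsub>poly_ring3 S\<^esub> ?G" "poly_ring3 S"
    by (rule genideal_ideal[OF sub])
  have "F \<in> Idl\<^bsub>poly_ring3 S\<^esub> ?G" if "F \<in> ?I" for F
  proof -
    obtain n where n: "\<And>i j k. coeff3 F i j k \<noteq> 0 \<Longrightarrow> i < n \<and> j < n \<and> k < n"
      using coeff3_bounded by blast
    have "hcomp d F \<in> ?G" for d
      using that assms by (auto simp: hcomp_carrier eval3_hcomp_eq_0 intro: homogeneous_hcomp)
    then have mem: "hcomp d F \<in> Idl\<^bsub>poly_ring3 S\<^esub> ?G" for d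
      using genideal_self[OF sub] by blast
    have "(\<Sum>d<m. hcomp d F) \<in> Idl\<^bsub>poly_ring3 S\<^esub> ?G" for m :: nat
    proof (induction m)
      case 0
      show ?case using J.zero_closed by (simp add: poly_ring3_simps)
    next
      case (Suc m)
      then show ?case using J.a_closed[OF Suc.IH mem[of m]] by (simp add: poly_ring3_simps)
    qed
    from this[of "3 * n"] show ?thesis using sum_hcomp[of F n] n by simp
  qed
  with 1 show ?thesis unfolding point_ideal_def eval3_def[symmetric] by blast
qed

lemma point_ideal_smult:
  fixes v :: "'a::Fields.field ^ 3"
  assumes "infinite (UNIV :: 'a set)" and "is_subring S" and "c \<noteq> 0"
  shows "point_ideal S (c *s v) = point_ideal S v"
proof -
  have "eval3 F (b *s v) = 0" if "\<forall>a. eval3 F (a *s (c *s v)) = 0" for F b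
    using that[THEN spec, of "b / c"] assms(3) by (simp add: vector_smult_assoc)
  then show ?thesis
    unfolding point_ideal_eq[OF assms(1,2)] by (auto simp: vector_smult_assoc)
qed

section \<open>The base field and its cube roots in characteristic three\<close>

locale char3_field =
  fixes K_type :: "'k::Fields.field itself"
  assumes char3: "CHAR('k) = 3" and inf: "infinite (UNIV :: 'k set)"
begin

lemma inf_ac: "infinite (UNIV :: 'k alg_closure set)"
  using inf finite_imageD[OF _ inj_to_ac] finite_subset[OF subset_UNIV] by blast

lemma three_eq_0: "(3 :: 'k alg_closure) = 0"
proof -
  have "(of_nat CHAR('k) :: 'k) = 0" by (rule of_nat_CHAR)
  then have "to_ac (3 :: 'k) = 0" using char3 by simp
  then show ?thesis by simp
qed

lemma cube_add: "(x + y) ^ 3 = x ^ 3 + (y :: 'k alg_closure) ^ 3"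
proof -
  have "(x + y) ^ 3 = x ^ 3 + y ^ 3 + 3 * (x * x * y + x * y * y)"
    by (simp add: power3_eq_cube algebra_simps)
  then show ?thesis by (simp add: three_eq_0)
qed

lemma is_subring_base: "is_subring (base_field :: 'k alg_closure set)"
  unfolding is_subring_def base_field_def
  by (auto simp flip: to_ac_add to_ac_mult to_ac_minus to_ac_1)

lemma base_subset_cuberoot: "base_field \<subseteq> (cuberoot_field :: 'k alg_closure set)"
  by (auto simp: cuberoot_field_def base_field_def simp flip: to_ac_power)

lemma is_subring_cuberoot: "is_subring (cuberoot_field :: 'k alg_closure set)"
proof -
  note b = is_subring_base[unfolded is_subring_def]
  have "- x \<in> cuberoot_field" if "x \<in> cuberoot_field" for x :: "'k alg_closure"
    using that b by (simp add: cuberoot_field_def)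
  moreover have "x + y \<in> cuberoot_field" "x * y \<in> cuberoot_field"
    if "x \<in> cuberoot_field" "y \<in> cuberoot_field" for x y :: "'k alg_closure"
    using that b by (auto simp: cuberoot_field_def cube_add power_mult_distrib)
  ultimately show ?thesis using b by (auto simp: is_subring_def cuberoot_field_def)
qed

lemma carrier_mono: "S \<subseteq> T \<Longrightarrow> carrier (poly_ring3 S) \<subseteq> carrier (poly_ring3 T)"
  by (auto simp: carrier_poly_ring3)

lemmas carrier_base_cuberoot = subsetD[OF carrier_mono[OF base_subset_cuberoot]]

text \<open>The pulled back polynomial has at \<open>w\<close> the value of the original at the
  image of \<open>w\<close> under the matrix, and matrices commute with scaling.\<close>

lemma X_automorphism_image_point_ideal:
  fixes v :: "'k alg_closure ^ 3"
  shows "X_automorphism_image A (point_ideal cuberoot_field v) =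
    point_ideal cuberoot_field ((\<chi> i j. to_ac (A $ i $ j)) *v v)"
proof -
  let ?W = "(\<chi> i j. const3 (to_ac (A $ i $ j))) *v coords3 :: 'k alg_closure poly3 ^ 3"
  let ?M = "(\<chi> i j. to_ac (A $ i $ j)) :: 'k alg_closure ^ 3 ^ 3"
  have W: "(\<chi> i. eval3 (?W $ i) w) = ?M *v w" for w
    by (simp add: vec_eq_iff matrix_vector_mult_def)
  have base: "to_ac (A $ i $ j) \<in> cuberoot_field" for i j
    using base_subset_cuberoot by (auto simp: base_field_def)
  have "?W $ i \<in> carrier (poly_ring3 cuberoot_field)" for i
    using is_subring_carrier[OF is_subring_cuberoot]
    by (auto simp: matrix_vector_mult_def is_subring_def
        intro!: is_subring_sum[OF is_subring_carrier[OF is_subring_cuberoot]] const3_carrier[OF is_subring_cuberoot]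
          coords3_carrier[OF is_subring_cuberoot] base)
  then have "compose3 F ?W \<in> carrier (poly_ring3 cuberoot_field)"
    if "F \<in> carrier (poly_ring3 cuberoot_field)" for F
    by (intro compose3_carrier is_subring_cuberoot that)
  moreover have "?M *v (c *s w) = c *s (?M *v w)" for c w
    by (simp add: vec_eq_iff matrix_vector_mult_def sum_distrib_left mult_ac)
  ultimately show ?thesis
    unfolding X_automorphism_image_def point_ideal_eq[OF inf_ac is_subring_cuberoot]
    by (auto simp: eval3_compose3 W)
qed

section \<open>Invariant curves and the 1-type\<close>

lemma X_invariant_curve_through_point:
  fixes v :: "'k alg_closure ^ 3"
  assumes "plane_curve base_field d H" and "eval3 H v = 0"
  shows "\<exists>G. plane_curve cuberoot_field d G \<and>
    X_invariant (PIdl\<^bsub>poly_ring3 cuberoot_field\<^esub> G) \<and>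
    PIdl\<^bsub>poly_ring3 cuberoot_field\<^esub> G \<subseteq> point_ideal cuberoot_field v"
proof (intro exI[of _ H] conjI)
  interpret cring "poly_ring3 (cuberoot_field :: 'k alg_closure set)"
    by (rule cring_poly_ring3[OF is_subring_cuberoot])
  let ?P = "PIdl\<^bsub>poly_ring3 cuberoot_field\<^esub> H"
  have H: "H \<in> carrier (poly_ring3 cuberoot_field)" "homogeneous d H"
    using assms(1) carrier_base_cuberoot by (auto simp: plane_curve_def)
  show "plane_curve cuberoot_field d H"
    using assms(1) H by (simp add: plane_curve_def)
  have P: "ideal ?P (poly_ring3 cuberoot_field)" by (rule cgenideal_ideal[OF H(1)])
  let ?I = "Idl\<^bsub>poly_ring3 cuberoot_field\<^esub> (?P \<inter> carrier (poly_ring3 base_field))"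
  have sub: "?P \<inter> carrier (poly_ring3 base_field) \<subseteq> carrier (poly_ring3 cuberoot_field)"
    using carrier_base_cuberoot by auto
  have "H \<in> ?I"
    using genideal_self[OF sub] cgenideal_self[OF H(1)] assms(1) by (auto simp: plane_curve_def)
  then have "?P \<subseteq> ?I" by (intro cgenideal_minimal genideal_ideal[OF sub])
  moreover have "?I \<subseteq> ?P" by (rule genideal_minimal[OF P]) auto
  ultimately show "X_invariant ?P" unfolding X_invariant_def by auto
  show "?P \<subseteq> point_ideal cuberoot_field v"
    using H is_subring_carrier[OF is_subring_cuberoot] assms(2)
    by (auto simp: cgenideal_def poly_ring3_simps point_ideal_eq[OF inf_ac is_subring_cuberoot]
        is_subring_def eval3_homogeneous)
qed

lemma one_type_le:
  fixes v :: "'k alg_closure ^ 3"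
  assumes "plane_curve base_field d H" and "eval3 H v = 0"
  shows "one_type (point_ideal cuberoot_field v) \<le> d"
  unfolding one_type_def by (rule Least_le) (rule X_invariant_curve_through_point[OF assms])

lemma coeff3_mult_000: "coeff3 (F * G) 0 0 0 = coeff3 F 0 0 0 * coeff3 G 0 0 0"
  by (simp add: coeff3_def coeff_mult_0)

text \<open>A term of \<open>g\<close> of positive degree pushes the product above degree
  \<open>d\<close>, so only the constant term of \<open>g\<close> contributes.\<close>

lemma hcomp_mult_homogeneous:
  fixes g G :: "'k alg_closure poly3"
  assumes "homogeneous d G"
  shows "hcomp d (g * G) = const3 (coeff3 g 0 0 0) * G"
proof (rule coeff3_eqI)
  fix i j k
  have "coeff3 (g * G) i j k = coeff3 g 0 0 0 * coeff3 G i j k" if "i + j + k = d"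
  proof -
    have *: "coeff3 g i' j' k' * coeff3 G (i - i') (j - j') (k - k') =
      (if k' = 0 then if j' = 0 then if i' = 0 then coeff3 g 0 0 0 * coeff3 G i j k else 0 else 0 else 0)"
      if "i' \<le> i" "j' \<le> j" "k' \<le> k" for i' j' k'
    proof (cases "coeff3 G (i - i') (j - j') (k - k') = 0")
      case False
      then have "(i - i') + (j - j') + (k - k') = d"
        using assms by (auto simp: homogeneous_def)
      then show ?thesis using that \<open>i + j + k = d\<close> by auto
    qed (use that in auto)
    have "coeff3 (g * G) i j k =
      (\<Sum>k'\<le>k. \<Sum>j'\<le>j. \<Sum>i'\<le>i. coeff3 g i' j' k' * coeff3 G (i - i') (j - j') (k - k'))"
      by (simp add: coeff3_def coeff_mult coeff_sum)
    also have "\<dots> = (\<Sum>k'\<le>k. \<Sum>j'\<le>j. \<Sum>i'\<le>i.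
      if k' = 0 then if j' = 0 then if i' = 0 then coeff3 g 0 0 0 * coeff3 G i j k else 0 else 0 else 0)"
      by (intro sum.cong refl *) auto
    also have "\<dots> = (\<Sum>k'\<le>k. if k' = 0 then \<Sum>j'\<le>j. if j' = 0 then \<Sum>i'\<le>i.
       if i' = 0 then coeff3 g 0 0 0 * coeff3 G i j k else 0 else 0 else 0)"
    proof (intro sum.cong refl)
      fix k'
      have "(\<Sum>j'\<le>j. \<Sum>i'\<le>i. if j' = 0 then if i' = 0 then c else 0 else 0) =
        (\<Sum>j'\<le>j. if j' = 0 then \<Sum>i'\<le>i. if i' = 0 then c else 0 else (0 :: 'k alg_closure))" for c
        by (intro sum.cong refl) auto
      then show "(\<Sum>j'\<le>j. \<Sum>i'\<le>i.
          if k' = 0 then if j' = 0 then if i' = 0 then coeff3 g 0 0 0 * coeff3 G i j k else 0 else 0 else 0) =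
        (if k' = 0 then \<Sum>j'\<le>j. if j' = 0 then \<Sum>i'\<le>i.
          if i' = 0 then coeff3 g 0 0 0 * coeff3 G i j k else 0 else 0 else 0)"
        by simp
    qed
    finally show ?thesis by simp
  qed
  moreover have "coeff3 (const3 c * G) i j k = c * coeff3 G i j k" for c
    by (simp add: coeff3_def const3_def)
  moreover have "coeff3 G i j k = 0" if "i + j + k \<noteq> d"
    using assms that by (auto simp: homogeneous_def)
  ultimately show "coeff3 (hcomp d (g * G)) i j k = coeff3 (const3 (coeff3 g 0 0 0) * G) i j k"
    by (simp add: coeff3_hcomp)
qed

text \<open>The cube of a line through \<open>v\<close> serves: in characteristic three cubing is
  additive and takes the coefficients into \<open>K\<close>. Its existence guarantees that the
  minimum in \<open>one_type\<close> is attained.\<close>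

lemma cubic_through_point:
  fixes v :: "'k alg_closure ^ 3"
  assumes "v \<noteq> 0" and "\<And>i. v $ i \<in> cuberoot_field"
  obtains H where "plane_curve base_field 3 H" and "eval3 H v = 0"
proof -
  obtain i where i: "v $ i \<noteq> 0" using assms(1) by (auto simp: vec_eq_iff)
  obtain j :: 3 where j: "j \<noteq> i" by (metis (full_types) zero_neq_one)
  define H where "H = const3 (v $ i ^ 3) * (coords3 $ j) ^ 3 - const3 (v $ j ^ 3) * (coords3 $ i) ^ 3"
  have "v $ i ^ 3 \<in> base_field" for i using assms(2)[of i] by (simp add: cuberoot_field_def)
  then have c: "const3 (v $ i ^ 3) \<in> carrier (poly_ring3 base_field)" for i
    by (intro const3_carrier is_subring_base)
  have "H \<in> carrier (poly_ring3 base_field)"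
    unfolding H_def power3_eq_cube[of "coords3 $ _"]
      diff_conv_add_uminus[of "const3 _ * _"]
    using is_subring_carrier[OF is_subring_base] coords3_carrier[OF is_subring_base] c
    by (simp add: is_subring_def del: add_uminus_conv_diff)
  moreover have "homogeneous 3 H"
    by (intro homogeneousI[OF inf_ac]) (simp add: H_def power_mult_distrib algebra_simps)
  moreover have "eval3 H (axis j 1) \<noteq> 0"
    using i j by (simp add: H_def axis_def)
  then have "H \<noteq> 0" by auto
  moreover have "eval3 H v = 0" by (simp add: H_def)
  ultimately show ?thesis using that by (auto simp: plane_curve_def)
qed

text \<open>Invariance speaks of ideals, so a form over \<open>K\<close> has to be extracted. If
  every element over \<open>K\<close> of the ideal of \<open>G\<close> were \<open>G\<close> times a
  polynomial without constant term, these elements could not generate \<open>G\<close>. Hence some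
  \<open>g * G\<close> over \<open>K\<close> has \<open>g\<close> with nonzero constant term, and
  its component of degree \<open>d\<close> is a nonzero scalar multiple of \<open>G\<close>.\<close>

lemma one_type_witness:
  fixes v :: "'k alg_closure ^ 3"
  assumes "v \<noteq> 0" and "\<And>i. v $ i \<in> cuberoot_field"
  obtains H where "plane_curve base_field (one_type (point_ideal cuberoot_field v)) H" and "eval3 H v = 0"
proof -
  interpret cring "poly_ring3 (cuberoot_field :: 'k alg_closure set)"
    by (rule cring_poly_ring3[OF is_subring_cuberoot])
  note S = is_subring_carrier[OF is_subring_cuberoot, unfolded is_subring_def]
    is_subring_0[OF is_subring_carrier[OF is_subring_cuberoot]]
  let ?R = "poly_ring3 (cuberoot_field :: 'k alg_closure set)"
  let ?p = "point_ideal cuberoot_field v"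
  define d where "d = one_type ?p"
  obtain C where "plane_curve base_field 3 C" "eval3 C v = 0"
    using cubic_through_point[OF assms] by blast
  then have "\<exists>d G. plane_curve cuberoot_field d G \<and> X_invariant (PIdl\<^bsub>?R\<^esub> G) \<and> PIdl\<^bsub>?R\<^esub> G \<subseteq> ?p"
    using X_invariant_curve_through_point by blast
  then have "\<exists>G. plane_curve cuberoot_field d G \<and> X_invariant (PIdl\<^bsub>?R\<^esub> G) \<and> PIdl\<^bsub>?R\<^esub> G \<subseteq> ?p"
    unfolding d_def one_type_def by (rule LeastI_ex)
  then obtain G where G: "plane_curve cuberoot_field d G" "X_invariant (PIdl\<^bsub>?R\<^esub> G)" "PIdl\<^bsub>?R\<^esub> G \<subseteq> ?p"
    by blast
  have hom: "homogeneous d G" and Gc: "G \<in> carrier ?R" and "G \<noteq> 0"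
    using G(1) by (auto simp: plane_curve_def)
  have "G \<in> ?p" using G(3) cgenideal_self[OF Gc] by blast
  then have "eval3 G (1 *s v) = 0"
    unfolding point_ideal_eq[OF inf_ac is_subring_cuberoot] by blast
  then have "eval3 G v = 0" by simp
  \<comment> \<open>The product of the irrelevant ideal with the ideal of \<open>G\<close>, as in
    Nakayama's lemma.\<close>
  define J where "J = {g * G | g. g \<in> carrier ?R \<and> coeff3 g 0 0 0 = 0}"
  have coeff3_add: "coeff3 (a + b) 0 0 0 = coeff3 a 0 0 0 + coeff3 b 0 0 0" for a b :: "'k alg_closure poly3"
    by (simp add: coeff3_def)
  have J: "ideal J ?R"
  proof (rule ideal_poly_ring3I[OF is_subring_cuberoot])
    show "J \<subseteq> carrier ?R" using S Gc by (auto simp: J_def)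
    show "0 \<in> J" unfolding J_def using S by (intro CollectI exI[of _ 0]) (auto simp: coeff3_def)
    show "A + B \<in> J" if AB: "A \<in> J" "B \<in> J" for A B
    proof -
      obtain a b where "a \<in> carrier ?R" "coeff3 a 0 0 0 = 0" "A = a * G"
        "b \<in> carrier ?R" "coeff3 b 0 0 0 = 0" "B = b * G"
        using AB by (auto simp: J_def)
      then show ?thesis using S unfolding J_def
        by (intro CollectI exI[of _ "a + b"]) (auto simp: coeff3_add algebra_simps)
    qed
    show "A * B \<in> J" if AB: "A \<in> carrier ?R" "B \<in> J" for A B
    proof -
      obtain b where "b \<in> carrier ?R" "coeff3 b 0 0 0 = 0" "B = b * G"
        using AB by (auto simp: J_def)
      then show ?thesis using S AB unfolding J_def
        by (intro CollectI exI[of _ "A * b"]) (auto simp: coeff3_mult_000 algebra_simps)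
    qed
  qed
  have "\<not> PIdl\<^bsub>?R\<^esub> G \<inter> carrier (poly_ring3 base_field) \<subseteq> J"
  proof
    assume "PIdl\<^bsub>?R\<^esub> G \<inter> carrier (poly_ring3 base_field) \<subseteq> J"
    then have "PIdl\<^bsub>?R\<^esub> G \<subseteq> J"
      using genideal_minimal[OF J] G(2) unfolding X_invariant_def by metis
    then have "G \<in> J" using cgenideal_self[OF Gc] by blast
    then obtain g where "coeff3 g 0 0 0 = 0" "G = g * G" by (auto simp: J_def)
    then have "g = 1" using \<open>G \<noteq> 0\<close> by simp
    then show False using \<open>coeff3 g 0 0 0 = 0\<close> by (simp add: coeff3_def)
  qed
  then obtain f where f: "f \<in> PIdl\<^bsub>?R\<^esub> G" "f \<in> carrier (poly_ring3 base_field)" "f \<notin> J" by blast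
  then obtain g where g: "g \<in> carrier ?R" "f = g * G"
    by (auto simp: cgenideal_def poly_ring3_simps)
  then have g0: "coeff3 g 0 0 0 \<noteq> 0" using f(3) by (auto simp: J_def)
  have eq: "hcomp d f = const3 (coeff3 g 0 0 0) * G"
    unfolding g(2) by (rule hcomp_mult_homogeneous[OF hom])
  have "hcomp d f \<noteq> 0"
    unfolding eq using g0 \<open>G \<noteq> 0\<close> by (simp add: const3_def)
  then have "plane_curve base_field d (hcomp d f)"
    unfolding plane_curve_def
    using hcomp_carrier[OF is_subring_base f(2)] homogeneous_hcomp by blast
  moreover have "eval3 (hcomp d f) v = 0"
    unfolding eq using \<open>eval3 G v = 0\<close> by simp
  ultimately show ?thesis using that unfolding d_def by blast
qed

section \<open>Coefficients of lines and conics over \<open>K\<close>\<close>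

lemma linear_form_coeffs:
  assumes "plane_curve base_field 1 H"
  obtains a b c :: 'k where "a \<noteq> 0 \<or> b \<noteq> 0 \<or> c \<noteq> 0"
    and "\<And>v. eval3 H v = to_ac a * v $ 1 + to_ac b * v $ 2 + to_ac c * v $ 3"
proof -
  have H: "homogeneous 1 H" "H \<noteq> 0" "\<And>i j k. coeff3 H i j k \<in> range to_ac"
    using assms by (auto simp: plane_curve_def carrier_poly_ring3 base_field_def)
  obtain C where C: "\<And>i j k. coeff3 H i j k = to_ac (C i j k)"
    using H(3) unfolding image_iff by metis
  have ev: "eval3 H v = to_ac (C 1 0 0) * v $ 1 + to_ac (C 0 1 0) * v $ 2 + to_ac (C 0 0 1) * v $ 3" for v
    unfolding eval3_homogeneous_sum[OF H(1)] C by (simp add: atMost_Suc)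
  moreover have "C 1 0 0 \<noteq> 0 \<or> C 0 1 0 \<noteq> 0 \<or> C 0 0 1 \<noteq> 0"
    using eval3_eq_0_imp[OF inf_ac, of H] H(2) ev by auto
  ultimately show ?thesis using that by blast
qed

lemma plane_curve_linear:
  assumes "a \<noteq> 0 \<or> b \<noteq> 0 \<or> (c :: 'k) \<noteq> 0"
  obtains H where "plane_curve base_field 1 H"
    and "\<And>v. eval3 H v = to_ac a * v $ 1 + to_ac b * v $ 2 + to_ac c * v $ 3"
proof -
  define H where "H = const3 (to_ac a) * coords3 $ 1 + const3 (to_ac b) * coords3 $ 2 + const3 (to_ac c) * coords3 $ 3"
  have ev: "eval3 H v = to_ac a * v $ 1 + to_ac b * v $ 2 + to_ac c * v $ 3" for v
    by (simp add: H_def)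
  have "homogeneous 1 H"
    by (intro homogeneousI[OF inf_ac]) (simp add: ev algebra_simps)
  moreover have "H \<noteq> 0"
  proof
    assume "H = 0"
    then have "to_ac a * v $ 1 + to_ac b * v $ 2 + to_ac c * v $ 3 = 0" for v :: "'k alg_closure ^ 3"
      using ev[of v] by simp
    from this[of "axis 1 1"] this[of "axis 2 1"] this[of "axis 3 1"] show False
      using assms by (simp add: axis_def)
  qed
  moreover have "const3 (to_ac a) \<in> carrier (poly_ring3 base_field)" for a :: 'k
    by (intro const3_carrier is_subring_base) (simp add: base_field_def)
  then have "H \<in> carrier (poly_ring3 base_field)"
    using is_subring_carrier[OF is_subring_base] coords3_carrier[OF is_subring_base]
    unfolding H_def by (simp add: is_subring_def)
  ultimately show ?thesis using that ev by (auto simp: plane_curve_def)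
qed

lemma quadratic_form_coeffs:
  assumes "plane_curve base_field 2 H"
  obtains a b c d e f :: 'k where "\<not> (a = 0 \<and> b = 0 \<and> c = 0 \<and> d = 0 \<and> e = 0 \<and> f = 0)"
    and "\<And>v. eval3 H v = to_ac a * (v $ 1)\<^sup>2 + to_ac b * (v $ 1 * v $ 2) + to_ac c * (v $ 1 * v $ 3)
      + to_ac d * (v $ 2)\<^sup>2 + to_ac e * (v $ 2 * v $ 3) + to_ac f * (v $ 3)\<^sup>2"
proof -
  have H: "homogeneous 2 H" "H \<noteq> 0" "\<And>i j k. coeff3 H i j k \<in> range to_ac"
    using assms by (auto simp: plane_curve_def carrier_poly_ring3 base_field_def)
  obtain C where C: "\<And>i j k. coeff3 H i j k = to_ac (C i j k)"
    using H(3) unfolding image_iff by metis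
  have ev: "eval3 H v = to_ac (C 2 0 0) * (v $ 1)\<^sup>2 + to_ac (C 1 1 0) * (v $ 1 * v $ 2)
     + to_ac (C 1 0 1) * (v $ 1 * v $ 3) + to_ac (C 0 2 0) * (v $ 2)\<^sup>2
     + to_ac (C 0 1 1) * (v $ 2 * v $ 3) + to_ac (C 0 0 2) * (v $ 3)\<^sup>2" for v
    unfolding eval3_homogeneous_sum[OF H(1)] C by (simp add: numeral_2_eq_2 atMost_Suc)
  moreover have "\<not> (C 2 0 0 = 0 \<and> C 1 1 0 = 0 \<and> C 1 0 1 = 0 \<and> C 0 2 0 = 0 \<and> C 0 1 1 = 0 \<and> C 0 0 2 = 0)"
    using eval3_eq_0_imp[OF inf_ac, of H] H(2) ev by auto
  ultimately show ?thesis using that by blast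
qed


lemma L_closed [simp]:
  fixes x y :: "'k alg_closure" and c :: 'k
  shows "1 \<in> (cuberoot_field :: 'k alg_closure set)" "0 \<in> (cuberoot_field :: 'k alg_closure set)"
    "x \<in> cuberoot_field \<Longrightarrow> - x \<in> cuberoot_field"
    "x \<in> cuberoot_field \<Longrightarrow> y \<in> cuberoot_field \<Longrightarrow> x + y \<in> cuberoot_field"
    "x \<in> cuberoot_field \<Longrightarrow> y \<in> cuberoot_field \<Longrightarrow> x - y \<in> cuberoot_field"
    "x \<in> cuberoot_field \<Longrightarrow> y \<in> cuberoot_field \<Longrightarrow> x * y \<in> cuberoot_field"
    "x \<in> cuberoot_field \<Longrightarrow> x ^ n \<in> cuberoot_field"
    "to_ac c \<in> cuberoot_field"
proof -
  note L = is_subring_cuberoot[unfolded is_subring_def] is_subring_0[OF is_subring_cuberoot]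
  show "1 \<in> (cuberoot_field :: 'k alg_closure set)" "0 \<in> (cuberoot_field :: 'k alg_closure set)"
    "x \<in> cuberoot_field \<Longrightarrow> - x \<in> cuberoot_field"
    "x \<in> cuberoot_field \<Longrightarrow> y \<in> cuberoot_field \<Longrightarrow> x + y \<in> cuberoot_field"
    "x \<in> cuberoot_field \<Longrightarrow> y \<in> cuberoot_field \<Longrightarrow> x * y \<in> cuberoot_field"
    using L by auto
  show "x \<in> cuberoot_field \<Longrightarrow> y \<in> cuberoot_field \<Longrightarrow> x - y \<in> cuberoot_field"
    using L unfolding diff_conv_add_uminus by blast
  show "x \<in> cuberoot_field \<Longrightarrow> x ^ n \<in> cuberoot_field"
    by (induction n) (use L in auto)
  show "to_ac c \<in> cuberoot_field"
    using base_subset_cuberoot by (force simp: base_field_def)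
qed

lemma L_inverse [simp]: "x \<in> cuberoot_field \<Longrightarrow> inverse x \<in> (cuberoot_field :: 'k alg_closure set)"
  by (auto simp: cuberoot_field_def base_field_def power_inverse simp flip: to_ac_inverse)

lemma L_divide [simp]:
  "x \<in> cuberoot_field \<Longrightarrow> y \<in> cuberoot_field \<Longrightarrow> x / y \<in> (cuberoot_field :: 'k alg_closure set)"
  by (simp add: divide_inverse)

subsection \<open>Derivations\<close>

text \<open>Nothing is imposed outside \<open>cuberoot_field\<close> except the values on
  \<open>K\<close>, and the values of \<open>D\<close> may be any elements of the algebraic
  closure.\<close>

definition K_derivation :: "('k alg_closure \<Rightarrow> 'k alg_closure) \<Rightarrow> bool" where
  "K_derivation D \<longleftrightarrow> (\<forall>c. D (to_ac c) = 0) \<and>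
     (\<forall>x\<in>cuberoot_field. \<forall>y\<in>cuberoot_field. D (x + y) = D x + D y \<and> D (x * y) = x * D y + y * D x)"

text \<open>Solves a quadratic relation for \<open>x\<close> without square roots: once the factor
  on the left is invertible, \<open>x\<close> is expressed through \<open>b\<close>,
  \<open>c\<close>, \<open>s\<close> and \<open>x ^ 3\<close>, and cubes of elements of
  \<open>cuberoot_field\<close> lie in \<open>K\<close>.\<close>

lemma cube_root_solve:
  fixes x :: "'a::comm_ring_1"
  assumes "s = b * x + c * x ^ 2"
  shows "(b ^ 3 - c ^ 3 * x ^ 3) * x = b ^ 2 * s - c * s ^ 2 + 2 * b * c ^ 2 * x ^ 3"
  unfolding assms by (simp add: power2_eq_square power3_eq_cube algebra_simps)

lemma cube_diff: "(x - y) ^ 3 = x ^ 3 - (y :: 'k alg_closure) ^ 3"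
  using cube_add[of x "- y"] by simp

text \<open>
  Let \<open>M\<close> be maximal among the subrings between \<open>K\<close> and its cube root field that do not contain \<open>t\<close>.  Then
  \<open>1, t, t\<^sup>2\<close> is a basis of the cube root field over \<open>M\<close>, and differentiation with respect to \<open>t\<close> is a derivation.
\<close>

lemma exists_deriv:
  fixes t :: "'k alg_closure"
  assumes t: "t \<in> cuberoot_field" "t \<notin> base_field"
  obtains D where "K_derivation D" and "D t = 1"
proof -
  define A where "A = {M. base_field \<subseteq> M \<and> M \<subseteq> cuberoot_field \<and> is_subring M \<and> t \<notin> M}"
  have "base_field \<in> A"
    using t base_subset_cuberoot is_subring_base by (simp add: A_def)
  have "\<exists>M\<in>A. \<forall>N\<in>A. M \<subseteq> N \<longrightarrow> N = M"
  proof (rule subset_Zorn_nonempty)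
    show "A \<noteq> {}" using \<open>base_field \<in> A\<close> by auto
    fix C assume C: "C \<noteq> {}" "subset.chain A C"
    then have CA: "C \<subseteq> A" by (simp add: subset_chain_def)
    have "is_subring (\<Union>C)"
      unfolding is_subring_def
    proof (intro conjI ballI)
      show "1 \<in> \<Union>C" using C(1) CA by (fastforce simp: A_def is_subring_def)
      show "- x \<in> \<Union>C" if "x \<in> \<Union>C" for x
        using that CA by (fastforce simp: A_def is_subring_def)
      have "\<exists>M\<in>C. x \<in> M \<and> y \<in> M" if xy: "x \<in> \<Union>C" "y \<in> \<Union>C" for x y
      proof -
        obtain U V where UV: "U \<in> C" "x \<in> U" "V \<in> C" "y \<in> V" using xy by blast
        then have "U \<subseteq> V \<or> V \<subseteq> U" using C(2) unfolding subset_chain_def by blast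
        then show ?thesis using UV by blast
      qed
      then have "x + y \<in> \<Union>C \<and> x * y \<in> \<Union>C" if xy: "x \<in> \<Union>C" "y \<in> \<Union>C" for x y
      proof -
        obtain M where "M \<in> C" "x \<in> M" "y \<in> M"
          using xy \<open>\<And>x y. x \<in> \<Union>C \<Longrightarrow> y \<in> \<Union>C \<Longrightarrow> \<exists>M\<in>C. x \<in> M \<and> y \<in> M\<close> by blast
        moreover from this have "is_subring M" using CA by (auto simp: A_def)
        ultimately show ?thesis by (auto simp: is_subring_def)
      qed
      then show "x + y \<in> \<Union>C" "x * y \<in> \<Union>C" if "x \<in> \<Union>C" "y \<in> \<Union>C" for x y
        using that by auto
    qed
    then show "\<Union>C \<in> A" using C(1) CA unfolding A_def by blast
  qed
  then obtain M where "M \<in> A" and max: "\<And>N. N \<in> A \<Longrightarrow> M \<subseteq> N \<Longrightarrow> N = M" by blast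
  then have M: "base_field \<subseteq> M" "M \<subseteq> cuberoot_field" "is_subring M" "t \<notin> M"
    by (auto simp: A_def)
  have M_add: "x + y \<in> M" and M_mult: "x * y \<in> M" if "x \<in> M" "y \<in> M" for x y
    using M(3) that by (auto simp: is_subring_def)
  have M_minus: "- x \<in> M" if "x \<in> M" for x using M(3) that by (auto simp: is_subring_def)
  have M_diff: "x - y \<in> M" if "x \<in> M" "y \<in> M" for x y
    using M_add[OF that(1) M_minus[OF that(2)]] by simp
  have M_01: "0 \<in> M" "1 \<in> M" using M(3) is_subring_0 by (auto simp: is_subring_def)
  have M_power: "x ^ n \<in> M" if "x \<in> M" for x n
    by (induction n) (use that M_01 M_mult in auto)
  have M_2: "2 \<in> M" using M_add[OF M_01(2) M_01(2)] by simp
  have M_cube: "x ^ 3 \<in> M" if "x \<in> cuberoot_field" for x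
    using that M(1) by (auto simp: cuberoot_field_def)
  \<comment> \<open>A subring between \<open>K\<close> and its cube root field is a field, because
    the inverse of \<open>x\<close> is \<open>x ^ 2\<close> times the inverse of
    \<open>x ^ 3\<close>, and \<open>x ^ 3\<close> lies in \<open>K\<close>.\<close>
  have M_inverse: "inverse x \<in> M" if "x \<in> M" for x
  proof (cases "x = 0")
    case False
    have "x ^ 3 \<in> base_field" using that M(2) by (auto simp: cuberoot_field_def)
    then have "inverse (x ^ 3) \<in> M"
      using M(1) by (auto simp: base_field_def simp flip: to_ac_inverse)
    then have "x ^ 2 * inverse (x ^ 3) \<in> M" using that M_mult M_power by blast
    moreover have "x ^ 2 * inverse (x ^ 3) = inverse x"
      using False by (simp add: field_simps power2_eq_square power3_eq_cube)
    ultimately show ?thesis by simp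
  qed (use M_01 in auto)
  note M_closed = M_add M_mult M_minus M_diff M_01 M_power M_2 M_cube M_inverse

  \<comment> \<open>The denominator is the cube of \<open>b - c * x\<close>, which vanishes only if
    \<open>x\<close> is a quotient of elements of \<open>M\<close>.\<close>
  have solve: "x = (b ^ 2 * s - c * s ^ 2 + 2 * b * c ^ 2 * x ^ 3) * inverse (b ^ 3 - c ^ 3 * x ^ 3)"
    if "x \<notin> M" "b \<in> M" "c \<in> M" "b \<noteq> 0 \<or> c \<noteq> 0" "s = b * x + c * x ^ 2" for x b c s
  proof -
    have "b \<noteq> c * x"
    proof
      assume eq: "b = c * x"
      then have "c \<noteq> 0" using that(4) by auto
      then have "x = b * inverse c" using eq by (simp add: field_simps)
      then show False using that(1-3) M_closed by metis
    qed
    then have "(b - c * x) ^ 3 \<noteq> 0" by simp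
    then have "b ^ 3 - c ^ 3 * x ^ 3 \<noteq> 0" by (simp add: cube_diff power_mult_distrib)
    then show ?thesis
      using cube_root_solve[OF that(5)] by (simp add: field_simps)
  qed
  have gen: "\<exists>a\<in>M. \<exists>b\<in>M. \<exists>c\<in>M. x = a + b * t + c * t ^ 2" if x: "x \<in> cuberoot_field" for x
  proof (cases "x \<in> M")
    case True
    then show ?thesis using M_01 by (intro bexI[of _ x] bexI[of _ 0]) auto
  next
    case False
    \<comment> \<open>As \<open>x ^ 3\<close> lies in \<open>K\<close>, three powers of
      \<open>x\<close> suffice for a ring. It is strictly larger than \<open>M\<close>, so by
      maximality it contains \<open>t\<close>; the resulting relation is then solved for
      \<open>x\<close>.\<close>
    define N where "N = {a + b * x + c * x ^ 2 | a b c. a \<in> M \<and> b \<in> M \<and> c \<in> M}"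
    have NI: "y \<in> N" if "y = a + b * x + c * x ^ 2" "a \<in> M" "b \<in> M" "c \<in> M" for y a b c
      using that unfolding N_def by blast
    have "is_subring N"
      unfolding is_subring_def
    proof (intro conjI ballI)
      show "1 \<in> N" by (rule NI[of _ 1 0 0]) (use M_01 in auto)
      show "- y \<in> N" if "y \<in> N" for y
      proof -
        from that obtain a b c where "y = a + b * x + c * x ^ 2" "a \<in> M" "b \<in> M" "c \<in> M"
          unfolding N_def by blast
        then show ?thesis by (intro NI[of _ "- a" "- b" "- c"]) (auto simp: M_closed)
      qed
      fix y z assume "y \<in> N" "z \<in> N"
      then obtain a b c a' b' c' where y: "y = a + b * x + c * x ^ 2" "a \<in> M" "b \<in> M" "c \<in> M"
        and z: "z = a' + b' * x + c' * x ^ 2" "a' \<in> M" "b' \<in> M" "c' \<in> M"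
        unfolding N_def by blast
      show "y + z \<in> N"
        by (rule NI[of _ "a + a'" "b + b'" "c + c'"])
          (use y z M_closed in \<open>auto simp: algebra_simps\<close>)
      have "y * z = (a * a' + (b * c' + c * b') * x ^ 3) + (a * b' + b * a' + c * c' * x ^ 3) * x
          + (a * c' + b * b' + c * a') * x ^ 2"
        unfolding y(1) z(1) by (simp add: algebra_simps power2_eq_square power3_eq_cube)
      then show "y * z \<in> N"
        by (rule NI) (intro M_closed y z x)+
    qed
    moreover have MN: "M \<subseteq> N"
    proof
      fix y assume "y \<in> M"
      then show "y \<in> N" by (intro NI[of _ y 0 0]) (use M_01 in auto)
    qed
    moreover have "N \<subseteq> cuberoot_field" using x M(2) by (auto simp: N_def subset_eq)
    moreover have "x \<in> N" by (rule NI[of _ 0 1 0]) (use M_01 in auto)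
    ultimately have "t \<in> N" using max[of N] False M(1) by (auto simp: A_def)
    then obtain a b c where t': "t = a + b * x + c * x ^ 2" "a \<in> M" "b \<in> M" "c \<in> M"
      unfolding N_def by blast
    then have "b \<noteq> 0 \<or> c \<noteq> 0" using M(4) by auto
    from solve[OF False t'(3,4) this, of "t - a"] t'(1)
    have eq: "x = (b ^ 2 * (t - a) - c * (t - a) ^ 2 + 2 * b * c ^ 2 * x ^ 3) * inverse (b ^ 3 - c ^ 3 * x ^ 3)"
      by simp
    define i where "i = inverse (b ^ 3 - c ^ 3 * x ^ 3)"
    have i: "i \<in> M" unfolding i_def by (intro M_closed t' x)
    have "(b ^ 2 * (t - a) - c * (t - a) ^ 2 + 2 * b * c ^ 2 * x ^ 3) * i =
      (- (b ^ 2 * a) - c * a ^ 2 + 2 * b * c ^ 2 * x ^ 3) * i + ((b ^ 2 + 2 * c * a) * i) * t + (- c * i) * t ^ 2"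
      by (simp add: algebra_simps power2_eq_square)
    from eq[folded i_def] this
    have "x = (- (b ^ 2 * a) - c * a ^ 2 + 2 * b * c ^ 2 * x ^ 3) * i + ((b ^ 2 + 2 * c * a) * i) * t + (- c * i) * t ^ 2"
      by (rule trans)
    moreover have "(- (b ^ 2 * a) - c * a ^ 2 + 2 * b * c ^ 2 * x ^ 3) * i \<in> M" "(b ^ 2 + 2 * c * a) * i \<in> M" "- c * i \<in> M"
      by (intro M_closed t' x i)+
    ultimately show ?thesis by blast
  qed
  \<comment> \<open>A nontrivial relation would express \<open>t\<close> through elements of
    \<open>M\<close>, by \<open>solve\<close> with \<open>x\<close> replaced by
    \<open>t\<close>.\<close>
  have uniq0: "b = 0 \<and> c = 0" if "a \<in> M" "b \<in> M" "c \<in> M" "a + b * t + c * t ^ 2 = 0" for a b c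
  proof (rule ccontr)
    assume "\<not> (b = 0 \<and> c = 0)"
    moreover have "- a = b * t + c * t ^ 2" using minus_unique[of a "b * t + c * t ^ 2"] that(4) by (simp add: add.assoc)
    ultimately have "t = (b ^ 2 * (- a) - c * (- a) ^ 2 + 2 * b * c ^ 2 * t ^ 3) * inverse (b ^ 3 - c ^ 3 * t ^ 3)"
      using solve[OF M(4) that(2,3)] by blast
    moreover have "(b ^ 2 * (- a) - c * (- a) ^ 2 + 2 * b * c ^ 2 * t ^ 3) * inverse (b ^ 3 - c ^ 3 * t ^ 3) \<in> M"
      by (intro M_closed that t)
    ultimately show False using M(4) by simp
  qed
  define D where "D x = (THE d. \<exists>a\<in>M. \<exists>b\<in>M. \<exists>c\<in>M. x = a + b * t + c * t ^ 2 \<and> d = b + 2 * c * t)" for x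
  have D: "D (a + b * t + c * t ^ 2) = b + 2 * c * t" if "a \<in> M" "b \<in> M" "c \<in> M" for a b c
    unfolding D_def
  proof (rule the_equality)
    fix d assume "\<exists>a'\<in>M. \<exists>b'\<in>M. \<exists>c'\<in>M. a + b * t + c * t ^ 2 = a' + b' * t + c' * t ^ 2 \<and> d = b' + 2 * c' * t"
    then obtain a' b' c' where *: "a' \<in> M" "b' \<in> M" "c' \<in> M"
      "a + b * t + c * t ^ 2 = a' + b' * t + c' * t ^ 2" "d = b' + 2 * c' * t" by blast
    have "(a - a') + (b - b') * t + (c - c') * t ^ 2 = 0" using *(4) by (simp add: algebra_simps)
    then have "b - b' = 0 \<and> c - c' = 0"
      by (intro uniq0[of "a - a'"] M_closed that *)
    then show "d = b + 2 * c * t" using *(5) by simp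
  qed (use that in blast)
  have "K_derivation D"
    unfolding K_derivation_def
  proof (intro conjI allI ballI)
    show "D (to_ac c) = 0" for c
    proof -
      have "to_ac c \<in> M" using M(1) by (auto simp: base_field_def)
      then show ?thesis using D[of "to_ac c" 0 0] M_01 by simp
    qed
    fix x y :: "'k alg_closure" assume "x \<in> cuberoot_field" "y \<in> cuberoot_field"
    then obtain a b c a' b' c' where x: "x = a + b * t + c * t ^ 2" "a \<in> M" "b \<in> M" "c \<in> M"
      and y: "y = a' + b' * t + c' * t ^ 2" "a' \<in> M" "b' \<in> M" "c' \<in> M"
      using gen by metis
    have Dx: "D x = b + 2 * c * t" and Dy: "D y = b' + 2 * c' * t"
      using D x y by auto
    have xy: "x + y = (a + a') + (b + b') * t + (c + c') * t ^ 2"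
      unfolding x(1) y(1) by (simp add: algebra_simps)
    have "D (x + y) = (b + b') + 2 * (c + c') * t"
      unfolding xy by (rule D) (intro M_closed x y)+
    then show "D (x + y) = D x + D y" unfolding Dx Dy by (simp add: algebra_simps)
    have xy: "x * y = (a * a' + (b * c' + c * b') * t ^ 3) + (a * b' + b * a' + c * c' * t ^ 3) * t
          + (a * c' + b * b' + c * a') * t ^ 2"
      unfolding x(1) y(1) by (simp add: algebra_simps power2_eq_square power3_eq_cube)
    have "D (x * y) = (a * b' + b * a' + c * c' * t ^ 3) + 2 * (a * c' + b * b' + c * a') * t"
      unfolding xy by (rule D) (intro M_closed x y t)+
    \<comment> \<open>Treating \<open>t ^ 3\<close> as a coefficient in the product changes the
      formal derivative only by a multiple of three.\<close>
    also have "\<dots> = x * D y + y * D x - 3 * ((b * c' + c * b') * t ^ 2 + c * c' * t ^ 3)"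
      unfolding Dx Dy unfolding x(1) y(1) by (simp add: algebra_simps power2_eq_square power3_eq_cube)
    finally show "D (x * y) = x * D y + y * D x" by (simp add: three_eq_0)
  qed
  moreover have "D t = 1" using D[of 0 1 0] M_01 by simp
  ultimately show ?thesis using that by blast
qed

lemma deriv_to_ac: "K_derivation D \<Longrightarrow> D (to_ac c) = 0"
  by (simp add: K_derivation_def)

lemma deriv_base: "K_derivation D \<Longrightarrow> x \<in> base_field \<Longrightarrow> D x = 0"
  by (auto simp: base_field_def deriv_to_ac)

lemma deriv_add:
  "K_derivation D \<Longrightarrow> x \<in> cuberoot_field \<Longrightarrow> y \<in> cuberoot_field \<Longrightarrow> D (x + y) = D x + D y"
  by (simp add: K_derivation_def)

lemma deriv_mult:
  "K_derivation D \<Longrightarrow> x \<in> cuberoot_field \<Longrightarrow> y \<in> cuberoot_field \<Longrightarrow> D (x * y) = x * D y + y * D x"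
  by (simp add: K_derivation_def)

lemma deriv_minus:
  assumes "K_derivation D" "x \<in> cuberoot_field"
  shows "D (- x) = - D x"
proof -
  have "D x + D (- x) = 0"
    using deriv_add[OF assms(1,2), of "- x"] deriv_to_ac[OF assms(1), of 0] assms(2) by simp
  then show ?thesis by (simp add: eq_neg_iff_add_eq_0 add.commute)
qed

lemma deriv_diff:
  "K_derivation D \<Longrightarrow> x \<in> cuberoot_field \<Longrightarrow> y \<in> cuberoot_field \<Longrightarrow> D (x - y) = D x - D y"
  using deriv_add[of D x "- y"] by (simp add: deriv_minus)

lemma deriv_square: "K_derivation D \<Longrightarrow> x \<in> cuberoot_field \<Longrightarrow> D (x ^ 2) = 2 * x * D x"
  by (simp add: power2_eq_square deriv_mult)

lemma deriv_cube: "K_derivation D \<Longrightarrow> x \<in> cuberoot_field \<Longrightarrow> D (x ^ 3) = 0"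
  by (rule deriv_base) (auto simp: cuberoot_field_def)

lemmas deriv_simps = deriv_add deriv_mult deriv_minus deriv_diff deriv_square deriv_cube

lemma base_fieldI:
  assumes "x \<in> cuberoot_field" and "\<And>D. K_derivation D \<Longrightarrow> D x = 0"
  shows "x \<in> base_field"
proof (rule ccontr)
  assume "x \<notin> base_field"
  then obtain D where "K_derivation D" "D x = 1" using exists_deriv assms(1) by blast
  then show False using assms(2)[of D] by simp
qed

definition rational :: "'k alg_closure ^ 3 \<Rightarrow> bool" where
  "rational v \<longleftrightarrow> (\<exists>c w. c \<noteq> 0 \<and> (\<forall>i. v $ i = c * to_ac (w $ i)))"

text \<open>If every derivation moved \<open>v\<close> only along itself, all quotients of
  coordinates of \<open>v\<close> would be killed by every derivation and hence lie in
  \<open>K\<close>.\<close>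

lemma not_rational_deriv:
  assumes "v \<noteq> 0" and "\<And>i. v $ i \<in> cuberoot_field" and "\<not> rational v"
  obtains D where "K_derivation D" and "\<nexists>c. \<forall>i. D (v $ i) = c * v $ i"
proof -
  have "\<exists>D. K_derivation D \<and> (\<nexists>c. \<forall>i. D (v $ i) = c * v $ i)"
  proof (rule ccontr)
    assume "\<not> ?thesis"
    then have all: "\<exists>c. \<forall>i. D (v $ i) = c * v $ i" if "K_derivation D" for D
      using that by blast
    obtain j where j: "v $ j \<noteq> 0" using assms(1) by (auto simp: vec_eq_iff)
    have "v $ i / v $ j \<in> base_field" for i
    proof (rule base_fieldI)
      show L: "v $ i / v $ j \<in> cuberoot_field" using assms(2) by simp
      fix D assume D: "K_derivation D"
      obtain c where c: "\<And>i. D (v $ i) = c * v $ i" using all[OF D] by blast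
      have "D (v $ i / v $ j * v $ j) = v $ i / v $ j * D (v $ j) + v $ j * D (v $ i / v $ j)"
        by (rule deriv_mult[OF D L assms(2)])
      then show "D (v $ i / v $ j) = 0" using j by (simp add: c)
    qed
    then have "\<exists>w. v $ i / v $ j = to_ac w" for i by (auto simp: base_field_def)
    then obtain w where w: "\<And>i. v $ i / v $ j = to_ac (w i)" by metis
    have "rational v" unfolding rational_def
      by (rule exI[of _ "v $ j"], rule exI[of _ "\<chi> i. w i"]) (use j in \<open>auto simp: w[symmetric]\<close>)
    then show False using assms(3) by simp
  qed
  then show ?thesis using that by blast
qed

end

subsection \<open>Singular points\<close>

definition is_derivation :: "('a::comm_ring_1 \<Rightarrow> 'a) \<Rightarrow> bool" where
  "is_derivation d \<longleftrightarrow> (\<forall>x y. d (x + y) = d x + d y \<and> d (x * y) = x * d y + y * d x)"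

lemma is_derivation_0: "is_derivation d \<Longrightarrow> d 0 = 0"
  unfolding is_derivation_def by (metis add_cancel_right_left)

lemma is_derivation_pderiv: "is_derivation (pderiv :: 'a::idom Polynomial.poly \<Rightarrow> _)"
  by (simp add: is_derivation_def pderiv_add pderiv_mult)

lemma is_derivation_map_poly:
  assumes "is_derivation d"
  shows "is_derivation (map_poly d)"
proof -
  note d = assms[unfolded is_derivation_def] is_derivation_0[OF assms]
  have add: "map_poly d (p + q) = map_poly d p + map_poly d q" for p q
    using d by (intro map_poly_add) auto
  have smult: "map_poly d (Polynomial.smult a q) = Polynomial.smult (d a) q + Polynomial.smult a (map_poly d q)" for a q
    using d by (intro poly_eqI) (simp add: coeff_map_poly algebra_simps)
  have "map_poly d (p * q) = p * map_poly d q + q * map_poly d p" for p q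
  proof (induction p)
    case (pCons a p)
    then show ?case
      using d by (simp add: map_poly_pCons smult add algebra_simps)
  qed simp
  then show ?thesis by (simp add: is_derivation_def add)
qed

definition partial3 :: "3 \<Rightarrow> 'a::idom poly3 \<Rightarrow> 'a poly3" where
  "partial3 i = (if i = 1 then map_poly (map_poly pderiv) else if i = 2 then map_poly pderiv else pderiv)"

lemma is_derivation_partial3: "is_derivation (partial3 i :: 'a::idom poly3 \<Rightarrow> _)"
  by (simp add: partial3_def is_derivation_map_poly is_derivation_pderiv)

lemma partial3_const3 [simp]: "partial3 i (const3 c :: 'a::idom poly3) = 0"
  by (simp add: partial3_def const3_def map_poly_pCons pderiv_pCons)

lemma partial3_coords3 [simp]: "partial3 i (coords3 $ j :: 'a::idom poly3) = (if i = j then 1 else 0)"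
  using exhaust_3[of i] exhaust_3[of j]
  by (auto simp: partial3_def coords3_nth map_poly_pCons pderiv_pCons one_pCons)

lemma partial_derivs_eq: "partial_derivs F = range (\<lambda>i. partial3 i F)"
proof -
  have "range (\<lambda>i. partial3 i F) = {partial3 1 F, partial3 2 F, partial3 3 F}"
    unfolding UNIV_3 by simp
  then show ?thesis by (simp add: partial_derivs_def partial3_def)
qed


lemma partial3_carrier:
  fixes F :: "'a::idom poly3"
  assumes "is_subring S" "F \<in> carrier (poly_ring3 S)"
  shows "partial3 i F \<in> carrier (poly_ring3 S)"
proof -
  note S = is_subring_carrier[OF assms(1)] is_subring_0[OF is_subring_carrier[OF assms(1)]]
  have "F \<in> carrier (poly_ring3 S) \<and> partial3 i F \<in> carrier (poly_ring3 S)"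
    using assms(2)
  proof (induction F rule: poly3_induct)
    case (const c)
    then show ?case using S const3_carrier[OF assms(1)] by simp
  next
    case (coord j)
    then show ?case using S coords3_carrier[OF assms(1)] by (simp add: is_subring_def)
  qed (use S in \<open>simp_all add: is_derivation_partial3[unfolded is_derivation_def] is_subring_def\<close>)
  then show ?thesis by simp
qed

text \<open>Taylor expansion along a line, with a remainder that is polynomial in \<open>e\<close>.
  It turns the vanishing of \<open>F\<close> and its partial derivatives into a double zero on every
  line through the point, a condition that does not depend on coordinates.\<close>

lemma eval3_taylor:
  fixes F :: "'a::idom poly3"
  shows "\<exists>R. \<forall>e. eval3 F (p + e *s x) =
    eval3 F p + e * (\<Sum>i\<in>UNIV. eval3 (partial3 i F) p * x $ i) + e ^ 2 * Polynomial.poly R e"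
  using univ_carrier[of F]
proof (induction F rule: poly3_induct)
  case (const c)
  show ?case by (intro exI[of _ 0]) simp
next
  case (coord i)
  have "(\<Sum>j\<in>UNIV. eval3 (partial3 j (coords3 $ i)) p * x $ j) = x $ i"
    by (simp add: if_distrib[of "\<lambda>F. eval3 F p"] if_distrib[of "\<lambda>a. a * _"] cong: if_cong)
  then show ?case by (intro exI[of _ 0]) simp
next
  case (add F G)
  then obtain R S where R: "\<And>e. eval3 F (p + e *s x) =
      eval3 F p + e * (\<Sum>i\<in>UNIV. eval3 (partial3 i F) p * x $ i) + e ^ 2 * Polynomial.poly R e"
    and S: "\<And>e. eval3 G (p + e *s x) =
      eval3 G p + e * (\<Sum>i\<in>UNIV. eval3 (partial3 i G) p * x $ i) + e ^ 2 * Polynomial.poly S e"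
    by blast
  show ?case
    by (intro exI[of _ "R + S"])
      (simp add: R S is_derivation_partial3[unfolded is_derivation_def] sum.distrib algebra_simps)
next
  case (mult F G)
  then obtain R S where R: "\<And>e. eval3 F (p + e *s x) =
      eval3 F p + e * (\<Sum>i\<in>UNIV. eval3 (partial3 i F) p * x $ i) + e ^ 2 * Polynomial.poly R e"
    and S: "\<And>e. eval3 G (p + e *s x) =
      eval3 G p + e * (\<Sum>i\<in>UNIV. eval3 (partial3 i G) p * x $ i) + e ^ 2 * Polynomial.poly S e"
    by blast
  define a where "a = (\<Sum>i\<in>UNIV. eval3 (partial3 i F) p * x $ i)"
  define b where "b = (\<Sum>i\<in>UNIV. eval3 (partial3 i G) p * x $ i)"
  have ab: "(\<Sum>i\<in>UNIV. eval3 (partial3 i (F * G)) p * x $ i) = eval3 F p * b + eval3 G p * a"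
    by (simp add: a_def b_def is_derivation_partial3[unfolded is_derivation_def] sum.distrib sum_distrib_left algebra_simps)
  show ?case
    unfolding ab
    \<comment> \<open>The part divisible by \<open>e ^ 2\<close> in the product of the two
      expansions, divided by \<open>e ^ 2\<close>.\<close>
    by (intro exI[of _ "[:a * b:] + [:0, a:] * S + [:0, b:] * R + [:eval3 F p:] * S + [:eval3 G p:] * R
        + [:0, 0, 1:] * R * S"] allI)
      (simp add: R[folded a_def] S[folded b_def] algebra_simps power2_eq_square)
qed

lemma low_coeffs_0:
  fixes a b :: "'a::idom"
  assumes "infinite (UNIV :: 'a set)" and "\<And>e. a + b * e + e ^ 2 * Polynomial.poly R e = 0"
  shows "a = 0 \<and> b = 0"
proof -
  let ?p = "pCons a (pCons b R)"
  have "Polynomial.poly ?p e = 0" for e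
    using assms(2)[of e] by (simp add: algebra_simps power2_eq_square)
  then have "?p = 0" using assms(1) poly_roots_finite[of ?p] by auto
  then show ?thesis by simp
qed

subsection \<open>Ternary forms in coordinates adapted to two points\<close>

definition det3 :: "'a::comm_ring_1 ^ 3 \<Rightarrow> 'a ^ 3 \<Rightarrow> 'a ^ 3 \<Rightarrow> 'a" where
  "det3 a b c = a $ 1 * (b $ 2 * c $ 3 - b $ 3 * c $ 2) - a $ 2 * (b $ 1 * c $ 3 - b $ 3 * c $ 1)
     + a $ 3 * (b $ 1 * c $ 2 - b $ 2 * c $ 1)"

lemma cramer3:
  fixes p q e v :: "'a::Fields.field ^ 3"
  assumes "det3 p q e \<noteq> 0"
  shows "v $ i = (det3 v q e / det3 p q e) * p $ i + (det3 p v e / det3 p q e) * q $ i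
    + (det3 p q v / det3 p q e) * e $ i"
proof -
  have "v $ i * det3 p q e = det3 v q e * p $ i + det3 p v e * q $ i + det3 p q v * e $ i"
    using exhaust_3[of i] by (elim disjE) (simp_all add: det3_def algebra_simps)
  then show ?thesis using assms by (simp add: field_simps)
qed

text \<open>These are the monomials that can occur when a derivation is applied to the adapted form
  of \<open>F\<close>. The powers \<open>s ^ 4\<close> and \<open>r ^ 4\<close> are absent, since
  replacing one factor in a monomial of \<open>F\<close> never produces them.\<close>

lemma quartic_eq_0_imp:
  fixes h1 :: "'a::idom"
  assumes "infinite (UNIV :: 'a set)"
    and "\<And>s r x. h1 * (s ^ 3 * r) + h2 * (s * r ^ 3) + h3 * (s ^ 2 * r ^ 2) + h4 * (s ^ 3 * x) + h5 * (r ^ 3 * x)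
     + h6 * (s ^ 2 * r * x) + h7 * (s * r ^ 2 * x) + h8 * (s ^ 2 * x ^ 2) + h9 * (s * r * x ^ 2) + h10 * (r ^ 2 * x ^ 2)
     + h11 * (s * x ^ 3) + h12 * (r * x ^ 3) + h13 * x ^ 4 = (0 :: 'a)"
  shows "h1 = 0 \<and> h2 = 0 \<and> h3 = 0 \<and> h4 = 0 \<and> h5 = 0 \<and> h6 = 0 \<and> h7 = 0 \<and> h8 = 0 \<and> h9 = 0 \<and> h10 = 0"
proof -
  have poly_0: "q = 0" if "\<And>x. Polynomial.poly q x = 0" for q :: "'a Polynomial.poly"
    using that assms(1) poly_roots_finite[of q] by auto
  have "[:h13 * x ^ 4 + h12 * (r * x ^ 3) + h10 * (r ^ 2 * x ^ 2) + h5 * (r ^ 3 * x),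
     h11 * x ^ 3 + h9 * (r * x ^ 2) + h7 * (r ^ 2 * x) + h2 * r ^ 3,
     h8 * x ^ 2 + h6 * (r * x) + h3 * r ^ 2, h4 * x + h1 * r:] = 0" for r x
  proof (rule poly_0)
    fix s
    show "Polynomial.poly [:h13 * x ^ 4 + h12 * (r * x ^ 3) + h10 * (r ^ 2 * x ^ 2) + h5 * (r ^ 3 * x),
      h11 * x ^ 3 + h9 * (r * x ^ 2) + h7 * (r ^ 2 * x) + h2 * r ^ 3,
      h8 * x ^ 2 + h6 * (r * x) + h3 * r ^ 2, h4 * x + h1 * r:] s = 0"
      using assms(2)[of s r x]
      by (simp add: algebra_simps power2_eq_square power3_eq_cube power4_eq_xxxx)
  qed
  then have 1: "h13 * x ^ 4 + h12 * (r * x ^ 3) + h10 * (r ^ 2 * x ^ 2) + h5 * (r ^ 3 * x) = 0"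
    "h11 * x ^ 3 + h9 * (r * x ^ 2) + h7 * (r ^ 2 * x) + h2 * r ^ 3 = 0"
    "h8 * x ^ 2 + h6 * (r * x) + h3 * r ^ 2 = 0" "h4 * x + h1 * r = 0" for r x
    by auto
  have "[:h13, h12, h10, h5:] = 0"
    by (rule poly_0) (use 1(1)[of 1] in \<open>simp add: algebra_simps power2_eq_square power3_eq_cube\<close>)
  moreover have "[:h11, h9, h7, h2:] = 0"
    by (rule poly_0) (use 1(2)[of 1] in \<open>simp add: algebra_simps power2_eq_square power3_eq_cube\<close>)
  moreover have "[:h8, h6, h3:] = 0"
    by (rule poly_0) (use 1(3)[of 1] in \<open>simp add: algebra_simps power2_eq_square power3_eq_cube\<close>)
  ultimately show ?thesis using 1(4)[of 1 0] 1(4)[of 0 1] by simp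
qed

context char3_field
begin

lemma quartic_expansion:
  fixes p q e :: "'k alg_closure ^ 3"
  assumes "F \<in> carrier (poly_ring3 cuberoot_field)" "homogeneous 4 F"
    and "\<And>i. p $ i \<in> cuberoot_field" "\<And>i. q $ i \<in> cuberoot_field" "\<And>i. e $ i \<in> cuberoot_field"
  obtains C :: "nat \<Rightarrow> nat \<Rightarrow> nat \<Rightarrow> 'k alg_closure" where "\<And>i j k. C i j k \<in> cuberoot_field"
    and "\<And>s r x. eval3 F (s *s p + r *s q + x *s e) =
      C 4 0 0 * s ^ 4 + C 3 1 0 * (s ^ 3 * r) + C 2 2 0 * (s ^ 2 * r ^ 2) + C 1 3 0 * (s * r ^ 3) + C 0 4 0 * r ^ 4
      + C 3 0 1 * (s ^ 3 * x) + C 2 1 1 * (s ^ 2 * r * x) + C 1 2 1 * (s * r ^ 2 * x) + C 0 3 1 * (r ^ 3 * x)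
      + C 2 0 2 * (s ^ 2 * x ^ 2) + C 1 1 2 * (s * r * x ^ 2) + C 0 2 2 * (r ^ 2 * x ^ 2)
      + C 1 0 3 * (s * x ^ 3) + C 0 1 3 * (r * x ^ 3) + C 0 0 4 * x ^ 4"
proof -
  define W :: "'k alg_closure poly3 ^ 3" where
    "W = (\<chi> i. const3 (p $ i) * coords3 $ 1 + const3 (q $ i) * coords3 $ 2 + const3 (e $ i) * coords3 $ 3)"
  have ev: "eval3 (compose3 F W) v = eval3 F (v $ 1 *s p + v $ 2 *s q + v $ 3 *s e)" for v
    unfolding eval3_compose3 by (rule arg_cong[of _ _ "eval3 F"]) (simp add: vec_eq_iff W_def mult.commute)
  have "W $ i \<in> carrier (poly_ring3 cuberoot_field)" for i
    using is_subring_carrier[OF is_subring_cuberoot] coords3_carrier[OF is_subring_cuberoot] assms(3-5)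
      const3_carrier[OF is_subring_cuberoot] by (simp add: W_def is_subring_def)
  then have car: "compose3 F W \<in> carrier (poly_ring3 cuberoot_field)"
    by (intro compose3_carrier is_subring_cuberoot assms(1))
  have hom: "homogeneous 4 (compose3 F W)"
  proof (rule homogeneousI[OF inf_ac])
    fix c and v :: "'k alg_closure ^ 3"
    have "eval3 (compose3 F W) (c *s v) = eval3 F (c *s (v $ 1 *s p + v $ 2 *s q + v $ 3 *s e))"
      unfolding ev by (rule arg_cong[of _ _ "eval3 F"]) (simp add: vec_eq_iff algebra_simps)
    also have "\<dots> = c ^ 4 * eval3 F (v $ 1 *s p + v $ 2 *s q + v $ 3 *s e)"
      by (rule eval3_homogeneous[OF assms(2)])
    finally show "eval3 (compose3 F W) (c *s v) = c ^ 4 * eval3 (compose3 F W) v"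
      by (simp only: ev)
  qed
  show ?thesis
  proof (rule that)
    show "coeff3 (compose3 F W) i j k \<in> cuberoot_field" for i j k
      using car by (simp add: carrier_poly_ring3)
    fix s r x
    have "eval3 F (s *s p + r *s q + x *s e) = eval3 (compose3 F W) (vector [s, r, x])"
      by (simp add: ev)
    also have "\<dots> = coeff3 (compose3 F W) 4 0 0 * s ^ 4 + coeff3 (compose3 F W) 3 1 0 * (s ^ 3 * r)
      + coeff3 (compose3 F W) 2 2 0 * (s ^ 2 * r ^ 2) + coeff3 (compose3 F W) 1 3 0 * (s * r ^ 3)
      + coeff3 (compose3 F W) 0 4 0 * r ^ 4
      + coeff3 (compose3 F W) 3 0 1 * (s ^ 3 * x) + coeff3 (compose3 F W) 2 1 1 * (s ^ 2 * r * x)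
      + coeff3 (compose3 F W) 1 2 1 * (s * r ^ 2 * x) + coeff3 (compose3 F W) 0 3 1 * (r ^ 3 * x)
      + coeff3 (compose3 F W) 2 0 2 * (s ^ 2 * x ^ 2) + coeff3 (compose3 F W) 1 1 2 * (s * r * x ^ 2)
      + coeff3 (compose3 F W) 0 2 2 * (r ^ 2 * x ^ 2)
      + coeff3 (compose3 F W) 1 0 3 * (s * x ^ 3) + coeff3 (compose3 F W) 0 1 3 * (r * x ^ 3)
      + coeff3 (compose3 F W) 0 0 4 * x ^ 4"
    proof -
      have "{..4 :: nat} = {0, 1, 2, 3, 4}" "{..3 :: nat} = {0, 1, 2, 3}" "{..2 :: nat} = {0, 1, 2}"
        "{..1 :: nat} = {0, 1}" by auto
      then show ?thesis
        unfolding eval3_homogeneous_sum[OF hom] by (simp add: add_ac)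
    qed
    finally show "eval3 F (s *s p + r *s q + x *s e) = \<dots>" .
  qed
qed

text \<open>A double zero at \<open>p\<close> on the lines joining it to \<open>q\<close> and
  \<open>e\<close> removes \<open>s ^ 4\<close>, \<open>s ^ 3 * r\<close> and
  \<open>s ^ 3 * x\<close>; the double zeros at \<open>q\<close> remove the corresponding terms in
  \<open>r\<close>.\<close>

lemma singular_pair_expansion:
  fixes p q e :: "'k alg_closure ^ 3"
  assumes "F \<in> carrier (poly_ring3 cuberoot_field)" "homogeneous 4 F"
    and "\<And>i. p $ i \<in> cuberoot_field" "\<And>i. q $ i \<in> cuberoot_field" "\<And>i. e $ i \<in> cuberoot_field"
    and "eval3 F p = 0" "\<And>i. eval3 (partial3 i F) p = 0"
    and "eval3 F q = 0" "\<And>i. eval3 (partial3 i F) q = 0"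
  obtains k \<alpha> \<beta> a b c m1 m2 m3 where "{k, \<alpha>, \<beta>, a, b, c, m1, m2, m3} \<subseteq> cuberoot_field"
    and "\<And>s r x. eval3 F (s *s p + r *s q + x *s e) =
      k * (s ^ 2 * r ^ 2) + \<alpha> * (s ^ 2 * r * x) + \<beta> * (s * r ^ 2 * x) + a * (s ^ 2 * x ^ 2)
      + b * (s * r * x ^ 2) + c * (r ^ 2 * x ^ 2) + x ^ 3 * (m1 * s + m2 * r + m3 * x)"
proof -
  obtain C :: "nat \<Rightarrow> nat \<Rightarrow> nat \<Rightarrow> 'k alg_closure" where C: "\<And>i j k. C i j k \<in> cuberoot_field"
    and ev: "\<And>s r x. eval3 F (s *s p + r *s q + x *s e) =
      C 4 0 0 * s ^ 4 + C 3 1 0 * (s ^ 3 * r) + C 2 2 0 * (s ^ 2 * r ^ 2) + C 1 3 0 * (s * r ^ 3) + C 0 4 0 * r ^ 4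
      + C 3 0 1 * (s ^ 3 * x) + C 2 1 1 * (s ^ 2 * r * x) + C 1 2 1 * (s * r ^ 2 * x) + C 0 3 1 * (r ^ 3 * x)
      + C 2 0 2 * (s ^ 2 * x ^ 2) + C 1 1 2 * (s * r * x ^ 2) + C 0 2 2 * (r ^ 2 * x ^ 2)
      + C 1 0 3 * (s * x ^ 3) + C 0 1 3 * (r * x ^ 3) + C 0 0 4 * x ^ 4"
    using quartic_expansion[OF assms(1-5)] by metis
  have sing: "\<exists>R. \<forall>t. eval3 F (z + t *s y) = t ^ 2 * Polynomial.poly R t" if "z = p \<or> z = q" for z y
    using eval3_taylor[of F z y] assms(6-9) that by auto
  have "C 4 0 0 = 0 \<and> C 3 1 0 = 0"
  proof -
    obtain R where R: "\<And>t. eval3 F (p + t *s q) = t ^ 2 * Polynomial.poly R t" using sing by blast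
    show ?thesis
      by (rule low_coeffs_0[OF inf_ac, of _ _ "[:C 2 2 0, C 1 3 0, C 0 4 0:] - R"])
        (use ev[of 1 _ 0] R in \<open>simp add: algebra_simps power2_eq_square power3_eq_cube power4_eq_xxxx\<close>)
  qed
  moreover have "C 4 0 0 = 0 \<and> C 3 0 1 = 0"
  proof -
    obtain R where R: "\<And>t. eval3 F (p + t *s e) = t ^ 2 * Polynomial.poly R t" using sing by blast
    show ?thesis
      by (rule low_coeffs_0[OF inf_ac, of _ _ "[:C 2 0 2, C 1 0 3, C 0 0 4:] - R"])
        (use ev[of 1 0 _] R in \<open>simp add: algebra_simps power2_eq_square power3_eq_cube power4_eq_xxxx\<close>)
  qed
  moreover have "C 0 4 0 = 0 \<and> C 1 3 0 = 0"
  proof -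
    obtain R where R: "\<And>t. eval3 F (q + t *s p) = t ^ 2 * Polynomial.poly R t" using sing by blast
    show ?thesis
      by (rule low_coeffs_0[OF inf_ac, of _ _ "[:C 2 2 0, C 3 1 0, C 4 0 0:] - R"])
        (use ev[of _ 1 0] R in \<open>simp add: algebra_simps power2_eq_square power3_eq_cube power4_eq_xxxx\<close>)
  qed
  moreover have "C 0 4 0 = 0 \<and> C 0 3 1 = 0"
  proof -
    obtain R where R: "\<And>t. eval3 F (q + t *s e) = t ^ 2 * Polynomial.poly R t" using sing by blast
    show ?thesis
      by (rule low_coeffs_0[OF inf_ac, of _ _ "[:C 0 2 2, C 0 1 3, C 0 0 4:] - R"])
        (use ev[of 0 1 _] R in \<open>simp add: algebra_simps power2_eq_square power3_eq_cube power4_eq_xxxx\<close>)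
  qed
  ultimately have "eval3 F (s *s p + r *s q + x *s e) =
      C 2 2 0 * (s ^ 2 * r ^ 2) + C 2 1 1 * (s ^ 2 * r * x) + C 1 2 1 * (s * r ^ 2 * x) + C 2 0 2 * (s ^ 2 * x ^ 2)
      + C 1 1 2 * (s * r * x ^ 2) + C 0 2 2 * (r ^ 2 * x ^ 2)
      + x ^ 3 * (C 1 0 3 * s + C 0 1 3 * r + C 0 0 4 * x)" for s r x
    unfolding ev by (simp add: algebra_simps power3_eq_cube power4_eq_xxxx)
  then show ?thesis
    by (intro that[of "C 2 2 0" "C 2 1 1" "C 1 2 1" "C 2 0 2" "C 1 1 2" "C 0 2 2" "C 1 0 3" "C 0 1 3" "C 0 0 4"])
      (use C in auto)
qed

end

lemma det3_indep:
  fixes p q e :: "'a::idom ^ 3"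
  assumes "det3 p q e \<noteq> 0" and "\<And>i. a * p $ i + b * q $ i + c * e $ i = 0"
  shows "a = 0" "b = 0" "c = 0"
proof -
  have "a * det3 p q e = det3 (\<chi> i. a * p $ i + b * q $ i + c * e $ i) q e"
    "b * det3 p q e = det3 p (\<chi> i. a * p $ i + b * q $ i + c * e $ i) e"
    "c * det3 p q e = det3 p q (\<chi> i. a * p $ i + b * q $ i + c * e $ i)"
    by (simp_all add: det3_def algebra_simps)
  moreover have "det3 0 q e = 0" "det3 p 0 e = 0" "det3 p q 0 = 0"
    by (simp_all add: det3_def)
  moreover have "(\<chi> i. a * p $ i + b * q $ i + c * e $ i) = 0"
    using assms(2) by (simp add: vec_eq_iff)
  ultimately show "a = 0" "b = 0" "c = 0" using assms(1) by auto
qed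

lemma det3_combine:
  "det3 (s *s p + r *s q + x *s e) q e = s * det3 p q e"
  "det3 p (s *s p + r *s q + x *s e) e = r * det3 p q e"
  "det3 p q (s *s p + r *s q + x *s e) = x * det3 p q e"
  by (simp_all add: det3_def algebra_simps)

section \<open>Derivations in the adapted coordinates\<close>

context char3_field
begin

lemma inf_base: "infinite (base_field :: 'k alg_closure set)"
  unfolding base_field_def using inf finite_imageD[OF _ inj_to_ac] by blast

context
  fixes p q e :: "'k alg_closure ^ 3" and F :: "'k alg_closure poly3"
    and k \<alpha> \<beta> a b c m1 m2 m3 :: "'k alg_closure"
  assumes p: "\<And>i. p $ i \<in> cuberoot_field" and q: "\<And>i. q $ i \<in> cuberoot_field"
    and e: "\<And>i. e $ i \<in> base_field" and det: "det3 p q e \<noteq> 0"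
    and F: "F \<in> carrier (poly_ring3 base_field)"
    and coeffs: "{k, \<alpha>, \<beta>, a, b, c, m1, m2, m3} \<subseteq> cuberoot_field"
    and ev: "\<And>s r x. eval3 F (s *s p + r *s q + x *s e) =
      k * (s ^ 2 * r ^ 2) + \<alpha> * (s ^ 2 * r * x) + \<beta> * (s * r ^ 2 * x) + a * (s ^ 2 * x ^ 2)
      + b * (s * r * x ^ 2) + c * (r ^ 2 * x ^ 2) + x ^ 3 * (m1 * s + m2 * r + m3 * x)"
begin

text \<open>Cramer's rule for the coordinates \<open>s\<close>, \<open>r\<close>, \<open>x\<close>
  of a vector in the basis \<open>p\<close>, \<open>q\<close>, \<open>e\<close>.\<close>

definition "cs v = det3 v q e / det3 p q e"
definition "cr v = det3 p v e / det3 p q e"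
definition "cx v = det3 p q v / det3 p q e"

lemma coords_expand: "v = cs v *s p + cr v *s q + cx v *s e"
  using cramer3[OF det, of v] by (simp add: vec_eq_iff cs_def cr_def cx_def)

lemma coords_combine:
  "cs (s *s p + r *s q + x *s e) = s" "cr (s *s p + r *s q + x *s e) = r"
  "cx (s *s p + r *s q + x *s e) = x"
  using det by (simp_all add: cs_def cr_def cx_def det3_combine)

lemma e_L: "e $ i \<in> cuberoot_field"
  using e base_subset_cuberoot by blast

lemma coords_L:
  assumes "\<And>i. v $ i \<in> cuberoot_field"
  shows "cs v \<in> cuberoot_field" "cr v \<in> cuberoot_field" "cx v \<in> cuberoot_field"
  unfolding cs_def cr_def cx_def det3_def using assms p q e_L by auto

lemma coords_linear:
  "\<exists>x y z. \<forall>v. cs v = x * v $ 1 + y * v $ 2 + z * v $ 3"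
  "\<exists>x y z. \<forall>v. cr v = x * v $ 1 + y * v $ 2 + z * v $ 3"
  "\<exists>x y z. \<forall>v. cx v = x * v $ 1 + y * v $ 2 + z * v $ 3"
proof -
  define d where "d = det3 p q e"
  have lin: "\<exists>x' y' z'. \<forall>v :: 'k alg_closure ^ 3.
      (v $ 1 * x + v $ 2 * y + v $ 3 * z) / d = x' * v $ 1 + y' * v $ 2 + z' * v $ 3" for x y z
    by (rule exI[of _ "x / d"],
      rule exI[of _ "y / d"],
      rule exI[of _ "z / d"])
      (simp add: divide_inverse algebra_simps)
  have det: "det3 v q e = v $ 1 * (q $ 2 * e $ 3 - q $ 3 * e $ 2)
      + v $ 2 * (q $ 3 * e $ 1 - q $ 1 * e $ 3) + v $ 3 * (q $ 1 * e $ 2 - q $ 2 * e $ 1)"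
    "det3 p v e = v $ 1 * (p $ 3 * e $ 2 - p $ 2 * e $ 3)
      + v $ 2 * (p $ 1 * e $ 3 - p $ 3 * e $ 1) + v $ 3 * (p $ 2 * e $ 1 - p $ 1 * e $ 2)"
    "det3 p q v = v $ 1 * (p $ 2 * q $ 3 - p $ 3 * q $ 2)
      + v $ 2 * (p $ 3 * q $ 1 - p $ 1 * q $ 3) + v $ 3 * (p $ 1 * q $ 2 - p $ 2 * q $ 1)" for v
    by (simp_all add: det3_def algebra_simps)
  show "\<exists>x y z. \<forall>v. cs v = x * v $ 1 + y * v $ 2 + z * v $ 3"
    unfolding cs_def d_def[symmetric] unfolding det(1) by (rule lin)
  show "\<exists>x y z. \<forall>v. cr v = x * v $ 1 + y * v $ 2 + z * v $ 3"
    unfolding cr_def d_def[symmetric] unfolding det(2) by (rule lin)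
  show "\<exists>x y z. \<forall>v. cx v = x * v $ 1 + y * v $ 2 + z * v $ 3"
    unfolding cx_def d_def[symmetric] unfolding det(3) by (rule lin)
qed

lemma coords_polys:
  obtains PS PR PX where "\<And>v. eval3 PS v = cs v" "\<And>v. eval3 PR v = cr v" "\<And>v. eval3 PX v = cx v"
proof -
  have "\<exists>P. \<forall>v. eval3 P v = x * v $ 1 + y * v $ 2 + z * v $ 3" for x y z :: "'k alg_closure"
    by (intro exI[of _ "const3 x * coords3 $ 1 + const3 y * coords3 $ 2 + const3 z * coords3 $ 3"]) simp
  then show ?thesis using that coords_linear by metis
qed

context
  fixes D p1 p2 p3 q1 q2 q3
  assumes D: "K_derivation D"
    and Dp: "\<And>i. D (p $ i) = p1 * p $ i + p2 * q $ i + p3 * e $ i"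
    and Dq: "\<And>i. D (q $ i) = q1 * p $ i + q2 * q $ i + q3 * e $ i"
begin

text \<open>A vector over \<open>K\<close> is constant, so differentiating its expansion in the
  basis \<open>p\<close>, \<open>q\<close>, \<open>e\<close> gives zero in each coordinate. The
  vector \<open>e\<close> is constant too, which is why only the derivatives of \<open>p\<close> and
  \<open>q\<close> appear.\<close>

lemma deriv_coords:
  assumes "\<And>i. v $ i \<in> base_field"
  shows "D (cs v) = - (cs v * p1 + cr v * q1)" "D (cr v) = - (cs v * p2 + cr v * q2)"
    "D (cx v) = - (cs v * p3 + cr v * q3)"
proof -
  have L: "cs v \<in> cuberoot_field" "cr v \<in> cuberoot_field" "cx v \<in> cuberoot_field"
    using coords_L[of v] assms base_subset_cuberoot by blast+
  have "(D (cs v) + cs v * p1 + cr v * q1) * p $ i + (D (cr v) + cs v * p2 + cr v * q2) * q $ i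
      + (D (cx v) + cs v * p3 + cr v * q3) * e $ i = 0" for i
  proof -
    have "v $ i = (cs v *s p + cr v *s q + cx v *s e) $ i" using coords_expand[of v] by simp
    then have "v $ i = cs v * p $ i + cr v * q $ i + cx v * e $ i" by simp
    then have "D (cs v * p $ i + cr v * q $ i + cx v * e $ i) = 0"
      using deriv_base[OF D assms[of i]] by simp
    moreover have "D (e $ i) = 0" by (rule deriv_base[OF D e])
    ultimately show ?thesis
      using L p q e_L by (simp add: deriv_simps[OF D] Dp Dq algebra_simps)
  qed
  from det3_indep[OF det this]
  show "D (cs v) = - (cs v * p1 + cr v * q1)" "D (cr v) = - (cs v * p2 + cr v * q2)"
    "D (cx v) = - (cs v * p3 + cr v * q3)"
    by (metis add.assoc eq_neg_iff_add_eq_0)+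
qed

text \<open>At vectors over \<open>K\<close> the value of \<open>F\<close> is killed by
  \<open>D\<close>. Expanding this in the coordinates gives a quartic form in \<open>s\<close>,
  \<open>r\<close>, \<open>x\<close> that must vanish; the relations are its coefficients.\<close>

lemma deriv_relations:
  "2 * k * p2 + \<alpha> * p3 = 0" "2 * k * q1 + \<beta> * q3 = 0"
  "D k = 2 * k * p1 + 2 * k * q2 + \<alpha> * q3 + \<beta> * p3"
  "\<alpha> * p2 + 2 * a * p3 = 0" "\<beta> * q1 + 2 * c * q3 = 0"
  "D \<alpha> = 2 * \<alpha> * p1 + \<alpha> * q2 + 2 * \<beta> * p2 + 2 * a * q3 + 2 * b * p3"
  "D \<beta> = \<beta> * p1 + 2 * \<alpha> * q1 + 2 * \<beta> * q2 + 2 * b * q3 + 2 * c * p3"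
  "D b = b * p1 + 2 * a * q1 + b * q2 + 2 * c * p2"
proof -
  \<comment> \<open>\<open>h1\<close> to \<open>h13\<close> are the coefficients of the negated
    derivative. As \<open>x ^ 3\<close> is constant, \<open>m1\<close>, \<open>m2\<close>,
    \<open>m3\<close> enter only the last three.\<close>
  define h1 where "h1 = 2 * k * p2 + \<alpha> * p3"
  define h2 where "h2 = 2 * k * q1 + \<beta> * q3"
  define h3 where "h3 = 2 * k * p1 + 2 * k * q2 + \<alpha> * q3 + \<beta> * p3 - D k"
  define h4 where "h4 = \<alpha> * p2 + 2 * a * p3"
  define h5 where "h5 = \<beta> * q1 + 2 * c * q3"
  define h6 where "h6 = 2 * \<alpha> * p1 + \<alpha> * q2 + 2 * \<beta> * p2 + 2 * a * q3 + 2 * b * p3 - D \<alpha>"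
  define h7 where "h7 = \<beta> * p1 + 2 * \<alpha> * q1 + 2 * \<beta> * q2 + 2 * b * q3 + 2 * c * p3 - D \<beta>"
  define h8 where "h8 = 2 * a * p1 + b * p2 - D a"
  define h9 where "h9 = b * p1 + 2 * a * q1 + b * q2 + 2 * c * p2 - D b"
  define h10 where "h10 = b * q1 + 2 * c * q2 - D c"
  define h11 where "h11 = m1 * p1 + m2 * p2 + m3 * p3 - D m1"
  define h12 where "h12 = m1 * q1 + m2 * q2 + m3 * q3 - D m2"
  define h13 where "h13 = - D m3"
  note h_defs = h1_def h2_def h3_def h4_def h5_def h6_def h7_def h8_def h9_def h10_def h11_def h12_def h13_def
  define h where "h s r x = h1 * (s ^ 3 * r) + h2 * (s * r ^ 3) + h3 * (s ^ 2 * r ^ 2) + h4 * (s ^ 3 * x) + h5 * (r ^ 3 * x)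
     + h6 * (s ^ 2 * r * x) + h7 * (s * r ^ 2 * x) + h8 * (s ^ 2 * x ^ 2) + h9 * (s * r * x ^ 2) + h10 * (r ^ 2 * x ^ 2)
     + h11 * (s * x ^ 3) + h12 * (r * x ^ 3) + h13 * x ^ 4" for s r x
  have base: "h (cs v) (cr v) (cx v) = 0" if v: "\<And>i. v $ i \<in> base_field" for v
  proof -
    define s r x where "s = cs v" and "r = cr v" and "x = cx v"
    have L: "s \<in> cuberoot_field" "r \<in> cuberoot_field" "x \<in> cuberoot_field"
      unfolding s_def r_def x_def using coords_L[of v] v base_subset_cuberoot by blast+
    have Ds: "D s = - (s * p1 + r * q1)" "D r = - (s * p2 + r * q2)" "D x = - (s * p3 + r * q3)"
      unfolding s_def r_def x_def by (rule deriv_coords[OF v])+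
    have "eval3 F v \<in> base_field" by (rule eval3_in[OF is_subring_base F v])
    then have "D (eval3 F (s *s p + r *s q + x *s e)) = 0"
      unfolding s_def r_def x_def using coords_expand[of v] deriv_base[OF D] by metis
    then have "D (k * (s ^ 2 * r ^ 2) + \<alpha> * (s ^ 2 * r * x) + \<beta> * (s * r ^ 2 * x) + a * (s ^ 2 * x ^ 2)
      + b * (s * r * x ^ 2) + c * (r ^ 2 * x ^ 2) + x ^ 3 * (m1 * s + m2 * r + m3 * x)) = 0"
      unfolding ev .
    moreover have "D (k * (s ^ 2 * r ^ 2) + \<alpha> * (s ^ 2 * r * x) + \<beta> * (s * r ^ 2 * x) + a * (s ^ 2 * x ^ 2)
      + b * (s * r * x ^ 2) + c * (r ^ 2 * x ^ 2) + x ^ 3 * (m1 * s + m2 * r + m3 * x)) = - h s r x"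
      using coeffs L
      apply (simp add: deriv_simps[OF D] Ds)
      apply (simp add: h_def h_defs algebra_simps power2_eq_square power3_eq_cube power4_eq_xxxx)
      done
    ultimately show ?thesis unfolding s_def r_def x_def by simp
  qed
  obtain PS PR PX where P: "\<And>v. eval3 PS v = cs v" "\<And>v. eval3 PR v = cr v" "\<And>v. eval3 PX v = cx v"
    using coords_polys by metis
  \<comment> \<open>The expression \<open>h\<close> is so far known to vanish only at coordinates of
    vectors over \<open>K\<close>; the polynomial \<open>H\<close> extends this to all
    \<open>s\<close>, \<open>r\<close>, \<open>x\<close>.\<close>
  define H where "H = const3 h1 * (PS ^ 3 * PR) + const3 h2 * (PS * PR ^ 3) + const3 h3 * (PS ^ 2 * PR ^ 2)
     + const3 h4 * (PS ^ 3 * PX) + const3 h5 * (PR ^ 3 * PX) + const3 h6 * (PS ^ 2 * PR * PX) + const3 h7 * (PS * PR ^ 2 * PX)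
     + const3 h8 * (PS ^ 2 * PX ^ 2) + const3 h9 * (PS * PR * PX ^ 2) + const3 h10 * (PR ^ 2 * PX ^ 2)
     + const3 h11 * (PS * PX ^ 3) + const3 h12 * (PR * PX ^ 3) + const3 h13 * PX ^ 4"
  have H: "eval3 H v = h (cs v) (cr v) (cx v)" for v
    by (simp add: H_def h_def P)
  have "H = 0"
    by (rule eval3_eq_0_imp[OF inf_base]) (use H base in auto)
  then have "h s r x = 0" for s r x
    using H[of "s *s p + r *s q + x *s e"] by (simp add: coords_combine)
  from quartic_eq_0_imp[OF inf_ac this[unfolded h_def]]
  show "2 * k * p2 + \<alpha> * p3 = 0" "2 * k * q1 + \<beta> * q3 = 0"
    "D k = 2 * k * p1 + 2 * k * q2 + \<alpha> * q3 + \<beta> * p3"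
    "\<alpha> * p2 + 2 * a * p3 = 0" "\<beta> * q1 + 2 * c * q3 = 0"
    "D \<alpha> = 2 * \<alpha> * p1 + \<alpha> * q2 + 2 * \<beta> * p2 + 2 * a * q3 + 2 * b * p3"
    "D \<beta> = \<beta> * p1 + 2 * \<alpha> * q1 + 2 * \<beta> * q2 + 2 * b * q3 + 2 * c * p3"
    "D b = b * p1 + 2 * a * q1 + b * q2 + 2 * c * p2"
    unfolding h_defs by auto
qed

text \<open>
  The form below is \<open>k\<^sup>2\<close> times the square root of \<open>F / k\<close> modulo \<open>x\<^sup>3\<close>, where \<open>1 / 2\<close> is replaced by \<open>- 1\<close>.
\<close>

lemma deriv_conic:
  assumes "\<alpha> ^ 2 = k * a" and "\<beta> ^ 2 = k * c" and v: "\<And>i. v $ i \<in> base_field"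
  shows "D (k ^ 2 * (cs v * cr v) - k * \<alpha> * (cs v * cx v) - k * \<beta> * (cr v * cx v) - (k * b + \<alpha> * \<beta>) * cx v ^ 2) = 0"
proof -
  define s r x where "s = cs v" and "r = cr v" and "x = cx v"
  have L: "s \<in> cuberoot_field" "r \<in> cuberoot_field" "x \<in> cuberoot_field"
    unfolding s_def r_def x_def using coords_L[of v] v base_subset_cuberoot by blast+
  have Ds: "D s = - (s * p1 + r * q1)" "D r = - (s * p2 + r * q2)" "D x = - (s * p3 + r * q3)"
    unfolding s_def r_def x_def by (rule deriv_coords[OF v])+
  note rel = deriv_relations
  have three: "(3 :: 'k alg_closure) = 0" by (rule three_eq_0)
  have eq: "D (k ^ 2 * (s * r) - k * \<alpha> * (s * x) - k * \<beta> * (r * x) - (k * b + \<alpha> * \<beta>) * x ^ 2) = 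
    (2 * k * D k - k ^ 2 * (p1 + q2) + k * \<alpha> * q3 + k * \<beta> * p3) * (s * r)
    + (k * \<alpha> * p3 - k ^ 2 * p2) * s ^ 2 + (k * \<beta> * q3 - k ^ 2 * q1) * r ^ 2
    + (k * \<alpha> * p1 + k * \<beta> * p2 + 2 * (k * b + \<alpha> * \<beta>) * p3 - k * D \<alpha> - \<alpha> * D k) * (s * x)
    + (k * \<alpha> * q1 + k * \<beta> * q2 + 2 * (k * b + \<alpha> * \<beta>) * q3 - k * D \<beta> - \<beta> * D k) * (r * x)
    - (k * D b + b * D k + \<alpha> * D \<beta> + \<beta> * D \<alpha>) * x ^ 2"
    using coeffs L
    apply (simp add: deriv_simps[OF D] Ds)
    apply (simp add: algebra_simps power2_eq_square)
    done
  have kp2: "k * p2 = \<alpha> * p3"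
  proof -
    have "k * p2 - \<alpha> * p3 = 3 * (k * p2) - (2 * k * p2 + \<alpha> * p3)" by (simp add: algebra_simps)
    then show ?thesis unfolding rel(1) three by simp
  qed
  have kq1: "k * q1 = \<beta> * q3"
  proof -
    have "k * q1 - \<beta> * q3 = 3 * (k * q1) - (2 * k * q1 + \<beta> * q3)" by (simp add: algebra_simps)
    then show ?thesis unfolding rel(2) three by simp
  qed
  \<comment> \<open>Each coefficient is three times an expression plus multiples of differences
    already known to vanish.\<close>
  have 1: "2 * k * D k - k ^ 2 * (p1 + q2) + k * \<alpha> * q3 + k * \<beta> * p3 =
      3 * (k ^ 2 * (p1 + q2) + k * \<alpha> * q3 + k * \<beta> * p3)"
    unfolding rel(3) by (simp add: algebra_simps power2_eq_square)
  have 2: "k * \<alpha> * p3 - k ^ 2 * p2 = k * (\<alpha> * p3 - k * p2)" "k * \<beta> * q3 - k ^ 2 * q1 = k * (\<beta> * q3 - k * q1)"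
    by (simp_all add: algebra_simps power2_eq_square)
  have 3: "k * \<alpha> * p1 + k * \<beta> * p2 + 2 * (k * b + \<alpha> * \<beta>) * p3 - k * D \<alpha> - \<alpha> * D k =
      3 * (- (k * \<alpha> * (p1 + q2) + \<alpha> ^ 2 * q3)) - \<beta> * (k * p2 - \<alpha> * p3) + 2 * q3 * (\<alpha> ^ 2 - k * a)"
    unfolding rel(3,6) by (simp add: algebra_simps power2_eq_square)
  have 4: "k * \<alpha> * q1 + k * \<beta> * q2 + 2 * (k * b + \<alpha> * \<beta>) * q3 - k * D \<beta> - \<beta> * D k =
      3 * (- (k * \<beta> * (p1 + q2) + \<beta> ^ 2 * p3)) - \<alpha> * (k * q1 - \<beta> * q3) + 2 * p3 * (\<beta> ^ 2 - k * c)"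
    unfolding rel(3,7) by (simp add: algebra_simps power2_eq_square)
  have 5: "k * D b + b * D k + \<alpha> * D \<beta> + \<beta> * D \<alpha> =
      3 * (k * b * (p1 + q2) + \<alpha> * b * q3 + \<beta> * b * p3 + \<alpha> * \<beta> * (p1 + q2) + 2 * \<alpha> ^ 2 * q1 + 2 * \<beta> ^ 2 * p2)
      + 4 * q1 * (k * a - \<alpha> ^ 2) + 4 * p2 * (k * c - \<beta> ^ 2)
      - 2 * a * (k * q1 - \<beta> * q3) - 2 * c * (k * p2 - \<alpha> * p3)"
    unfolding rel(3,6,7,8) by (simp add: algebra_simps power2_eq_square)
  show ?thesis
    unfolding s_def[symmetric] r_def[symmetric] x_def[symmetric] eq 1 2 3 4 5 three by (simp add: kp2 kq1 assms(1,2))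
qed

end

end

end

section \<open>The conic over \<open>K\<close> through two singular points\<close>

definition line :: "'k::Fields.field \<Rightarrow> 'k \<Rightarrow> 'k \<Rightarrow> 'k alg_closure ^ 3 \<Rightarrow> 'k alg_closure" where
  "line a b c v = to_ac a * v $ 1 + to_ac b * v $ 2 + to_ac c * v $ 3"

definition conic ::
    "'k::Fields.field \<Rightarrow> 'k \<Rightarrow> 'k \<Rightarrow> 'k \<Rightarrow> 'k \<Rightarrow> 'k \<Rightarrow> 'k alg_closure ^ 3 \<Rightarrow> 'k alg_closure" where
  "conic a b c d e f v = to_ac a * (v $ 1)\<^sup>2 + to_ac b * (v $ 1 * v $ 2) + to_ac c * (v $ 1 * v $ 3)
     + to_ac d * (v $ 2)\<^sup>2 + to_ac e * (v $ 2 * v $ 3) + to_ac f * (v $ 3)\<^sup>2"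

text \<open>Six values, at the coordinate vectors and their pairwise sums, determine a quadratic
  form; its coefficients are integral combinations of these values.\<close>

lemma conic_coeffs_base:
  fixes N :: "'k::Fields.field alg_closure ^ 3 \<Rightarrow> 'k alg_closure"
  assumes N: "\<And>v. N v = A * (v $ 1)\<^sup>2 + B * (v $ 1 * v $ 2) + C * (v $ 1 * v $ 3)
     + D * (v $ 2)\<^sup>2 + E * (v $ 2 * v $ 3) + F * (v $ 3)\<^sup>2"
    and base: "\<And>v. (\<forall>i. v $ i \<in> base_field) \<Longrightarrow> N v \<in> base_field"
  obtains a b c d e f where "\<And>v. N v = conic a b c d e f v"
proof -
  have ex: "\<exists>n. to_ac n = N (vector [to_ac x, to_ac y, to_ac z])" for x y z :: 'k
    using base[of "vector [to_ac x, to_ac y, to_ac z]"] by (force simp: forall_3 base_field_def)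
  obtain a where a: "to_ac a = N (vector [to_ac 1, to_ac 0, to_ac 0])" using ex by blast
  obtain d where d: "to_ac d = N (vector [to_ac 0, to_ac 1, to_ac 0])" using ex by blast
  obtain f where f: "to_ac f = N (vector [to_ac 0, to_ac 0, to_ac 1])" using ex by blast
  obtain b where b: "to_ac b = N (vector [to_ac 1, to_ac 1, to_ac 0])" using ex by blast
  obtain c where c: "to_ac c = N (vector [to_ac 1, to_ac 0, to_ac 1])" using ex by blast
  obtain e where e: "to_ac e = N (vector [to_ac 0, to_ac 1, to_ac 1])" using ex by blast
  have "A = to_ac a" "D = to_ac d" "F = to_ac f" "B = to_ac (b - a - d)" "C = to_ac (c - a - f)" "E = to_ac (e - d - f)"
    by (simp_all add: a b c d e f N)
  then have "N v = conic a (b - a - d) (c - a - f) d (e - d - f) f v" for v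
    unfolding N conic_def by simp
  then show ?thesis using that by blast
qed

context char3_field
begin

lemma conic_through_singular_points:
  fixes F :: "'k alg_closure poly3"
  assumes F: "plane_curve base_field 4 F" and sqf: "squarefree F"
    and p: "\<And>i. p $ i \<in> cuberoot_field" and q: "\<And>i. q $ i \<in> cuberoot_field"
    and e: "\<And>i. e $ i \<in> base_field" and det: "det3 p q e \<noteq> 0"
    and sing: "eval3 F p = 0" "\<And>i. eval3 (partial3 i F) p = 0"
      "eval3 F q = 0" "\<And>i. eval3 (partial3 i F) q = 0"
    and nrat: "\<not> rational p" "\<not> rational q"
  shows "\<exists>a b c d e f. \<not> (a = 0 \<and> b = 0 \<and> c = 0 \<and> d = 0 \<and> e = 0 \<and> f = 0) \<and>
      conic a b c d e f p = 0 \<and> conic a b c d e f q = 0"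
    and "line a' b' c' p = 0 \<Longrightarrow> line a' b' c' q = 0 \<Longrightarrow> a' = 0 \<and> b' = 0 \<and> c' = 0"
proof -
  have FK: "F \<in> carrier (poly_ring3 base_field)" and hom: "homogeneous 4 F"
    using F by (auto simp: plane_curve_def)
  have FL: "F \<in> carrier (poly_ring3 cuberoot_field)" by (rule carrier_base_cuberoot[OF FK])
  have eL: "e $ i \<in> cuberoot_field" for i using e base_subset_cuberoot by blast
  obtain k \<alpha> \<beta> a b c m1 m2 m3 where coeffs: "{k, \<alpha>, \<beta>, a, b, c, m1, m2, m3} \<subseteq> cuberoot_field"
    and ev: "\<And>s r x. eval3 F (s *s p + r *s q + x *s e) =
      k * (s ^ 2 * r ^ 2) + \<alpha> * (s ^ 2 * r * x) + \<beta> * (s * r ^ 2 * x) + a * (s ^ 2 * x ^ 2)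
      + b * (s * r * x ^ 2) + c * (r ^ 2 * x ^ 2) + x ^ 3 * (m1 * s + m2 * r + m3 * x)"
    using singular_pair_expansion[OF FL hom p q eL sing] by metis
  note cc = p q e det FK coeffs ev
  let ?s = "cs p q e" and ?r = "cr p q e" and ?x = "cx p q e"
  have expand: "v = ?s v *s p + ?r v *s q + ?x v *s e" for v
    by (rule coords_expand[OF cc])
  note combine = coords_combine[OF cc]
  have expand_nth: "v $ i = ?s v * p $ i + ?r v * q $ i + ?x v * e $ i" for v i
    using arg_cong[OF expand[of v], of "\<lambda>w. w $ i"] by simp
  have Dpi: "D (p $ i) = ?s (\<chi> i. D (p $ i)) * p $ i + ?r (\<chi> i. D (p $ i)) * q $ i + ?x (\<chi> i. D (p $ i)) * e $ i"
    for D i using expand_nth[of "\<chi> i. D (p $ i)" i] by simp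
  have Dqi: "D (q $ i) = ?s (\<chi> i. D (q $ i)) * p $ i + ?r (\<chi> i. D (q $ i)) * q $ i + ?x (\<chi> i. D (q $ i)) * e $ i"
    for D i using expand_nth[of "\<chi> i. D (q $ i)" i] by simp
  have rel: "2 * k * p2 + \<alpha> * p3 = 0" "2 * k * q1 + \<beta> * q3 = 0"
    "D k = 2 * k * p1 + 2 * k * q2 + \<alpha> * q3 + \<beta> * p3" "\<alpha> * p2 + 2 * a * p3 = 0" "\<beta> * q1 + 2 * c * q3 = 0"
    if "K_derivation D" "\<And>i. D (p $ i) = p1 * p $ i + p2 * q $ i + p3 * e $ i"
      "\<And>i. D (q $ i) = q1 * p $ i + q2 * q $ i + q3 * e $ i" for D p1 p2 p3 q1 q2 q3
    using deriv_relations[OF cc that] by auto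
  have "p \<noteq> 0" "q \<noteq> 0" using det by (auto simp: det3_def)
  obtain D1 where D1: "K_derivation D1" "\<nexists>c. \<forall>i. D1 (p $ i) = c * p $ i"
    using not_rational_deriv[OF \<open>p \<noteq> 0\<close> p nrat(1)] by blast
  obtain D2 where D2: "K_derivation D2" "\<nexists>c. \<forall>i. D2 (q $ i) = c * q $ i"
    using not_rational_deriv[OF \<open>q \<noteq> 0\<close> q nrat(2)] by blast
  \<comment> \<open>Components of \<open>D1 p\<close> and \<open>D2 q\<close> in the adapted basis,
    each derivation being chosen for one of the points. Non-rationality says that \<open>p2\<close>,
    \<open>p3\<close> are not both zero, and likewise \<open>q1\<close>, \<open>q3\<close>.\<close>
  define p2 p3 where "p2 = ?r (\<chi> i. D1 (p $ i))" and "p3 = ?x (\<chi> i. D1 (p $ i))"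
  define q1 q3 where "q1 = ?s (\<chi> i. D2 (q $ i))" and "q3 = ?x (\<chi> i. D2 (q $ i))"
  define p1 q2 where "p1 = ?s (\<chi> i. D1 (p $ i))" and "q2 = ?r (\<chi> i. D2 (q $ i))"
  have "D1 (p $ i) = p1 * p $ i + p2 * q $ i + p3 * e $ i" "D2 (q $ i) = q1 * p $ i + q2 * q $ i + q3 * e $ i" for i
    unfolding p1_def p2_def p3_def q1_def q2_def q3_def by (rule Dpi Dqi)+
  then have p23: "p2 \<noteq> 0 \<or> p3 \<noteq> 0" and q13: "q1 \<noteq> 0 \<or> q3 \<noteq> 0"
    using D1(2) D2(2) by auto
  have two: "(2 :: 'k alg_closure) = - 1"
    using three_eq_0 by (simp add: eq_neg_iff_add_eq_0)
  have rel1: "k * p2 = \<alpha> * p3" "\<alpha> * p2 = a * p3"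
    using rel(1,4)[OF D1(1) Dpi Dqi] unfolding p2_def p3_def two by simp_all
  have rel2: "k * q1 = \<beta> * q3" "\<beta> * q1 = c * q3"
    using rel(2,5)[OF D2(1) Dpi Dqi] unfolding q1_def q3_def two by simp_all
  have k: "k \<noteq> 0"
  proof
    assume k0: "k = 0"
    have a0: "\<alpha> * ?x (\<chi> i. D (p $ i)) = 0" and b0: "\<beta> * ?x (\<chi> i. D (q $ i)) = 0"
      and ab: "\<alpha> * ?x (\<chi> i. D (q $ i)) + \<beta> * ?x (\<chi> i. D (p $ i)) = 0" if "K_derivation D" for D
      using rel(1,2,3)[OF that Dpi Dqi] k0 deriv_to_ac[OF that, of 0] by auto
    \<comment> \<open>Otherwise the relations force \<open>p3 = 0\<close> and then
      \<open>p2 = 0\<close>.\<close>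
    have "\<alpha> = 0"
    proof (rule ccontr)
      assume "\<alpha> \<noteq> 0"
      then have "p3 = 0" using a0[OF D1(1)] by (simp add: p3_def)
      then show False using rel1(2) \<open>\<alpha> \<noteq> 0\<close> p23 by simp
    qed
    moreover have "\<beta> = 0"
    proof (rule ccontr)
      assume "\<beta> \<noteq> 0"
      then have "q3 = 0" using b0[OF D2(1)] by (simp add: q3_def)
      then show False using rel2(2) \<open>\<beta> \<noteq> 0\<close> q13 by simp
    qed
    ultimately have ev0: "eval3 F (s *s p + r *s q + x *s e) =
      x ^ 2 * (a * s ^ 2 + b * (s * r) + c * r ^ 2 + x * (m1 * s + m2 * r + m3 * x))" for s r x
      unfolding ev k0 by (simp add: algebra_simps power2_eq_square power3_eq_cube)
    obtain PS PR PX where P: "\<And>v. eval3 PS v = ?s v" "\<And>v. eval3 PR v = ?r v" "\<And>v. eval3 PX v = ?x v"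
      using coords_polys[OF cc] by metis
    have "F = PX ^ 2 * (const3 a * PS ^ 2 + const3 b * (PS * PR) + const3 c * PR ^ 2
        + PX * (const3 m1 * PS + const3 m2 * PR + const3 m3 * PX))"
    proof (rule eval3_inject[OF inf_ac])
      fix v
      have "eval3 F v = eval3 F (?s v *s p + ?r v *s q + ?x v *s e)" using expand[of v] by simp
      then show "eval3 F v = eval3 (PX ^ 2 * (const3 a * PS ^ 2 + const3 b * (PS * PR) + const3 c * PR ^ 2
        + PX * (const3 m1 * PS + const3 m2 * PR + const3 m3 * PX))) v"
        unfolding ev0 by (simp add: P)
    qed
    \<comment> \<open>Reducedness enters here; \<open>PX\<close> is no unit because it vanishes at
      \<open>p\<close>.\<close>
    then have "PX dvd 1" using sqf unfolding squarefree_def by (metis dvd_triv_left)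
    then obtain U where "1 = PX * U" by (auto simp: dvd_def)
    then have "eval3 (PX * U) p = 1" by (metis eval3_simps(2))
    moreover have "?x p = 0" using combine(3)[of 1 0 0] by simp
    ultimately show False by (simp add: P)
  qed
  have sq1: "\<alpha> ^ 2 = k * a"
  proof -
    \<comment> \<open>As \<open>k\<close> is nonzero, \<open>p3 = 0\<close> would imply
      \<open>p2 = 0\<close>. Eliminating \<open>p2\<close> from the two relations and cancelling
      \<open>p3\<close> gives the claim.\<close>
    have "p3 \<noteq> 0" using rel1(1) k p23 by auto
    have "\<alpha> ^ 2 * p3 = \<alpha> * (k * p2)" unfolding rel1(1) by (simp add: power2_eq_square)
    also have "\<dots> = k * (a * p3)" unfolding rel1(2)[symmetric] by simp
    finally show ?thesis using \<open>p3 \<noteq> 0\<close> by simp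
  qed
  have sq2: "\<beta> ^ 2 = k * c"
  proof -
    have "q3 \<noteq> 0" using rel2(1) k q13 by auto
    have "\<beta> ^ 2 * q3 = \<beta> * (k * q1)" unfolding rel2(1) by (simp add: power2_eq_square)
    also have "\<dots> = k * (c * q3)" unfolding rel2(2)[symmetric] by simp
    finally show ?thesis using \<open>q3 \<noteq> 0\<close> by simp
  qed
  define N where "N v = k ^ 2 * (?s v * ?r v) - k * \<alpha> * (?s v * ?x v) - k * \<beta> * (?r v * ?x v)
    - (k * b + \<alpha> * \<beta>) * ?x v ^ 2" for v
  have N_base: "N v \<in> base_field" if v: "\<forall>i. v $ i \<in> base_field" for v
  proof (rule base_fieldI)
    have "?s v \<in> cuberoot_field" "?r v \<in> cuberoot_field" "?x v \<in> cuberoot_field"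
      using coords_L[OF cc, of v] v base_subset_cuberoot by blast+
    then show "N v \<in> cuberoot_field" unfolding N_def using coeffs by simp
    show "D (N v) = 0" if "K_derivation D" for D
      unfolding N_def by (rule deriv_conic[OF cc that Dpi Dqi sq1 sq2]) (use v in simp)
  qed
  obtain s1 s2 s3 r1 r2 r3 x1 x2 x3 where lin':
    "\<And>v. ?s v = s1 * v $ 1 + s2 * v $ 2 + s3 * v $ 3" "\<And>v. ?r v = r1 * v $ 1 + r2 * v $ 2 + r3 * v $ 3"
    "\<And>v. ?x v = x1 * v $ 1 + x2 * v $ 2 + x3 * v $ 3"
    using coords_linear[OF cc] by metis
  \<comment> \<open>Only the existence of coefficients matters, so closure under products of linear
    forms and differences replaces their computation.\<close>
  define quadr :: "('k alg_closure ^ 3 \<Rightarrow> 'k alg_closure) \<Rightarrow> bool" where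
    "quadr N \<longleftrightarrow> (\<exists>A B C D E G. \<forall>v. N v = A * (v $ 1)\<^sup>2 + B * (v $ 1 * v $ 2) + C * (v $ 1 * v $ 3)
     + D * (v $ 2)\<^sup>2 + E * (v $ 2 * v $ 3) + G * (v $ 3)\<^sup>2)" for N
  have quadr_mult: "quadr (\<lambda>v. t * ((x1 * v $ 1 + x2 * v $ 2 + x3 * v $ 3) * (y1 * v $ 1 + y2 * v $ 2 + y3 * v $ 3)))"
    for t x1 x2 x3 y1 y2 y3
    unfolding quadr_def
    by (rule exI[of _ "t * (x1 * y1)"],
      rule exI[of _ "t * (x1 * y2 + x2 * y1)"],
      rule exI[of _ "t * (x1 * y3 + x3 * y1)"],
      rule exI[of _ "t * (x2 * y2)"],
      rule exI[of _ "t * (x2 * y3 + x3 * y2)"],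
      rule exI[of _ "t * (x3 * y3)"])
      (simp add: algebra_simps power2_eq_square)
  have quadr_diff: "quadr (\<lambda>v. M v - N v)" if MN: "quadr M" "quadr N" for M N
  proof -
    obtain A B C D E G A' B' C' D' E' G' where coeffs:
      "\<And>v. M v = A * (v $ 1)\<^sup>2 + B * (v $ 1 * v $ 2) + C * (v $ 1 * v $ 3)
       + D * (v $ 2)\<^sup>2 + E * (v $ 2 * v $ 3) + G * (v $ 3)\<^sup>2"
      "\<And>v. N v = A' * (v $ 1)\<^sup>2 + B' * (v $ 1 * v $ 2) + C' * (v $ 1 * v $ 3)
       + D' * (v $ 2)\<^sup>2 + E' * (v $ 2 * v $ 3) + G' * (v $ 3)\<^sup>2"
      using MN unfolding quadr_def by blast
    show ?thesis unfolding quadr_def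
      by (rule exI[of _ "A - A'"],
      rule exI[of _ "B - B'"],
      rule exI[of _ "C - C'"],
      rule exI[of _ "D - D'"],
      rule exI[of _ "E - E'"],
      rule exI[of _ "G - G'"]) (simp add: coeffs algebra_simps)
  qed
  have "quadr N"
    unfolding N_def lin' power2_eq_square[of "_ + _"] by (intro quadr_diff quadr_mult)
  then obtain A B C D E G where "\<And>v. N v = A * (v $ 1)\<^sup>2 + B * (v $ 1 * v $ 2) + C * (v $ 1 * v $ 3)
     + D * (v $ 2)\<^sup>2 + E * (v $ 2 * v $ 3) + G * (v $ 3)\<^sup>2" unfolding quadr_def by blast
  from conic_coeffs_base[OF this N_base] obtain a1 b1 c1 d1 e1 f1 where
    N: "\<And>v. N v = conic a1 b1 c1 d1 e1 f1 v" by blast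
  \<comment> \<open>The value at \<open>p + q\<close> ensures that the conic is not the zero
    form.\<close>
  have "N p = 0" "N q = 0" "N (p + q) = k ^ 2"
    using combine[of 1 0 0] combine[of 0 1 0] combine[of 1 1 0] by (simp_all add: N_def)
  then have conic: "conic a1 b1 c1 d1 e1 f1 p = 0" "conic a1 b1 c1 d1 e1 f1 q = 0" "conic a1 b1 c1 d1 e1 f1 (p + q) \<noteq> 0"
    using N k by auto
  show "\<exists>a b c d e f. \<not> (a = 0 \<and> b = 0 \<and> c = 0 \<and> d = 0 \<and> e = 0 \<and> f = 0) \<and>
      conic a b c d e f p = 0 \<and> conic a b c d e f q = 0"
    by (rule exI[of _ a1],
      rule exI[of _ b1],
      rule exI[of _ c1],
      rule exI[of _ d1],
      rule exI[of _ e1],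
      rule exI[of _ f1]) (use conic in \<open>auto simp: conic_def\<close>)
  show "a' = 0 \<and> b' = 0 \<and> c' = 0" if line: "line a' b' c' p = 0" "line a' b' c' q = 0"
  proof (rule ccontr)
    assume ne: "\<not> (a' = 0 \<and> b' = 0 \<and> c' = 0)"
    have lin: "line a' b' c' v = ?s v * line a' b' c' p + ?r v * line a' b' c' q + ?x v * line a' b' c' e" for v
      unfolding line_def expand_nth[of v 1] expand_nth[of v 2] expand_nth[of v 3] by (simp add: algebra_simps)
    have le: "line a' b' c' e \<noteq> 0"
    proof
      assume "line a' b' c' e = 0"
      then have "line a' b' c' v = 0" for v using lin[of v] line by simp
      from this[of "axis 1 1"] this[of "axis 2 1"] this[of "axis 3 1"] show False
        using ne by (simp add: line_def axis_def)
    qed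
    \<comment> \<open>Differentiating the equation of the line at \<open>p\<close> leaves
      \<open>p3\<close> times its nonzero value at \<open>e\<close>, so \<open>p3 = 0\<close>; the
      first relation then gives \<open>p2 = 0\<close>, a contradiction.\<close>
    have "D1 (line a' b' c' p) = line a' b' c' (\<chi> i. D1 (p $ i))"
      using p by (simp add: line_def deriv_simps[OF D1(1)] deriv_to_ac[OF D1(1)])
    then have "line a' b' c' (\<chi> i. D1 (p $ i)) = 0" using line(1) deriv_to_ac[OF D1(1), of 0] by simp
    then have "p3 = 0" using lin[of "\<chi> i. D1 (p $ i)"] line le by (simp add: p3_def)
    then show False using rel1(1) k p23 by simp
  qed
qed

end

subsection \<open>Normal forms\<close>

abbreviation vline :: "'k::Fields.field ^ 3 \<Rightarrow> 'k alg_closure ^ 3 \<Rightarrow> 'k alg_closure" where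
  "vline R \<equiv> line (R $ 1) (R $ 2) (R $ 3)"

definition base_change :: "'k::Fields.field ^ 3 ^ 3 \<Rightarrow> 'k alg_closure ^ 3 ^ 3" where
  "base_change A = (\<chi> i j. to_ac (A $ i $ j))"

text \<open>Equivalently, the three coordinates are linearly independent over
  \<open>K\<close>.\<close>

definition off_lines :: "'k::Fields.field alg_closure ^ 3 \<Rightarrow> bool" where
  "off_lines v \<longleftrightarrow> (\<forall>a b c. line a b c v = 0 \<longrightarrow> a = 0 \<and> b = 0 \<and> c = 0)"

lemma base_change_mult_vec: "(base_change A *v v) $ i = vline (A $ i) v"
  by (simp add: base_change_def matrix_vector_mult_def sum_3 line_def)

lemma vline_base_change: "vline l (base_change A *v v) = vline (l v* A) v"
  by (simp add: line_def base_change_mult_vec vector_matrix_mult_def sum_3 algebra_simps)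

lemma base_change_mult: "base_change (B ** A) *v v = base_change B *v (base_change A *v v)"
  unfolding vec_eq_iff base_change_mult_vec
  by (simp add: line_def base_change_mult_vec matrix_matrix_mult_def sum_3 algebra_simps)

lemma off_lines_base_change:
  assumes "off_lines v" and "invertible A"
  shows "off_lines (base_change A *v v)"
  unfolding off_lines_def
proof (intro allI impI)
  fix a b c assume "line a b c (base_change A *v v) = 0"
  define l where "l = (vector [a, b, c] :: 'a ^ 3)"
  have "vline l (base_change A *v v) = 0" using \<open>line a b c (base_change A *v v) = 0\<close> by (simp add: l_def)
  then have "vline (l v* A) v = 0" by (simp add: vline_base_change)
  then have "l v* A = 0" using assms(1) by (auto simp: off_lines_def vec_eq_iff forall_3)
  moreover obtain B where "A ** B = mat 1" using assms(2) by (auto simp: invertible_def)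
  ultimately have "l = 0" by (metis vector_matrix_mul_assoc vector_matrix_mul_rid vector_matrix_mult_0)
  then show "a = 0 \<and> b = 0 \<and> c = 0" by (auto simp: l_def vec_eq_iff forall_3)
qed

lemma invertible_rows:
  fixes R1 R2 R3 :: "'k::Fields.field ^ 3"
  assumes "det3 R1 R2 R3 \<noteq> 0"
  shows "invertible (vector [R1, R2, R3] :: 'k ^ 3 ^ 3)"
proof -
  have "det (vector [R1, R2, R3] :: 'k ^ 3 ^ 3) = det3 R1 R2 R3"
    by (simp add: det_3 det3_def algebra_simps)
  then show ?thesis using assms by (simp add: invertible_det_nz)
qed

lemma vlines_eq_0:
  assumes "det3 R1 R2 R3 \<noteq> 0" "vline R1 w = 0" "vline R2 w = 0" "vline R3 w = 0"
  shows "w = 0"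
proof -
  have "to_ac (det3 R1 R2 R3) * w $ 1 = vline R1 w * to_ac (R2 $ 2 * R3 $ 3 - R2 $ 3 * R3 $ 2)
      + vline R2 w * to_ac (R3 $ 2 * R1 $ 3 - R3 $ 3 * R1 $ 2) + vline R3 w * to_ac (R1 $ 2 * R2 $ 3 - R1 $ 3 * R2 $ 2)"
    "to_ac (det3 R1 R2 R3) * w $ 2 = vline R1 w * to_ac (R2 $ 3 * R3 $ 1 - R2 $ 1 * R3 $ 3)
      + vline R2 w * to_ac (R3 $ 3 * R1 $ 1 - R3 $ 1 * R1 $ 3) + vline R3 w * to_ac (R1 $ 3 * R2 $ 1 - R1 $ 1 * R2 $ 3)"
    "to_ac (det3 R1 R2 R3) * w $ 3 = vline R1 w * to_ac (R2 $ 1 * R3 $ 2 - R2 $ 2 * R3 $ 1)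
      + vline R2 w * to_ac (R3 $ 1 * R1 $ 2 - R3 $ 2 * R1 $ 1) + vline R3 w * to_ac (R1 $ 1 * R2 $ 2 - R1 $ 2 * R2 $ 1)"
    by (simp_all add: line_def det3_def algebra_simps)
  then show ?thesis using assms by (simp add: vec_eq_iff forall_3)
qed

lemma off_linesD: "off_lines v \<Longrightarrow> line a b c v = 0 \<Longrightarrow> a = 0 \<and> b = 0 \<and> c = 0"
  by (auto simp: off_lines_def)

text \<open>The quadratic formula, with \<open>y\<close> a root of the discriminant. The minus signs
  prepare for the shape \<open>R1^2 - R2 R3\<close> of the conic.\<close>

lemma binary_quadratic_factor:
  fixes d e f :: "'k::Fields.field"
  assumes sqrt: "\<And>x :: 'k. \<exists>y. y ^ 2 = x" and two: "(2 :: 'k) \<noteq> 0"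
  obtains m1 m2 n1 n2 where "d = - (m1 * n1)" "e = - (m1 * n2 + m2 * n1)" "f = - (m2 * n2)"
proof (cases "d = 0")
  case True
  then show ?thesis using that[of 0 e f "- 1"] by simp
next
  case False
  obtain y where y: "y ^ 2 = e ^ 2 - 4 * d * f" using sqrt by blast
  have four: "(4 :: 'k) \<noteq> 0" using two by (metis mult_2 mult_eq_0_iff numeral_Bit0)
  show ?thesis
  proof (rule that[of "- d" 1 "(e + y) / (2 * d)" "- (e - y) / 2"])
    show "d = - (- d * 1)" by simp
    show "e = - (- d * ((e + y) / (2 * d)) + - (e - y) / 2 * 1)"
      using False two four by (simp add: field_simps)
    have "(e - y) * (e + y) = 4 * d * f" using y by (simp add: algebra_simps power2_eq_square)
    then have "(e - y) / 2 * ((e + y) / (2 * d)) = 4 * d * f / (4 * d)" by simp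
    then have "f = (e - y) / 2 * ((e + y) / (2 * d))" using False four by simp
    then show "f = - (- (e - y) / 2 * ((e + y) / (2 * d)))"
      by (simp only: minus_divide_left[symmetric] mult_minus_left minus_minus)
  qed
qed

text \<open>If the first variable occurs squared, completing the square leaves a binary form, which
  factors; otherwise that variable occurs at most linearly. In each case dependent rows would put
  \<open>v\<close> on a line over \<open>K\<close>.\<close>

lemma conic_normal_form:
  fixes v :: "'k::Fields.field alg_closure ^ 3"
  assumes sqrt: "\<And>x :: 'k. \<exists>y. y ^ 2 = x" and two: "(2 :: 'k) \<noteq> 0"
    and nz: "\<not> (a = 0 \<and> b = 0 \<and> c = 0 \<and> d = 0 \<and> e = 0 \<and> f = 0)"
    and conic: "conic a b c d e f v = 0" and off: "off_lines v"
  obtains R1 R2 R3 where "det3 R1 R2 R3 \<noteq> 0"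
    and "\<And>w. conic a b c d e f w = (vline R1 w) ^ 2 - vline R2 w * vline R3 w"
proof (cases "a = 0")
  case False
  obtain \<alpha> where \<alpha>: "\<alpha> ^ 2 = a" using sqrt by blast
  then have \<alpha>0: "\<alpha> \<noteq> 0" using False by auto
  define \<beta> \<gamma> where "\<beta> = b / (2 * \<alpha>)" and "\<gamma> = c / (2 * \<alpha>)"
  have bc: "b = 2 * \<alpha> * \<beta>" "c = 2 * \<alpha> * \<gamma>" using \<alpha>0 two by (simp_all add: \<beta>_def \<gamma>_def)
  obtain m1 m2 n1 n2 where mn: "d - \<beta> ^ 2 = - (m1 * n1)" "e - 2 * \<beta> * \<gamma> = - (m1 * n2 + m2 * n1)"
    "f - \<gamma> ^ 2 = - (m2 * n2)"
    using binary_quadratic_factor[OF sqrt two] by metis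
  have def: "d = \<beta> ^ 2 - m1 * n1" "e = 2 * \<beta> * \<gamma> - (m1 * n2 + m2 * n1)" "f = \<gamma> ^ 2 - m2 * n2"
    using mn by (simp_all add: diff_eq_eq algebra_simps)
  define R1 R2 R3 where "R1 = (vector [\<alpha>, \<beta>, \<gamma>] :: 'k ^ 3)" and "R2 = (vector [0, m1, m2] :: 'k ^ 3)"
    and "R3 = (vector [0, n1, n2] :: 'k ^ 3)"
  have eq: "conic a b c d e f w = (vline R1 w) ^ 2 - vline R2 w * vline R3 w" for w
    unfolding conic_def line_def R1_def R2_def R3_def bc def \<alpha>[symmetric]
    by (simp add: algebra_simps power2_eq_square)
  \<comment> \<open>If the two linear factors were dependent, their product would be zero or the
    square of a linear form over \<open>K\<close>, and the conic would split into lines over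
    \<open>K\<close>.\<close>
  have "m1 * n2 - m2 * n1 \<noteq> 0"
  proof
    assume 0: "m1 * n2 - m2 * n1 = 0"
    have "\<exists>g. \<forall>w. vline R2 w * vline R3 w = (to_ac g * vline R2 w) ^ 2 \<or> vline R2 w * vline R3 w = 0"
    proof (cases "m1 = 0 \<and> m2 = 0")
      case True
      then show ?thesis by (simp add: R2_def line_def)
    next
      case False
      have "\<exists>h. n1 = h * m1 \<and> n2 = h * m2"
      proof (cases "m1 = 0")
        case True
        then show ?thesis using False 0 by (intro exI[of _ "n2 / m2"]) auto
      next
        case m1: False
        have "n2 = n1 / m1 * m2" using 0 m1 by (simp add: field_simps)
        then show ?thesis using m1 by (intro exI[of _ "n1 / m1"]) auto
      qed
      then obtain h where h: "n1 = h * m1" "n2 = h * m2" by blast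
      obtain g where "g ^ 2 = h" using sqrt by blast
      then have "vline R2 w * vline R3 w = (to_ac g * vline R2 w) ^ 2" for w
        by (auto simp: R2_def R3_def line_def h algebra_simps power2_eq_square)
      then show ?thesis by blast
    qed
    then obtain g where "vline R2 v * vline R3 v = (to_ac g * vline R2 v) ^ 2 \<or> vline R2 v * vline R3 v = 0" by blast
    then have "(vline R1 v) ^ 2 = (to_ac g * vline R2 v) ^ 2 \<or> (vline R1 v) ^ 2 = 0"
      using conic eq[of v] by auto
    then have "vline R1 v = to_ac g * vline R2 v \<or> vline R1 v = - (to_ac g * vline R2 v) \<or> vline R1 v = 0"
      by (auto simp: power2_eq_iff)
    moreover have "vline R1 v + to_ac h * vline R2 v = line \<alpha> (\<beta> + h * m1) (\<gamma> + h * m2) v" for h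
      by (simp add: R1_def R2_def line_def algebra_simps)
    then have "vline R1 v + to_ac h * vline R2 v \<noteq> 0" for h
      using off_linesD[OF off] \<alpha>0 by metis
    from this[of g] this[of "- g"] this[of 0]
    have "vline R1 v \<noteq> - (to_ac g * vline R2 v)" "vline R1 v \<noteq> to_ac g * vline R2 v" "vline R1 v \<noteq> 0"
      by (auto simp: eq_neg_iff_add_eq_0)
    ultimately show False by blast
  qed
  then have "det3 R1 R2 R3 \<noteq> 0" using \<alpha>0 by (simp add: det3_def R1_def R2_def R3_def)
  then show ?thesis using that eq by blast
next
  case a: True
  consider "b \<noteq> 0" | "b = 0" "c \<noteq> 0" | "b = 0" "c = 0" by blast
  then show ?thesis
  proof cases
    case 1
    obtain C D E where cde: "c = C * b" "d = D * b" "e = E * b"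
      using 1 by (metis nonzero_divide_eq_eq)
    \<comment> \<open>The first variable is multiplied by a linear form in the other two. Splitting
      off that form as a factor leaves only a multiple of the squared third variable, which becomes
      \<open>R1^2\<close>.\<close>
    obtain \<gamma> where \<gamma>: "\<gamma> ^ 2 = f - E * C * b + D * C ^ 2 * b" using sqrt by blast
    then have f: "f = \<gamma> ^ 2 + E * C * b - D * C ^ 2 * b" by simp
    define R1 R2 R3 where "R1 = (vector [0, 0, \<gamma>] :: 'k ^ 3)" and "R2 = (vector [0, - b, - C * b] :: 'k ^ 3)"
      and "R3 = (vector [1, D, E - C * D] :: 'k ^ 3)"
    have eq: "conic a b c d e f w = (vline R1 w) ^ 2 - vline R2 w * vline R3 w" for w
      unfolding conic_def line_def R1_def R2_def R3_def f cde a
      by (simp add: algebra_simps power2_eq_square)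
    have "\<gamma> \<noteq> 0"
    proof
      assume "\<gamma> = 0"
      then have "vline R2 v = 0 \<or> vline R3 v = 0" using eq[of v] conic by (simp add: R1_def line_def)
      then show False using off_linesD[OF off] 1 unfolding R2_def R3_def by (metis neg_equal_0_iff_equal vector_3(1,2) zero_neq_one)
    qed
    then have "det3 R1 R2 R3 \<noteq> 0" using 1 by (simp add: det3_def R1_def R2_def R3_def)
    then show ?thesis using that eq by blast
  next
    case 2
    obtain \<gamma> where \<gamma>: "\<gamma> ^ 2 = d" using sqrt by blast
    obtain E F where ef: "e = E * c" "f = F * c"
      using 2 by (metis nonzero_divide_eq_eq)
    define R1 R2 R3 where "R1 = (vector [0, \<gamma>, 0] :: 'k ^ 3)" and "R2 = (vector [0, 0, - c] :: 'k ^ 3)"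
      and "R3 = (vector [1, E, F] :: 'k ^ 3)"
    have eq: "conic a b c d e f w = (vline R1 w) ^ 2 - vline R2 w * vline R3 w" for w
      unfolding conic_def line_def R1_def R2_def R3_def \<gamma>[symmetric] a ef 2(1)
      by (simp add: algebra_simps power2_eq_square)
    have "\<gamma> \<noteq> 0"
    proof
      assume "\<gamma> = 0"
      then have "vline R2 v = 0 \<or> vline R3 v = 0" using eq[of v] conic by (simp add: R1_def line_def)
      then show False using off_linesD[OF off] 2 unfolding R2_def R3_def by (metis neg_equal_0_iff_equal vector_3(1,3) zero_neq_one)
    qed
    then have "det3 R1 R2 R3 \<noteq> 0" using 2 by (simp add: det3_def R1_def R2_def R3_def)
    then show ?thesis using that eq by blast
  next
    case 3
    obtain m1 m2 n1 n2 where mn: "d = - (m1 * n1)" "e = - (m1 * n2 + m2 * n1)" "f = - (m2 * n2)"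
      using binary_quadratic_factor[OF sqrt two] by metis
    have "conic a b c d e f v = - (line 0 m1 m2 v * line 0 n1 n2 v)"
      unfolding conic_def line_def mn a 3 by (simp add: algebra_simps power2_eq_square)
    then have "line 0 m1 m2 v = 0 \<or> line 0 n1 n2 v = 0" using conic by simp
    then have "(m1 = 0 \<and> m2 = 0) \<or> (n1 = 0 \<and> n2 = 0)" using off_linesD[OF off] by blast
    then show ?thesis using nz a 3 mn by auto
  qed
qed

context char3_field
begin

definition parabola_normal :: "'k alg_closure ^ 3 \<Rightarrow> 'k alg_closure ^ 3 \<Rightarrow> bool" where
  "parabola_normal v w \<longleftrightarrow> (\<exists>A t u x y. invertible A \<and> t \<in> cuberoot_field \<and> u \<in> cuberoot_field \<and>
     x \<noteq> 0 \<and> y \<noteq> 0 \<and> base_change A *v v = x *s vector [t, t ^ 2, 1] \<and>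
     base_change A *v w = y *s vector [u, u ^ 2, 1])"

lemma parabola_normalI:
  fixes v w :: "'k alg_closure ^ 3"
  assumes "det3 R1 R2 R3 \<noteq> 0" and "\<And>i. v $ i \<in> cuberoot_field" "\<And>i. w $ i \<in> cuberoot_field"
    and "(vline R1 v) ^ 2 = vline R2 v * vline R3 v" "(vline R1 w) ^ 2 = vline R2 w * vline R3 w"
    and "vline R3 v \<noteq> 0" "vline R3 w \<noteq> 0"
  shows "parabola_normal v w"
proof -
  have "base_change (vector [R1, R2, R3]) *v z =
      vline R3 z *s vector [vline R1 z / vline R3 z, (vline R1 z / vline R3 z) ^ 2, 1]"
    if "(vline R1 z) ^ 2 = vline R2 z * vline R3 z" "vline R3 z \<noteq> 0" for z
    unfolding vec_eq_iff forall_3 base_change_mult_vec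
    using that by (simp add: power_divide) (simp add: power2_eq_square)
  moreover have "vline R1 z / vline R3 z \<in> cuberoot_field" if "\<And>i. z $ i \<in> cuberoot_field" for z
    using that by (simp add: line_def)
  ultimately show ?thesis
    unfolding parabola_normal_def using assms invertible_rows[OF assms(1)] by metis
qed

text \<open>The point \<open>v\<close> avoids the lines \<open>R2\<close> and \<open>R3\<close>, so
  only \<open>w\<close> can be at infinity, as (0:1:0). Exchanging \<open>R2\<close> and
  \<open>R3\<close>, a symmetry of the conic, then moves it to (0:0:1).\<close>

lemma parabola_normal_conic:
  fixes v w :: "'k alg_closure ^ 3"
  assumes sqrt: "\<And>x :: 'k. \<exists>y. y ^ 2 = x" and two: "(2 :: 'k) \<noteq> 0"
    and nz: "\<not> (a = 0 \<and> b = 0 \<and> c = 0 \<and> d = 0 \<and> e = 0 \<and> f = 0)"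
    and conic: "conic a b c d e f v = 0" "conic a b c d e f w = 0" and off: "off_lines v"
    and L: "\<And>i. v $ i \<in> cuberoot_field" "\<And>i. w $ i \<in> cuberoot_field" and "w \<noteq> 0"
  shows "parabola_normal v w"
proof -
  obtain R1 R2 R3 where R: "det3 R1 R2 R3 \<noteq> 0"
    "\<And>w. conic a b c d e f w = (vline R1 w) ^ 2 - vline R2 w * vline R3 w"
    using conic_normal_form[OF sqrt two nz conic(1) off] by blast
  have eqs: "(vline R1 v) ^ 2 = vline R2 v * vline R3 v" "(vline R1 w) ^ 2 = vline R2 w * vline R3 w"
    using R(2) conic by auto
  have "R2 \<noteq> 0" "R3 \<noteq> 0" using R(1) by (auto simp: det3_def)
  then have nv: "vline R2 v \<noteq> 0" "vline R3 v \<noteq> 0"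
    using off_linesD[OF off] by (auto simp: vec_eq_iff forall_3)
  show ?thesis
  proof (cases "vline R3 w = 0")
    case False
    then show ?thesis using parabola_normalI[OF R(1) L eqs nv(2)] by blast
  next
    case True
    then have "vline R1 w = 0" using eqs(2) by simp
    then have "vline R2 w \<noteq> 0" using vlines_eq_0[OF R(1)] True \<open>w \<noteq> 0\<close> by blast
    moreover have "det3 R1 R3 R2 \<noteq> 0"
    proof -
      have "det3 R1 R3 R2 = - det3 R1 R2 R3" by (simp add: det3_def algebra_simps)
      then show ?thesis using R(1) by simp
    qed
    ultimately show ?thesis
      using parabola_normalI[of R1 R3 R2 v w] L eqs nv(1) by (simp add: mult.commute)
  qed
qed

lemma parabola_normal_rational:
  fixes v w :: "'k alg_closure ^ 3"
  assumes sqrt: "\<And>x :: 'k. \<exists>y. y ^ 2 = x" and two: "(2 :: 'k) \<noteq> 0"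
    and nz: "\<not> (a = 0 \<and> b = 0 \<and> c = 0 \<and> d = 0 \<and> e = 0 \<and> f = 0)"
    and conic: "conic a b c d e f v = 0" and off: "off_lines v"
    and L: "\<And>i. v $ i \<in> cuberoot_field" "\<And>i. w $ i \<in> cuberoot_field" and "w \<noteq> 0" and rat: "rational w"
  shows "parabola_normal v w"
proof -
  have "v \<noteq> 0" using off_linesD[OF off, of 1 0 0] by (auto simp: line_def)
  \<comment> \<open>The lemma is applied to \<open>v\<close> in both places, just to normalise this
    one point.\<close>
  obtain A t x where A: "invertible A" "t \<in> cuberoot_field" "x \<noteq> 0"
    "base_change A *v v = x *s vector [t, t ^ 2, 1]"
    using parabola_normal_conic[OF sqrt two nz conic conic off L(1) L(1) \<open>v \<noteq> 0\<close>]
    unfolding parabola_normal_def by blast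
  obtain \<tau> where \<tau>: "t ^ 3 = to_ac \<tau>" using A(2) by (auto simp: cuberoot_field_def base_field_def)
  obtain z w0 where w0: "\<And>i. w $ i = z * to_ac (w0 $ i)" using rat unfolding rational_def by blast
  define y where "y = A *v w0"
  define v' w' where "v' = base_change A *v v" and "w' = base_change A *v w"
  have w': "w' $ i = z * to_ac (y $ i)" for i
    unfolding w'_def base_change_mult_vec
    by (simp add: line_def w0 y_def matrix_vector_mult_def sum_3 algebra_simps)
  \<comment> \<open>Values at the rational point of the two conics spanning the pencil. If
    \<open>g1\<close> vanishes, the first conic serves; otherwise \<open>g2\<close> times the first
    minus \<open>g1\<close> times the second does, and it is nonzero because \<open>g1\<close>
    is.\<close>
  define g1 where "g1 = (y $ 1) ^ 2 - y $ 2 * y $ 3"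
  define g2 where "g2 = y $ 1 * y $ 2 - \<tau> * (y $ 3) ^ 2"
  have ex: "\<exists>a b c d e f. \<not> (a = 0 \<and> b = 0 \<and> c = 0 \<and> d = 0 \<and> e = 0 \<and> f = 0) \<and>
      conic a b c d e f v' = 0 \<and> conic a b c d e f w' = 0"
  proof (cases "g1 = 0")
    case True
    then have "to_ac ((y $ 1) ^ 2) - to_ac (y $ 2 * y $ 3) = 0" unfolding g1_def by (metis to_ac_0 to_ac_diff)
    then have "conic 1 0 0 0 (- 1) 0 w' = 0"
      by (simp add: conic_def w' power_mult_distrib power2_eq_square algebra_simps)
    moreover have "conic 1 0 0 0 (- 1) 0 v' = 0"
      unfolding v'_def A(4) by (simp add: conic_def power2_eq_square algebra_simps)
    ultimately show ?thesis
      by (metis zero_neq_one)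
  next
    case False
    have "conic g2 (- g1) 0 0 (- g2) (g1 * \<tau>) w' = z ^ 2 * to_ac (g2 * g1 - g1 * g2)"
      unfolding conic_def w' g1_def g2_def by (simp add: power2_eq_square algebra_simps)
    then have "conic g2 (- g1) 0 0 (- g2) (g1 * \<tau>) w' = 0" by simp
    moreover have "conic g2 (- g1) 0 0 (- g2) (g1 * \<tau>) v' = x ^ 2 * to_ac g1 * (to_ac \<tau> - t ^ 3)"
      unfolding v'_def A(4) by (simp add: conic_def power2_eq_square power3_eq_cube algebra_simps)
    then have "conic g2 (- g1) 0 0 (- g2) (g1 * \<tau>) v' = 0" by (simp add: \<tau>)
    ultimately show ?thesis using False by (metis neg_equal_0_iff_equal)
  qed
  have "off_lines v'" unfolding v'_def by (rule off_lines_base_change[OF off A(1)])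
  have L': "v' $ i \<in> cuberoot_field" "w' $ i \<in> cuberoot_field" for i
    unfolding v'_def w'_def base_change_mult_vec using L by (simp_all add: line_def)
  have "w' \<noteq> 0"
  proof
    assume "w' = 0"
    then have "z * to_ac (y $ i) = 0" for i using w'[of i] by simp
    moreover have "z \<noteq> 0" using w0 \<open>w \<noteq> 0\<close> by (auto simp: vec_eq_iff)
    ultimately have "y = 0" by (simp add: vec_eq_iff)
    then have "w0 = 0" using A(1) unfolding y_def
      by (metis invertible_def matrix_vector_mul_assoc matrix_vector_mul_lid matrix_vector_mult_0_right)
    then show False using w0 \<open>w \<noteq> 0\<close> by (auto simp: vec_eq_iff)
  qed
  then have "parabola_normal v' w'"
    using ex parabola_normal_conic[OF sqrt two _ _ _ \<open>off_lines v'\<close> L'] by blast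
  then obtain B t u x y where "invertible B" "t \<in> cuberoot_field" "u \<in> cuberoot_field" "x \<noteq> 0" "y \<noteq> 0"
    "base_change B *v v' = x *s vector [t, t ^ 2, 1]" "base_change B *v w' = y *s vector [u, u ^ 2, 1]"
    unfolding parabola_normal_def by blast
  then show ?thesis
    unfolding parabola_normal_def v'_def w'_def base_change_mult[symmetric]
    using invertible_mult[OF _ A(1)] by blast
qed

lemma line_pair_normal:
  fixes v w :: "'k alg_closure ^ 3"
  assumes "det3 R1 R2 R0 \<noteq> 0" "vline R2 v = 0" "vline R1 w = 0" "v \<noteq> 0" "w \<noteq> 0"
    and L: "\<And>i. v $ i \<in> cuberoot_field" "\<And>i. w $ i \<in> cuberoot_field"
  obtains A t u x y where "invertible A" "t \<in> cuberoot_field" "u \<in> cuberoot_field"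
     "x \<noteq> 0" "y \<noteq> 0" "base_change A *v v = x *s vector [t, 0, 1]" "base_change A *v w = y *s vector [0, u, 1]"
proof -
  \<comment> \<open>The third row must not vanish at either point. Adding \<open>R1\<close> changes
    its value at \<open>v\<close> but not at \<open>w\<close>, adding \<open>R2\<close> does the
    converse, and neither changes the determinant.\<close>
  define a where "a = (if vline R0 v = 0 then R1 else 0)"
  define b where "b = (if vline R0 w = 0 then R2 else 0)"
  define R3 where "R3 = R0 + a + b"
  have "vline R3 z = vline R0 z + vline a z + vline b z" for z
    by (simp add: R3_def line_def algebra_simps)
  moreover have "vline a w = 0" "vline b v = 0" "vline R0 v = 0 \<Longrightarrow> vline a v \<noteq> 0" "vline R0 v \<noteq> 0 \<Longrightarrow> vline a v = 0"
    "vline R0 w = 0 \<Longrightarrow> vline b w \<noteq> 0" "vline R0 w \<noteq> 0 \<Longrightarrow> vline b w = 0"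
    using vlines_eq_0[OF assms(1)] assms(2-5) by (auto simp: a_def b_def) (auto simp: line_def)
  ultimately have nz: "vline R3 v \<noteq> 0" "vline R3 w \<noteq> 0"
    by (cases "vline R0 v = 0"; cases "vline R0 w = 0"; simp)+
  have "det3 R1 R2 R3 = det3 R1 R2 R0"
    by (auto simp: R3_def a_def b_def det3_def algebra_simps)
  then have "invertible (vector [R1, R2, R3] :: 'k ^ 3 ^ 3)" using assms(1) by (intro invertible_rows) simp
  moreover have "base_change (vector [R1, R2, R3]) *v v = vline R3 v *s vector [vline R1 v / vline R3 v, 0, 1]"
    "base_change (vector [R1, R2, R3]) *v w = vline R3 w *s vector [0, vline R2 w / vline R3 w, 1]"
    unfolding vec_eq_iff forall_3 base_change_mult_vec using nz assms(2,3) by simp_all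
  moreover have "vline R1 v / vline R3 v \<in> cuberoot_field" "vline R2 w / vline R3 w \<in> cuberoot_field"
    using L by (simp_all add: line_def)
  ultimately show ?thesis using that nz by blast
qed

lemma rational_second_line:
  fixes v :: "'k alg_closure ^ 3"
  assumes "rational v" "v \<noteq> 0" "l \<noteq> 0" "vline l v = 0"
  obtains R z where "vline R v = 0" "det3 l R z \<noteq> 0"
proof -
  obtain c w where c: "c \<noteq> 0" and w: "\<And>i. v $ i = c * to_ac (w $ i)"
    using assms(1) unfolding rational_def by blast
  have "c * to_ac (l $ 1 * w $ 1 + l $ 2 * w $ 2 + l $ 3 * w $ 3) = 0"
    using assms(4) by (simp add: line_def w algebra_simps)
  then have lw: "l $ 1 * w $ 1 + l $ 2 * w $ 2 + l $ 3 * w $ 3 = 0"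
    using c by (simp only: mult_eq_0_iff to_ac_eq_0_iff) simp
  obtain i where i: "w $ i \<noteq> 0" using assms(2) w by (auto simp: vec_eq_iff)
  \<comment> \<open>Cross products of \<open>w\<close> with the coordinate vectors: the lines
    joining the point to the coordinate points. Below, the triple product identity selects one that
    differs from \<open>l\<close>.\<close>
  define R where "R k = (if k = 1 then vector [0, w $ 3, - w $ 2] else
     if k = 2 then vector [- w $ 3, 0, w $ 1] else vector [w $ 2, - w $ 1, 0] :: 'k ^ 3)" for k :: 3
  have R: "vline (R k) v = 0" for k
    by (auto simp: R_def line_def w algebra_simps)
  obtain k where k: "l $ k \<noteq> 0" using assms(3) by (auto simp: vec_eq_iff)
  have "det3 l (R k) z = l $ k * (w $ 1 * z $ 1 + w $ 2 * z $ 2 + w $ 3 * z $ 3)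
      - z $ k * (l $ 1 * w $ 1 + l $ 2 * w $ 2 + l $ 3 * w $ 3)" for z
    using exhaust_3[of k] by (elim disjE) (simp_all add: det3_def R_def algebra_simps)
  then have "det3 l (R k) (axis i 1) = l $ k * w $ i"
    unfolding lw using exhaust_3[of i] by (auto simp: axis_def)
  then have "det3 l (R k) (axis i 1) \<noteq> 0" using k i by simp
  then show ?thesis using that R by blast
qed

lemma proportional_lines:
  fixes l m :: "'k ^ 3"
  assumes "\<And>z. det3 l m z = 0" "m \<noteq> 0" "vline m w = 0"
  shows "vline l w = 0"
proof -
  obtain k where k: "m $ k \<noteq> 0" using assms(2) by (auto simp: vec_eq_iff)
  have "l $ 2 * m $ 3 = l $ 3 * m $ 2" "l $ 1 * m $ 3 = l $ 3 * m $ 1" "l $ 1 * m $ 2 = l $ 2 * m $ 1"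
    using assms(1)[of "axis 1 1"] assms(1)[of "axis 2 1"] assms(1)[of "axis 3 1"]
    by (simp_all add: det3_def axis_def)
  then have "l $ i * m $ k = l $ k * m $ i" for i
    using exhaust_3[of i] exhaust_3[of k] by auto
  then have eq: "to_ac (l $ i) * to_ac (m $ k) = to_ac (l $ k) * to_ac (m $ i)" for i
    by (metis to_ac_mult)
  have "vline l w * to_ac (m $ k) = (to_ac (l $ 1) * to_ac (m $ k)) * w $ 1 + (to_ac (l $ 2) * to_ac (m $ k)) * w $ 2
    + (to_ac (l $ 3) * to_ac (m $ k)) * w $ 3"
    by (simp add: line_def algebra_simps)
  also have "\<dots> = to_ac (l $ k) * vline m w"
    unfolding eq by (simp add: line_def algebra_simps)
  finally show ?thesis using k assms(3) by simp
qed

end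

subsection \<open>The base field\<close>

lemma separably_closed_sqrt:
  assumes "separably_closed TYPE('k::Fields.field)" and two: "(2 :: 'k) \<noteq> 0"
  shows "\<exists>y. y ^ 2 = (x :: 'k)"
proof (cases "x = 0")
  case True
  then show ?thesis by (intro exI[of _ 0]) simp
next
  case False
  let ?p = "[:- x, 0, 1:]"
  have pd: "pderiv ?p = [:0, 2:]" by (simp add: pderiv_pCons)
  have "coprime ?p (pderiv ?p)"
  proof (rule coprimeI)
    fix c assume c: "c dvd ?p" "c dvd pderiv ?p"
    \<comment> \<open>A combination of the polynomial and its derivative is a nonzero
      constant.\<close>
    have "[:0, 1 / 2:] * pderiv ?p - ?p = [:x:]" using two by (simp add: pd)
    moreover have "c dvd [:0, 1 / 2:] * pderiv ?p - ?p" using c by (intro dvd_diff dvd_mult)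
    ultimately have "c dvd [:x:]" by simp
    moreover have "[:x:] dvd 1" using False by (simp add: is_unit_const_poly_iff dvd_field_iff)
    ultimately show "is_unit c" by (rule dvd_trans)
  qed
  then obtain y where "Polynomial.poly ?p y = 0"
    using assms(1) unfolding separably_closed_def by force
  then show ?thesis by (intro exI[of _ y]) (simp add: power2_eq_square algebra_simps)
qed

text \<open>In a finite field of odd characteristic squaring is not injective, hence not surjective.\<close>

lemma infinite_if_sqrt:
  assumes sqrt: "\<And>x :: 'k::Fields.field. \<exists>y. y ^ 2 = x" and two: "(2 :: 'k) \<noteq> 0"
  shows "infinite (UNIV :: 'k set)"
proof
  assume fin: "finite (UNIV :: 'k set)"
  have "surj (\<lambda>y :: 'k. y ^ 2)" using sqrt by (metis surjI)
  then have "inj (\<lambda>y :: 'k. y ^ 2)" using fin finite_UNIV_surj_inj by blast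
  then have "(1 :: 'k) = - 1" by (rule injD) simp
  then show False using two by (simp add: eq_neg_iff_add_eq_0)
qed

section \<open>From points as ideals to coordinate vectors\<close>

context char3_field
begin

text \<open>\<open>F\<close> and its partial derivatives are defined over \<open>K\<close>, so lying
  in \<open>r\<close> puts them into the contraction \<open>P\<close>, which is contained in
  \<open>P1\<close>. The points \<open>r\<close> and \<open>P1\<close> are never compared
  directly.\<close>

lemma singular_at_point:
  fixes F :: "'k alg_closure poly3"
  assumes F: "F \<in> carrier (poly_ring3 base_field)" and "nonsmooth_at F P" and "lies_over base_field P1 P"
    and P1: "P1 = point_ideal cuberoot_field v"
  shows "eval3 F v = 0" "eval3 (partial3 i F) v = 0"
proof -
  obtain r where r: "r \<inter> carrier (poly_ring3 base_field) = P" "F \<in> r" "partial_derivs F \<subseteq> r"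
    using assms(2) unfolding nonsmooth_at_def lies_over_def by blast
  have P: "P \<subseteq> P1" using assms(3) unfolding lies_over_def by blast
  have "eval3 G v = 0" if "G \<in> P1" for G
  proof -
    have "eval3 G (1 *s v) = 0"
      using that unfolding P1 point_ideal_eq[OF inf_ac is_subring_cuberoot] by blast
    then show ?thesis by simp
  qed
  moreover have "F \<in> P1" using F r P by blast
  moreover have "partial3 i F \<in> P1"
    using partial3_carrier[OF is_subring_base F, of i] r(1,3) P unfolding partial_derivs_eq by blast
  ultimately show "eval3 F v = 0" "eval3 (partial3 i F) v = 0" by auto
qed

text \<open>If no coordinate vector completed \<open>v\<close>, \<open>w\<close> to a basis, all
  their two by two minors would vanish and the points would coincide.\<close>

lemma det3_nonzero:
  fixes v w :: "'k alg_closure ^ 3"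
  assumes "v \<noteq> 0" "w \<noteq> 0" "point_ideal cuberoot_field v \<noteq> point_ideal cuberoot_field w"
  obtains e where "\<And>i. e $ i \<in> base_field" "det3 v w e \<noteq> 0"
proof -
  have "\<exists>j. det3 v w (axis j 1) \<noteq> 0"
  proof (rule ccontr)
    assume "\<not> ?thesis"
    then have "det3 v w (axis j 1) = 0" for j by blast
    from this[of 1] this[of 2] this[of 3]
    have *: "v $ 2 * w $ 3 = v $ 3 * w $ 2" "v $ 1 * w $ 3 = v $ 3 * w $ 1" "v $ 1 * w $ 2 = v $ 2 * w $ 1"
      by (simp_all add: det3_def axis_def)
    obtain k where k: "w $ k \<noteq> 0" using assms(2) by (auto simp: vec_eq_iff)
    have "v $ i * w $ k = v $ k * w $ i" for i
      using * exhaust_3[of i] exhaust_3[of k] by auto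
    then have "v = (v $ k / w $ k) *s w" using k by (simp add: vec_eq_iff field_simps)
    moreover from this have "v $ k / w $ k \<noteq> 0" using assms(1) by auto
    ultimately show False
      using point_ideal_smult[OF inf_ac is_subring_cuberoot, of "v $ k / w $ k" w] assms(3) by simp
  qed
  then obtain j where j: "det3 v w (axis j 1) \<noteq> 0" by blast
  moreover have "(axis j 1 :: 'k alg_closure ^ 3) $ i \<in> base_field" for i
    using is_subring_base is_subring_0[OF is_subring_base] by (auto simp: axis_def is_subring_def)
  ultimately show ?thesis using that by blast
qed

lemma one_type_2_off_lines:
  assumes "one_type (point_ideal cuberoot_field v) = 2"
  shows "off_lines (v :: 'k alg_closure ^ 3)"
  unfolding off_lines_def
proof (intro allI impI, rule ccontr)
  fix a b c assume line: "line a b c v = 0" and ne: "\<not> (a = 0 \<and> b = 0 \<and> c = 0)"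
  obtain H where "plane_curve base_field 1 H" "eval3 H v = 0"
    using plane_curve_linear[of a b c] ne line unfolding line_def by metis
  then show False using one_type_le assms by fastforce
qed

lemma one_type_2_conic:
  fixes v :: "'k alg_closure ^ 3"
  assumes "one_type (point_ideal cuberoot_field v) = 2" "v \<noteq> 0" "\<And>i. v $ i \<in> cuberoot_field"
  obtains a b c d e f where "\<not> (a = 0 \<and> b = 0 \<and> c = 0 \<and> d = 0 \<and> e = 0 \<and> f = 0)" "conic a b c d e f v = 0"
proof -
  obtain H where H: "plane_curve base_field 2 H" "eval3 H v = 0"
    using one_type_witness[OF assms(2,3)] unfolding assms(1) by blast
  show ?thesis
    using quadratic_form_coeffs[OF H(1), folded conic_def] H(2) that by metis
qed

lemma one_type_1_line:
  fixes v :: "'k alg_closure ^ 3"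
  assumes "one_type (point_ideal cuberoot_field v) = 1" "v \<noteq> 0" "\<And>i. v $ i \<in> cuberoot_field"
  obtains l where "l \<noteq> 0" "vline l v = 0"
proof -
  obtain H where H: "plane_curve base_field 1 H" "eval3 H v = 0"
    using one_type_witness[OF assms(2,3)] unfolding assms(1) by blast
  obtain a b c where "a \<noteq> 0 \<or> b \<noteq> 0 \<or> c \<noteq> 0" "line a b c v = 0"
    using linear_form_coeffs[OF H(1), folded line_def] H(2) by metis
  then show ?thesis
    by (intro that[of "vector [a, b, c]"]) (auto simp: vec_eq_iff forall_3)
qed

lemma X_equivalentI:
  fixes v w v' w' :: "'k alg_closure ^ 3"
  assumes "invertible A" "x \<noteq> 0" "y \<noteq> 0" "base_change A *v v = x *s v'" "base_change A *v w = y *s w'"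
  shows "X_equivalent {point_ideal cuberoot_field v, point_ideal cuberoot_field w}
    {point_ideal cuberoot_field v', point_ideal cuberoot_field w'}"
  unfolding X_equivalent_def
  by (intro exI[of _ A])
    (simp add: assms X_automorphism_image_point_ideal base_change_def[symmetric]
      point_ideal_smult[OF inf_ac is_subring_cuberoot])

lemma off_lines_not_rational:
  assumes "off_lines v" shows "\<not> rational v"
proof
  assume "rational v"
  then obtain c w where w: "\<And>i. v $ i = c * to_ac (w $ i)" unfolding rational_def by blast
  have "line 0 (w $ 3) (- (w $ 2)) v = 0" "line (w $ 3) 0 (- (w $ 1)) v = 0"
    by (simp_all add: line_def w)
  then have "w $ 1 = 0 \<and> w $ 2 = 0 \<and> w $ 3 = 0" using off_linesD[OF assms] by fastforce
  then have "line 1 0 0 v = 0" by (simp add: line_def w)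
  then show False using off_linesD[OF assms] by fastforce
qed

end

theorem proposition5p14:
  fixes F :: "'k::Fields.field alg_closure poly3"
    and P Q P1 Q1 :: "'k alg_closure poly3 set"
  assumes "CHAR('k) = 3" and "\<not> perfect_field TYPE('k)" and "separably_closed TYPE('k)"
    and "plane_curve base_field 4 F" and "geometrically_reduced F"
    and "plane_point base_field P" and "plane_point base_field Q" and "P \<noteq> Q"
    and "nonsmooth_at F P" and "nonsmooth_at F Q"
    and "plane_point cuberoot_field P1" and "lies_over base_field P1 P"
    and "plane_point cuberoot_field Q1" and "lies_over base_field Q1 Q"
    and "rational_point cuberoot_field P1" and "rational_point cuberoot_field Q1"
    and "one_type P1 \<in> {1, 2}" and "one_type Q1 \<in> {1, 2}"
  shows "\<exists>u\<in>cuberoot_field. \<exists>t\<in>cuberoot_field.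
    (one_type P1 = 2 \<or> one_type Q1 = 2 \<longrightarrow>
      X_equivalent {P1, Q1}
        {point_ideal cuberoot_field (vector [t, t ^ 2, 1]),
         point_ideal cuberoot_field (vector [u, u ^ 2, 1])}) \<and>
    (\<not> (one_type P1 = 2 \<or> one_type Q1 = 2) \<longrightarrow>
      X_equivalent {P1, Q1}
        {point_ideal cuberoot_field (vector [t, 0, 1]),
         point_ideal cuberoot_field (vector [0, u, 1])})"
proof -
  have two: "(2 :: 'k) \<noteq> 0"
  proof
    assume "(2 :: 'k) = 0"
    then have "of_nat 2 = (0 :: 'k)" by simp
    then have "CHAR('k) dvd 2" by (simp only: of_nat_eq_0_iff_char_dvd)
    then show False using assms(1) by (auto dest: dvd_imp_le)
  qed
  have sqrt: "\<exists>y. y ^ 2 = x" for x :: 'k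
    by (rule separably_closed_sqrt[OF assms(3) two])
  interpret char3_field "TYPE('k)"
    using assms(1) infinite_if_sqrt[OF sqrt two] by unfold_locales
  obtain v where v: "v \<noteq> 0" "\<And>i. v $ i \<in> cuberoot_field" and P1: "P1 = point_ideal cuberoot_field v"
    using assms(15) unfolding rational_point_def by blast
  obtain w where w: "w \<noteq> 0" "\<And>i. w $ i \<in> cuberoot_field" and Q1: "Q1 = point_ideal cuberoot_field w"
    using assms(16) unfolding rational_point_def by blast
  have FK: "F \<in> carrier (poly_ring3 base_field)" using assms(4) by (simp add: plane_curve_def)
  have "P1 \<noteq> Q1" using assms(8,12,14) unfolding lies_over_def by blast
  note sv = singular_at_point[OF FK assms(9,12) P1] and sw = singular_at_point[OF FK assms(10,14) Q1]
  obtain e where e: "\<And>i. e $ i \<in> base_field" "det3 v w e \<noteq> 0"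
    using det3_nonzero[OF v(1) w(1)] \<open>P1 \<noteq> Q1\<close> unfolding P1 Q1 by blast
  note conic = conic_through_singular_points[OF assms(4) assms(5)[unfolded geometrically_reduced_def]
    v(2) w(2) e sv(1,2) sw(1,2)]
  have "det3 w v e \<noteq> 0" using e(2) by (simp add: det3_def algebra_simps)
  \<comment> \<open>The points exchanged, for the case that only the second is known to have 1-type
    2.\<close>
  note conic' = conic_through_singular_points[OF assms(4) assms(5)[unfolded geometrically_reduced_def]
    w(2) v(2) e(1) this sw(1,2) sv(1,2)]
  show ?thesis
  proof (cases "one_type P1 = 2 \<or> one_type Q1 = 2")
    case True
    \<comment> \<open>Here \<open>y\<close> is a point of 1-type 2, hence not rational; rationality
      of \<open>z\<close> decides between the pencil and the conic through both singular
      points.\<close>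
    have normal: "parabola_normal y z"
      if yz: "one_type (point_ideal cuberoot_field y) = 2" "y \<noteq> 0" "z \<noteq> 0"
        "\<And>i. y $ i \<in> cuberoot_field" "\<And>i. z $ i \<in> cuberoot_field"
        and cz: "\<not> rational y \<Longrightarrow> \<not> rational z \<Longrightarrow>
          \<exists>a b c d e f. \<not> (a = 0 \<and> b = 0 \<and> c = 0 \<and> d = 0 \<and> e = 0 \<and> f = 0) \<and>
            conic a b c d e f y = 0 \<and> conic a b c d e f z = 0" for y z
    proof (cases "rational z")
      case True
      obtain a b c d e f where "\<not> (a = 0 \<and> b = 0 \<and> c = 0 \<and> d = 0 \<and> e = 0 \<and> f = 0)" "conic a b c d e f y = 0"
        using one_type_2_conic[OF yz(1,2,4)] by metis
      then show ?thesis
        using parabola_normal_rational[OF sqrt two _ _ one_type_2_off_lines[OF yz(1)] yz(4,5,3) True] by blast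
    next
      case False
      have off: "off_lines y" by (rule one_type_2_off_lines[OF yz(1)])
      obtain a b c d e f where "\<not> (a = 0 \<and> b = 0 \<and> c = 0 \<and> d = 0 \<and> e = 0 \<and> f = 0)"
        "conic a b c d e f y = 0" "conic a b c d e f z = 0"
        using cz[OF off_lines_not_rational[OF off] False] by metis
      then show ?thesis by (rule parabola_normal_conic[OF sqrt two _ _ _ off yz(4,5,3)])
    qed
    have "\<exists>A t u x y. invertible A \<and> t \<in> cuberoot_field \<and> u \<in> cuberoot_field \<and> x \<noteq> 0 \<and> y \<noteq> 0 \<and>
        base_change A *v v = x *s vector [t, t ^ 2, 1] \<and> base_change A *v w = y *s vector [u, u ^ 2, 1]"
    proof (cases "one_type P1 = 2")
      case True
      then show ?thesis
        using normal[OF _ v(1) w(1) v(2) w(2)] conic(1) unfolding P1 parabola_normal_def by blast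
    next
      case False
      then have "one_type Q1 = 2" using True by blast
      then have "parabola_normal w v"
        using normal[OF _ w(1) v(1) w(2) v(2)] conic'(1) unfolding Q1 by blast
      then show ?thesis unfolding parabola_normal_def by blast
    qed
    then obtain A t u x y where "invertible A" "t \<in> cuberoot_field" "u \<in> cuberoot_field" "x \<noteq> 0" "y \<noteq> 0"
      "base_change A *v v = x *s vector [t, t ^ 2, 1]" "base_change A *v w = y *s vector [u, u ^ 2, 1]" by metis
    then show ?thesis using X_equivalentI True unfolding P1 Q1 by metis
  next
    case False
    then have "one_type P1 = 1" "one_type Q1 = 1" using assms(17,18) by auto
    obtain l where l: "l \<noteq> 0" "vline l v = 0"
      using one_type_1_line[OF _ v] \<open>one_type P1 = 1\<close> unfolding P1 by metis
    obtain m where m: "m \<noteq> 0" "vline m w = 0"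
      using one_type_1_line[OF _ w] \<open>one_type Q1 = 1\<close> unfolding Q1 by metis
    have flip: "det3 a b c = - det3 b a c" for a b c :: "'k ^ 3" by (simp add: det3_def algebra_simps)
    \<comment> \<open>Two distinct lines over \<open>K\<close> are wanted, one through each point,
      to serve as coordinate axes.\<close>
    have "\<exists>R1 R2 R0. det3 R1 R2 R0 \<noteq> 0 \<and> vline R2 v = 0 \<and> vline R1 w = 0"
    proof (cases "\<exists>z. det3 l m z \<noteq> 0")
      case True
      then show ?thesis using l m flip by (metis neg_equal_0_iff_equal)
    next
      case False
      then have lw: "vline l w = 0" by (intro proportional_lines[of l m]) (use m in auto)
      \<comment> \<open>If the two lines coincide, both points lie on one line over
        \<open>K\<close>, so one of them is rational and a second line over \<open>K\<close> passes
        through it.\<close>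
      have "rational v \<or> rational w"
        using conic(2)[OF _ _ l(2) lw] l(1) by (auto simp: vec_eq_iff forall_3)
      then show ?thesis
      proof
        assume "rational v"
        then obtain R z where "vline R v = 0" "det3 l R z \<noteq> 0" using rational_second_line v(1) l by metis
        then show ?thesis using lw by blast
      next
        assume "rational w"
        then obtain R z where "vline R w = 0" "det3 l R z \<noteq> 0" using rational_second_line w(1) l(1) lw by metis
        then show ?thesis using l(2) flip by (metis neg_equal_0_iff_equal)
      qed
    qed
    then obtain R1 R2 R0 where R: "det3 R1 R2 R0 \<noteq> 0" "vline R2 v = 0" "vline R1 w = 0" by blast
    obtain A t u x y where "invertible A" "t \<in> cuberoot_field" "u \<in> cuberoot_field"
     "x \<noteq> 0" "y \<noteq> 0" "base_change A *v v = x *s vector [t, 0, 1]" "base_change A *v w = y *s vector [0, u, 1]"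
      using line_pair_normal[OF R v(1) w(1) v(2) w(2)] by metis
    then show ?thesis using X_equivalentI False unfolding P1 Q1 by metis
  qed
qed

end
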